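(* Let the approximating chain $\{(\xi^h_n,\alpha^h_n),n<\infty\}$ with the transition probabilities described in the context be locally consistent with the controlled surplus diffusion, let $m^h(\cdot)$ be the relaxed control representation of the controls $\{u^h_n\}$, let $(\xi^h(\cdot),\alpha^h(\cdot))$ be the continuous-time interpolation, and let $\{\hat\xi^h(\cdot),\hat\alpha^h(\cdot),\hat m^h(\cdot),\hat W^h(\cdot),\hat z^h(\cdot),\hat g^h(\cdot),\hat T^h(\cdot)\}$ be the corresponding rescaled processes. Then the family $\{\hat\xi^h(\cdot),\hat\alpha^h(\cdot),\hat m^h(\cdot),\hat W^h(\cdot),\hat z^h(\cdot),\hat g^h(\cdot),\hat T^h(\cdot)\}_{h>0}$ is tight.
   Context: Setting: $\mathcal{M}=\{0,\dots,m_0-1\}$, irreducible generator $Q=(q_{ij})$. Control set $U=\{(a,s,l): a\in[M_a,1], s\in[0,M_s], l\in[M_l,1], s+l\le1\}$. For $i\in\mathcal{M}$: bounded $\mu_C(i),\sigma_C(i),\sigma_S(i)>0$, $r_1(i)\ge r_2$, $c(i)=(1+\rho)\mu_C(i)$, $\Psi(a,i)=(1+\beta)(1-a)\mu_C(i)$, $\beta>\rho>0$, $K>0$; $b(x,i,u)=c(i)-\Psi(a,i)-a\mu_C(i)+[sr_1(i)+(1-s-l)r_2-l](x-K)^+$, $\sigma^2(x,i,u)=a^2\sigma_C^2(i)+s^2\sigma_S^2(i)((x-K)^+)^2$. The controlled surplus diffusion is $\mathrm{d}X=b(X,\alpha,u)\mathrm{d}t+\sigma(X,\alpha,u)\mathrm{d}W$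 with regime chain $\alpha$ of generator $Q$. Approximating chain: $S_h=\{kh:|kh|\le B+h\}$ ($B$ a multiple of $h$); $\{(\xi^h_n,\alpha^h_n)\}$ on $S_h\times\mathcal{M}$ with admissible controls $u^h_n\in U$. For $|x|\le B$ (regular step, $I^h_n=0$), with $D=\sigma^2+h|b|-h^2q_{ii}$ evaluated at $(x,i,u)$: move to $(x\pm h,i)$ with probability $(\sigma^2/2+h[b]^\pm)/D$, to $(x,j)$, $j\ne i$, with probability $q_{ij}h^2/D$, with interpolation interval $\Delta t^h(x,i,u,0)=h^2/D$. At $x=-(B+h)$ the chain moves to $-B$ (left reflection, $I^h_n=1$, $\Delta z^h_n=h$), at $x=B+h$ to $B$ (right reflection, $I^h_n=2$, $\Delta g^h_n=h$), in zero time. Local consistency means: given the past and $\xi^h_n=x,\alpha^h_n=i,I^h_n=0,u^h_n=u$, $\mathbb{E}\Delta\xi^h_n=b(x,i,u)\Delta t^h+o(\Delta t^h)$, $\mathrm{Var}\,\Delta\xi^h_n=\sigma^2(x,i,u)\Delta t^h+o(\Delta t^h)$, $\mathbb{P}(\alpha^h_{n+1}=j)=q_{ij}\Delta t^h+o(\Delta t^h)$ for $j\ne i$, $\mathbb{P}(\alpha^h_{n+1}=i)=1+q_{ii}\Delta t^h+o(\Delta t^h)$, and $\sup_{n,\omega}|\Delta\xi^h_n|\to0$ as $h\to0$, where $\Delta\xi^h_n=\xi^h_{n+1}-\xi^h_n$, $\Delta t^h=\Delta t^h(x,i,u,0)$. Interpolations: $\Delta t^h_k=\Delta t^h(\xi^h_k,\alpha^h_k,u^h_k,0)\mathbf{1}\{I^h_k=0\}$,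 $t^h_n=\sum_{k<n}\Delta t^h_k$, $n^h(t)=\max\{n:t^h_n\le t\}$; $\xi^h(t)=\xi^h_n$, $\alpha^h(t)=\alpha^h_n$, $u^h(t)=u^h_n$ for $t\in[t^h_n,t^h_{n+1})$; $z^h(t)=\sum_{k\le n^h(t)}\Delta z^h_k\mathbf{1}\{I^h_k=1\}$, $g^h(t)=\sum_{k\le n^h(t)}\Delta g^h_k\mathbf{1}\{I^h_k=2\}$; $W^h(t)=\sum_{k<n^h(t),\,I^h_k=0}(\Delta\xi^h_k-\mathbb{E}^h_k\Delta\xi^h_k)/\sigma(\xi^h_k,\alpha^h_k,u^h_k)$, with $\mathbb{E}^h_k$ the conditional expectation given the past up to step $k$. The relaxed control representation of $u^h$ is the measure $m^h$ on $\mathcal{B}(U\times[0,\infty))$ with $m^h(\mathrm{d}\phi\,\mathrm{d}t)=\delta_{u^h(t)}(\mathrm{d}\phi)\mathrm{d}t$ (relaxed controls carry the weak topology on measures on $U\times[0,T]$ for each $T$). Rescaling: $\Delta\hat t^h_n=\Delta t^h_n$ on regular steps and $=h$ on reflection steps, $\hat t^h_n=\sum_{k<n}\Delta\hat t^h_k$, $\hat T^h(t)=t^h_n$ for $t\in[\hat t^h_n,\hat t^h_{n+1})$, and $\hat\psi^h(t)=\psi^h(\hat T^h(t))$ for each of $\psi^h=\xi^h,\alpha^h,W^h,z^h,g^h,u^h$; $\hat m^h$ is the relaxed control representation of $\hat u^h$ in the rescaled time. Tightness is in the Skorokhod space $D[0,\infty)$ for the path processes and in the space of relaxed controls for $\hat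 m^h$. *)

theory Defs
  imports "HOL-Probability.Probability"
begin

type_synonym ctrl = "real \<times> real \<times> real"

record model =
  m0    :: nat                       (* regimes {0..<m0} *)
  Q     :: "nat \<Rightarrow> nat \<Rightarrow> real"
  muC   :: "nat \<Rightarrow> real"
  sigC  :: "nat \<Rightarrow> real"
  sigS  :: "nat \<Rightarrow> real"
  r1    :: "nat \<Rightarrow> real"
  r2    :: real
  rho   :: real
  beta  :: real
  Kc    :: real
  Ma    :: real
  Ms    :: real
  Ml    :: real

definition Uset :: "model \<Rightarrow> ctrl set" where
  "Uset P = {(a,s,l). Ma P \<le> a \<and> a \<le> 1 \<and> 0 \<le> s \<and> s \<le> Ms P \<and> Ml P \<le> l \<and> l \<le> 1 \<and> s + l \<le> 1}"

definition irreducible_generator :: "nat \<Rightarrow> (nat \<Rightarrow> nat \<Rightarrow> real) \<Rightarrow> bool" where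
  "irreducible_generator m q \<longleftrightarrow>
     (\<forall>i<m. \<forall>j<m. i \<noteq> j \<longrightarrow> 0 \<le> q i j) \<and>
     (\<forall>i<m. (\<Sum>j<m. q i j) = 0) \<and>
     (\<forall>i<m. \<forall>j<m. (\<lambda>a b. a < m \<and> b < m \<and> a \<noteq> b \<and> 0 < q a b)\<^sup>*\<^sup>* i j)"

definition model_assms :: "model \<Rightarrow> bool" where
  "model_assms P \<longleftrightarrow> 1 \<le> m0 P \<and> irreducible_generator (m0 P) (Q P) \<and>
     (\<forall>i<m0 P. 0 < muC P i \<and> 0 < sigC P i \<and> 0 < sigS P i \<and> r2 P \<le> r1 P i) \<and>
     0 < rho P \<and> rho P < beta P \<and> 0 < Kc P \<and>
     0 < Ma P \<and> Ma P \<le> 1 \<and> 0 \<le> Ms P \<and> Ml P \<le> 1"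

definition cfun :: "model \<Rightarrow> nat \<Rightarrow> real" where
  "cfun P i = (1 + rho P) * muC P i"

definition Psi :: "model \<Rightarrow> real \<Rightarrow> nat \<Rightarrow> real" where
  "Psi P a i = (1 + beta P) * (1 - a) * muC P i"

definition drift :: "model \<Rightarrow> real \<Rightarrow> nat \<Rightarrow> ctrl \<Rightarrow> real" where
  "drift P x i u = (case u of (a,s,l) \<Rightarrow>
     cfun P i - Psi P a i - a * muC P i
     + (s * r1 P i + (1 - s - l) * r2 P - l) * max (x - Kc P) 0)"

definition sig2 :: "model \<Rightarrow> real \<Rightarrow> nat \<Rightarrow> ctrl \<Rightarrow> real" where
  "sig2 P x i u = (case u of (a,s,l) \<Rightarrow>
     a^2 * (sigC P i)^2 + s^2 * (sigS P i)^2 * (max (x - Kc P) 0)^2)"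

definition Sgrid :: "real \<Rightarrow> real \<Rightarrow> real set" where
  "Sgrid B h = {x. \<exists>k::int. x = real_of_int k * h \<and> \<bar>x\<bar> \<le> B + h}"

definition Dn :: "model \<Rightarrow> real \<Rightarrow> real \<Rightarrow> nat \<Rightarrow> ctrl \<Rightarrow> real" where
  "Dn P h x i u = sig2 P x i u + h * \<bar>drift P x i u\<bar> - h^2 * Q P i i"

definition ptrans :: "model \<Rightarrow> real \<Rightarrow> real \<Rightarrow> real \<Rightarrow> nat \<Rightarrow> ctrl \<Rightarrow> real \<Rightarrow> nat \<Rightarrow> real" where
  "ptrans P B h x i u y j =
    (if x = -(B + h) then (if y = -B \<and> j = i then 1 else 0)
     else if x = B + h then (if y = B \<and> j = i then 1 else 0)
     else (let D = Dn P h x i u; b = drift P x i u; s2 = sig2 P x i u in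
       if j = i then
         (if y = x + h then (s2 / 2 + h * max b 0) / D
          else if y = x - h then (s2 / 2 + h * max (- b) 0) / D
          else 0)
       else if j < m0 P \<and> y = x then Q P i j * h^2 / D else 0))"

definition approx_chain ::
  "model \<Rightarrow> real \<Rightarrow> real \<Rightarrow> 'a measure \<Rightarrow> (nat \<Rightarrow> 'a measure) \<Rightarrow>
   (nat \<Rightarrow> 'a \<Rightarrow> real) \<Rightarrow> (nat \<Rightarrow> 'a \<Rightarrow> nat) \<Rightarrow> (nat \<Rightarrow> 'a \<Rightarrow> ctrl) \<Rightarrow> bool" where
  "approx_chain P B h M F xi al u \<longleftrightarrow>
     prob_space M \<and>
     (\<forall>n. sigma_finite_subalgebra M (F n)) \<and>
     (\<forall>n. sets (F n) \<subseteq> sets (F (Suc n))) \<and>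
     (\<forall>n. xi n \<in> borel_measurable (F n) \<and> al n \<in> measurable (F n) (count_space UNIV)
          \<and> u n \<in> borel_measurable (F n)) \<and>
     (\<forall>\<omega>\<in>space M. xi 0 \<omega> \<in> Sgrid B h \<and> al 0 \<omega> < m0 P) \<and>
     (\<forall>n. \<forall>\<omega>\<in>space M. u n \<omega> \<in> Uset P) \<and>
     (\<forall>n y j. AE \<omega> in M.
        real_cond_exp M (F n)
          (indicator {\<omega>'\<in>space M. xi (Suc n) \<omega>' = y \<and> al (Suc n) \<omega>' = j}) \<omega>
        = ptrans P B h (xi n \<omega>) (al n \<omega>) (u n \<omega>) y j)"

definition Iidx :: "real \<Rightarrow> real \<Rightarrow> (nat \<Rightarrow> real) \<Rightarrow> nat \<Rightarrow> nat" where
  "Iidx B h xs n = (if xs n = -(B + h) then 1 else if xs n = B + h then 2 else 0)"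

definition dtn :: "model \<Rightarrow> real \<Rightarrow> real \<Rightarrow> (nat \<Rightarrow> real) \<Rightarrow> (nat \<Rightarrow> nat) \<Rightarrow> (nat \<Rightarrow> ctrl) \<Rightarrow> nat \<Rightarrow> real" where
  "dtn P B h xs as us n =
     (if Iidx B h xs n = 0 then h^2 / Dn P h (xs n) (as n) (us n) else 0)"

definition ttn :: "model \<Rightarrow> real \<Rightarrow> real \<Rightarrow> (nat \<Rightarrow> real) \<Rightarrow> (nat \<Rightarrow> nat) \<Rightarrow> (nat \<Rightarrow> ctrl) \<Rightarrow> nat \<Rightarrow> real" where
  "ttn P B h xs as us n = (\<Sum>k<n. dtn P B h xs as us k)"

definition nh :: "model \<Rightarrow> real \<Rightarrow> real \<Rightarrow> (nat \<Rightarrow> real) \<Rightarrow> (nat \<Rightarrow> nat) \<Rightarrow> (nat \<Rightarrow> ctrl) \<Rightarrow> real \<Rightarrow> nat" where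
  "nh P B h xs as us t = (GREATEST n. ttn P B h xs as us n \<le> t)"

definition dthat :: "model \<Rightarrow> real \<Rightarrow> real \<Rightarrow> (nat \<Rightarrow> real) \<Rightarrow> (nat \<Rightarrow> nat) \<Rightarrow> (nat \<Rightarrow> ctrl) \<Rightarrow> nat \<Rightarrow> real" where
  "dthat P B h xs as us n =
     (if Iidx B h xs n = 0 then dtn P B h xs as us n else h)"

definition tthat :: "model \<Rightarrow> real \<Rightarrow> real \<Rightarrow> (nat \<Rightarrow> real) \<Rightarrow> (nat \<Rightarrow> nat) \<Rightarrow> (nat \<Rightarrow> ctrl) \<Rightarrow> nat \<Rightarrow> real" where
  "tthat P B h xs as us n = (\<Sum>k<n. dthat P B h xs as us k)"

definition That :: "model \<Rightarrow> real \<Rightarrow> real \<Rightarrow> (nat \<Rightarrow> real) \<Rightarrow> (nat \<Rightarrow> nat) \<Rightarrow> (nat \<Rightarrow> ctrl) \<Rightarrow> real \<Rightarrow> real" where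
  "That P B h xs as us t = ttn P B h xs as us (GREATEST n. tthat P B h xs as us n \<le> t)"

text \<open>Unrescaled interpolations psi^h(t); Es k is the conditional mean of the k-th increment.\<close>
definition xi_int where
  "xi_int P B h xs as us t = xs (nh P B h xs as us t)"
definition al_int where
  "al_int P B h xs as us t = as (nh P B h xs as us t)"
definition u_int where
  "u_int P B h xs as us t = us (nh P B h xs as us t)"
definition z_int where
  "z_int P B h xs as us t = (\<Sum>k\<in>{..nh P B h xs as us t}. if Iidx B h xs k = 1 then h else 0)"
definition g_int where
  "g_int P B h xs as us t = (\<Sum>k\<in>{..nh P B h xs as us t}. if Iidx B h xs k = 2 then h else 0)"
definition W_int where
  "W_int P B h xs as us (Es :: nat \<Rightarrow> real) t =
     (\<Sum>k<nh P B h xs as us t. if Iidx B h xs k = 0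
        then (xs (Suc k) - xs k - Es k) / sqrt (sig2 P (xs k) (as k) (us k)) else 0)"

definition relaxed_rep :: "(real \<Rightarrow> ctrl) \<Rightarrow> (ctrl \<times> real) measure" where
  "relaxed_rep v = distr (density lborel (indicator {0..})) borel (\<lambda>t. (v t, t))"

text \<open>Rescaled processes; paths are indexed by t >= 0 and frozen at their t = 0 value for t < 0.\<close>
definition rescaled ::
  "model \<Rightarrow> real \<Rightarrow> real \<Rightarrow> 'a measure \<Rightarrow> (nat \<Rightarrow> 'a measure) \<Rightarrow>
   (nat \<Rightarrow> 'a \<Rightarrow> real) \<Rightarrow> (nat \<Rightarrow> 'a \<Rightarrow> nat) \<Rightarrow> (nat \<Rightarrow> 'a \<Rightarrow> ctrl) \<Rightarrow> 'a \<Rightarrow>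
   (real \<Rightarrow> real) \<times> (real \<Rightarrow> real) \<times> (ctrl \<times> real) measure \<times>
   (real \<Rightarrow> real) \<times> (real \<Rightarrow> real) \<times> (real \<Rightarrow> real) \<times> (real \<Rightarrow> real)" where
  "rescaled P B h M F xi al u \<omega> =
    (let xs = (\<lambda>n. xi n \<omega>); as = (\<lambda>n. al n \<omega>); us = (\<lambda>n. u n \<omega>);
         Es = (\<lambda>k. real_cond_exp M (F k) (\<lambda>\<omega>'. xi (Suc k) \<omega>' - xi k \<omega>') \<omega>);
         T = (\<lambda>t. That P B h xs as us (max 0 t))
     in ((\<lambda>t. xi_int P B h xs as us (T t)),
         (\<lambda>t. real (al_int P B h xs as us (T t))),
         relaxed_rep (\<lambda>t. u_int P B h xs as us (T t)),
         (\<lambda>t. W_int P B h xs as us Es (T t)),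
         (\<lambda>t. z_int P B h xs as us (T t)),
         (\<lambda>t. g_int P B h xs as us (T t)),
         T))"

section \<open>Skorokhod space D[0,oo) (J1 topology, Ethier--Kurtz metric)\<close>

definition Dset :: "(real \<Rightarrow> real) set" where
  "Dset = {f. (\<forall>t\<le>0. f t = f 0) \<and> (\<forall>t\<ge>0. continuous (at_right t) f)
              \<and> (\<forall>t>0. \<exists>l. (f \<longlongrightarrow> l) (at_left t))}"

definition Lam :: "(real \<Rightarrow> real) set" where
  "Lam = {lam. strict_mono_on {0..} lam \<and> continuous_on {0..} lam \<and> lam ` {0..} = {0..}}"

definition gammaL :: "(real \<Rightarrow> real) \<Rightarrow> ennreal" where
  "gammaL lam = (SUP p\<in>{(s,t). 0 \<le> s \<and> s < t}.
      ennreal \<bar>ln ((lam (snd p) - lam (fst p)) / (snd p - fst p))\<bar>)"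

definition skd :: "(real \<Rightarrow> real) \<Rightarrow> (real \<Rightarrow> real) \<Rightarrow> ennreal" where
  "skd x y = (INF lam\<in>Lam. max (gammaL lam)
      (\<integral>\<^sup>+ v. indicator {0..} v * ennreal (exp (- v)) *
           min 1 (SUP t\<in>{0..}. ennreal \<bar>x (min t v) - y (min (lam t) v)\<bar>) \<partial>lborel))"

definition Dtop :: "(real \<Rightarrow> real) topology" where
  "Dtop = topology (\<lambda>S. S \<subseteq> Dset \<and> (\<forall>x\<in>S. \<exists>e>0. {y\<in>Dset. skd x y < e} \<subseteq> S))"

definition Rset :: "model \<Rightarrow> (ctrl \<times> real) measure set" where
  "Rset P = {m. sets m = sets borel \<and> (\<forall>T\<ge>0. emeasure m (Uset P \<times> {0..T}) = ennreal T)
              \<and> emeasure m (- (Uset P \<times> {0..})) = 0}"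

definition Rtop :: "model \<Rightarrow> (ctrl \<times> real) measure topology" where
  "Rtop P = topology_generated_by
     {{m\<in>Rset P. (\<integral>p. indicator (Uset P \<times> {0..T}) p * (f p :: real) \<partial>m) \<in> V} | T f V.
        0 \<le> T \<and> continuous_on (Uset P \<times> {0..T}) f \<and> open V}"

definition jointtop :: "model \<Rightarrow> ((real \<Rightarrow> real) \<times> (real \<Rightarrow> real) \<times> (ctrl \<times> real) measure \<times>
   (real \<Rightarrow> real) \<times> (real \<Rightarrow> real) \<times> (real \<Rightarrow> real) \<times> (real \<Rightarrow> real)) topology" where
  "jointtop P = prod_topology Dtop (prod_topology Dtop (prod_topology (Rtop P)
      (prod_topology Dtop (prod_topology Dtop (prod_topology Dtop Dtop)))))"

definition tight_family :: "'i set \<Rightarrow> ('i \<Rightarrow> 'a measure) \<Rightarrow> ('i \<Rightarrow> 'a \<Rightarrow> 'b) \<Rightarrow> 'b topology \<Rightarrow> bool" where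
  "tight_family H M X T \<longleftrightarrow>
     (\<forall>\<epsilon>>0. \<exists>K. compactin T K \<and>
        (\<forall>h\<in>H. \<exists>A\<in>sets (M h). A \<subseteq> {\<omega>\<in>space (M h). X h \<omega> \<in> K} \<and> 1 - \<epsilon> \<le> measure (M h) A))"

definition Hset :: "real \<Rightarrow> real set" where
  "Hset B = {h. 0 < h \<and> (\<exists>k::nat. 0 < k \<and> B = real k * h)}"

end

theory Submission
  imports Defs
begin

text \<open>
  A product of tight families is tight, so the components are treated one by one.

  Each rescaled process is a step function whose steps last at least \<open>\<kappa> h\<^sup>2\<close> and at most \<open>G h\<close>.
  Moduli of continuity in rescaled time can therefore be read off from the step index, and no
  random times enter the probabilistic estimates. The reflection terms and the time change are
  Lipschitz in rescaled time up to an error \<open>h\<close>. The noise in \<open>\<xi>\<close> and \<open>W\<close> is a martingale with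
  increments of order \<open>h\<close>; a fourth moment bound and dyadic chaining give a Hoelder modulus that is
  uniform in \<open>h\<close>. A regime jump has conditional probability of order \<open>h\<^sup>2\<close> at each step, so with
  high probability the jumps before time \<open>N\<close> are separated by a distance independent of \<open>h\<close>.

  Relaxed controls form a compact set: under \<open>\<theta> = exp (-t)\<close> they become probability measures on
  \<open>U \<times> [0, 1]\<close>, and such a measure depends continuously on the masses of the cells of a binary
  tree of partitions, which range over a compact set by Tychonoff's theorem.
\<close>

section \<open>Step paths and the Skorokhod distance\<close>

text \<open>Tightness asks for one compact set that serves all meshes, although the step paths are
  discontinuous at each of them. At a fixed mesh a path is coded by its step times and values, which
  range over a compact product. As the mesh shrinks, these paths approach a set of continuous
  functions, compact by Arzela-Ascoli; adjoining the compact sets of the meshes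
  \<open>B / Suc k\<close> to it keeps it compact. Only the regime component retains jumps of fixed
  size. It is recoded by clocks that tick at the jumps, and genuine time changes match the jumps of
  nearby paths.

  In the original time a reflection of size \<open>h\<close> can recur after a time of order
  \<open>h\<^sup>2\<close>, which rules out a Lipschitz bound; in rescaled time it lasts
  \<open>h\<close>.

  The Hoelder exponent \<open>1/8\<close> is a convenient one below the \<open>1/4\<close> that
  fourth moments allow: the fourth power of a threshold is then a square root. All constants depend
  on the model, on \<open>B\<close> and on the tolerated probability, never on the mesh. The
  decisive one is the lower bound of \<open>sig2\<close>, which comes from \<open>Ma P > 0\<close>
  and keeps the regular steps of order \<open>h\<^sup>2\<close>.\<close>

definition clock :: "(nat \<Rightarrow> real) \<Rightarrow> bool" where
  "clock \<tau> \<longleftrightarrow> \<tau> 0 = 0 \<and> strict_mono \<tau> \<and> (\<forall>x. \<exists>n. x < \<tau> n)"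

text \<open>For a clock the \<open>GREATEST\<close> exists at every time because the step times are
  unbounded. The \<open>max 0\<close> produces the constant extension to negative times that
  \<open>Dset\<close> demands.\<close>

definition stepf :: "(nat \<Rightarrow> real) \<Rightarrow> (nat \<Rightarrow> 'b) \<Rightarrow> real \<Rightarrow> 'b" where
  "stepf \<tau> v t = v (GREATEST n. \<tau> n \<le> max 0 t)"

lemma Greatest_clock:
  fixes \<tau> :: "nat \<Rightarrow> real"
  assumes "strict_mono \<tau>" "\<tau> n \<le> t" "t < \<tau> (Suc n)"
  shows "(GREATEST n. \<tau> n \<le> t) = n"
proof (rule Greatest_equality)
  fix y assume "\<tau> y \<le> t"
  then have "\<tau> y < \<tau> (Suc n)" using assms by simp
  then show "y \<le> n" using assms(1) by (simp add: strict_mono_less)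
qed (fact assms(2))

lemma clock_cell:
  assumes "clock \<tau>" "0 \<le> t"
  obtains n where "\<tau> n \<le> t" "t < \<tau> (Suc n)"
proof -
  define k where "k = (LEAST n. t < \<tau> n)"
  have k: "t < \<tau> k" unfolding k_def using assms(1) by (auto simp: clock_def intro: LeastI)
  have "k \<noteq> 0" using k assms by (metis clock_def not_less)
  then obtain n where n: "k = Suc n" by (cases k) auto
  have "\<not> t < \<tau> n" using not_less_Least[of n "\<lambda>n. t < \<tau> n"] n k_def by simp
  with k n show thesis by (intro that[of n]) auto
qed

lemma stepf_eq:
  assumes "strict_mono \<tau>" "0 \<le> t" "\<tau> n \<le> t" "t < \<tau> (Suc n)"
  shows "stepf \<tau> v t = v n"
  using Greatest_clock[OF assms(1,3,4)] assms(2) by (simp add: stepf_def)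

lemma stepf_neg: "t \<le> 0 \<Longrightarrow> stepf \<tau> v t = stepf \<tau> v 0"
  by (simp add: stepf_def)

lemma clock_nonneg: "clock \<tau> \<Longrightarrow> 0 \<le> \<tau> n"
  unfolding clock_def by (metis le0 strict_mono_less_eq)

lemma stepf_Dset:
  fixes v :: "nat \<Rightarrow> real"
  assumes c: "clock \<tau>"
  shows "stepf \<tau> v \<in> Dset"
proof -
  have sm: "strict_mono \<tau>" using c by (simp add: clock_def)
  have "continuous (at_right t) (stepf \<tau> v)" if t: "0 \<le> t" for t
  proof -
    obtain n where n: "\<tau> n \<le> t" "t < \<tau> (Suc n)" using clock_cell[OF c t] .
    have "eventually (\<lambda>s. s \<in> {t<..<\<tau> (Suc n)}) (at_right t)"
      using n(2) by (rule eventually_at_right_real)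
    then have "eventually (\<lambda>s. stepf \<tau> v s = v n) (at_right t)"
      by eventually_elim (use sm n t in \<open>auto intro!: stepf_eq\<close>)
    then have "(stepf \<tau> v \<longlongrightarrow> v n) (at_right t)"
      by (rule tendsto_eventually)
    then show ?thesis using stepf_eq[OF sm t n, of v] by (simp add: continuous_within)
  qed
  moreover have "\<exists>l. (stepf \<tau> v \<longlongrightarrow> l) (at_left t)" if t: "0 < t" for t
  proof -
    \<comment> \<open>The inequality is not strict here: at a jump time the left limit is the value
      of the cell that ends there.\<close>
    define k where "k = (LEAST n. t \<le> \<tau> n)"
    obtain n0 where "t < \<tau> n0" using c by (auto simp: clock_def)
    then have "t \<le> \<tau> n0" by simp
    then have k: "t \<le> \<tau> k" unfolding k_def by (rule LeastI)
    have "k \<noteq> 0" using k t c by (metis clock_def not_less)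
    then obtain n where n: "k = Suc n" by (cases k) auto
    have n1: "\<tau> n < t" using not_less_Least[of n "\<lambda>n. t \<le> \<tau> n"] n k_def by simp
    have "eventually (\<lambda>s. s \<in> {\<tau> n<..<t}) (at_left t)"
      using n1 by (rule eventually_at_left_real)
    then have "eventually (\<lambda>s. stepf \<tau> v s = v n) (at_left t)"
    proof eventually_elim
      case (elim s)
      then show ?case using sm k n clock_nonneg[OF c, of n] by (intro stepf_eq) auto
    qed
    then show ?thesis by (intro exI tendsto_eventually)
  qed
  moreover have "\<forall>t\<le>0. stepf \<tau> v t = stepf \<tau> v 0" using stepf_neg by blast
  ultimately show ?thesis unfolding Dset_def by blast
qed

lemma skd_leI:
  assumes "lam \<in> Lam" "gammaL lam \<le> a"
    and "(\<integral>\<^sup>+ v. indicator {0..} v * ennreal (exp (- v)) *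
           min 1 (SUP t\<in>{0..}. ennreal \<bar>x (min t v) - y (min (lam t) v)\<bar>) \<partial>lborel) \<le> a"
  shows "skd x y \<le> a"
  unfolding skd_def by (rule INF_lower2[OF assms(1)]) (use assms in simp)

text \<open>The difference quotients of \<open>lam\<close> are within
  \<open>\<eta> \<le> 1/2\<close> of \<open>1\<close>. Hence \<open>lam\<close> is increasing and
  onto, and \<open>ln (1 + r)\<close> is at most twice \<open>r\<close> in absolute value for the
  deviations \<open>r\<close> that occur.\<close>

lemma Lam_perturbation:
  fixes lam :: "real \<Rightarrow> real"
  assumes 0: "lam 0 = 0" and c: "continuous_on {0..} lam" and e: "0 \<le> \<eta>" "\<eta> \<le> 1/2"
    and L: "\<And>s t. 0 \<le> s \<Longrightarrow> s < t \<Longrightarrow> \<bar>lam t - lam s - (t - s)\<bar> \<le> \<eta> * (t - s)"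
  shows "lam \<in> Lam" "gammaL lam \<le> ennreal (2 * \<eta>)"
proof -
  have lo: "(t - s) / 2 \<le> lam t - lam s" if "0 \<le> s" "s < t" for s t
  proof -
    have "\<eta> * (t - s) \<le> 1/2 * (t - s)" using that e by (intro mult_right_mono) auto
    with L[OF that] show ?thesis by (simp add: abs_le_iff field_simps)
  qed
  have sm: "strict_mono_on {0..} lam"
  proof (rule strict_mono_onI)
    fix r s :: real assume "r \<in> {0..}" "s \<in> {0..}" "r < s"
    then show "lam r < lam s" using lo[of r s] by auto
  qed
  have nn: "0 \<le> lam t" if "0 \<le> t" for t
    using lo[of 0 t] 0 that by (cases "t = 0") auto
  have "y \<in> lam ` {0..}" if y: "0 \<le> y" for y
  proof (cases "y = 0")
    case True then show ?thesis using 0 by (intro image_eqI[of _ _ 0]) auto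
  next
    case False
    \<comment> \<open>Slope at least \<open>1/2\<close> makes \<open>2 * y\<close> a sufficient
      right end for the intermediate value theorem.\<close>
    have "y \<le> lam (2 * y)" using lo[of 0 "2*y"] 0 y False by simp
    moreover have "continuous_on {0..2*y} lam" by (rule continuous_on_subset[OF c]) auto
    ultimately obtain x where "0 \<le> x" "lam x = y"
      using IVT'[of lam 0 y "2*y"] 0 y by auto
    then show ?thesis by (intro image_eqI[of _ _ x]) auto
  qed
  then have "lam ` {0..} = {0..}" using nn by auto
  with sm c show "lam \<in> Lam" by (simp add: Lam_def)
  show "gammaL lam \<le> ennreal (2 * \<eta>)"
    unfolding gammaL_def
  proof (rule SUP_least, clarsimp)
    fix s t :: real assume st: "0 \<le> s" "s < t"
    define r where "r = (lam t - lam s) / (t - s) - 1"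
    have "r = (lam t - lam s - (t - s)) / (t - s)" using st by (simp add: r_def field_simps)
    then have r: "\<bar>r\<bar> \<le> \<eta>" using L[OF st] st by (simp add: abs_divide divide_le_eq)
    then have r2: "\<bar>r\<bar> \<le> 1/2" using e by simp
    have "\<bar>ln (1 + r) - r\<bar> \<le> 2 * r\<^sup>2" by (rule abs_ln_one_plus_x_minus_x_bound[OF r2])
    moreover have "2 * r\<^sup>2 \<le> \<bar>r\<bar>"
    proof -
      have "r\<^sup>2 = \<bar>r\<bar> * \<bar>r\<bar>" by (simp add: power2_eq_square)
      also have "\<dots> \<le> 1/2 * \<bar>r\<bar>" using r2 by (intro mult_right_mono) auto
      finally show ?thesis by simp
    qed
    ultimately have "\<bar>ln (1 + r)\<bar> \<le> 2 * \<eta>" using r by linarith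
    then show "ennreal \<bar>ln ((lam t - lam s) / (t - s))\<bar> \<le> ennreal (2 * \<eta>)"
      by (intro ennreal_leI) (simp add: r_def)
  qed
qed

lemma nn_integral_exp_tail:
  "(\<integral>\<^sup>+ v. ennreal (exp (- v)) * indicator {a..} v \<partial>lborel) = ennreal (exp (- a))"
proof -
  have "(\<integral>\<^sup>+ v. ennreal (exp (- v)) * indicator {a..} v \<partial>lborel) = ennreal (0 - (- exp (- a)))"
  proof (rule nn_integral_FTC_atLeast)
    show "((\<lambda>x. - exp (- x)) has_real_derivative exp (- x)) (at x)" for x :: real
      by (auto intro!: derivative_eq_intros)
    have "((\<lambda>x::real. exp (- x)) \<longlongrightarrow> 0) at_top"
      by (rule filterlim_compose[OF exp_at_bot filterlim_uminus_at_bot_at_top])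
    from tendsto_minus[OF this] show "((\<lambda>x::real. - exp (- x)) \<longlongrightarrow> 0) at_top" by simp
  qed auto
  then show ?thesis by simp
qed

lemma clamp_lipschitz:
  fixes a b s t :: real
  shows "s \<le> t \<Longrightarrow> \<bar>max a (min t b) - max a (min s b)\<bar> \<le> t - s"
  by (auto simp: max_def min_def)

text \<open>The time change carries \<open>\<tau> i\<close> to \<open>\<sigma> i\<close> linearly for \<open>i \<le> m\<close>; the two paths then disagree
  only when the cut-off \<open>v\<close> separates \<open>\<tau> i\<close> from \<open>\<sigma> i\<close>.\<close>
lemma skd_stepf:
  fixes v w :: "nat \<Rightarrow> real"
  assumes c: "clock \<tau>" "clock \<sigma>" and N: "N \<le> \<tau> m" "N \<le> \<sigma> m"
    and \<eta>: "\<eta> = (\<Sum>i<m. \<bar>(\<sigma> (Suc i) - \<sigma> i) / (\<tau> (Suc i) - \<tau> i) - 1\<bar>)" "\<eta> \<le> 1/2"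
  shows "skd (stepf \<tau> v) (stepf \<sigma> w) \<le>
    ennreal (2 * \<eta> + (\<Sum>i\<le>m. \<bar>\<tau> i - \<sigma> i\<bar>) + (\<Sum>i\<le>m. \<bar>v i - w i\<bar>) + exp (- N))"
proof -
  define cc where "cc i = (\<sigma> (Suc i) - \<sigma> i) / (\<tau> (Suc i) - \<tau> i) - 1" for i
  \<comment> \<open>The \<open>i\<close>-th clamp is the time spent in cell \<open>i\<close> up to
    time \<open>t\<close>, so \<open>lam\<close> has slope \<open>1 + cc i\<close> on the cells
    before \<open>\<tau> m\<close> and slope \<open>1\<close> afterwards.\<close>
  define lam where "lam t = t + (\<Sum>i<m. cc i * (max (\<tau> i) (min t (\<tau> (Suc i))) - \<tau> i))" for t
  have sm: "strict_mono \<tau>" "strict_mono \<sigma>" and z: "\<tau> 0 = 0" "\<sigma> 0 = 0" using c by (auto simp: clock_def)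
  have mono: "\<tau> i \<le> \<tau> j \<longleftrightarrow> i \<le> j" "\<sigma> i \<le> \<sigma> j \<longleftrightarrow> i \<le> j" for i j
    using sm by (simp_all add: strict_mono_less_eq)
  have smono: "\<tau> i < \<tau> j \<longleftrightarrow> i < j" for i j using sm by (simp add: strict_mono_less)
  have lam_tau: "lam (\<tau> j) = \<sigma> j" if "j \<le> m" for j
  proof -
    have "(\<Sum>i<m. cc i * (max (\<tau> i) (min (\<tau> j) (\<tau> (Suc i))) - \<tau> i))
        = (\<Sum>i<m. if i < j then cc i * (\<tau> (Suc i) - \<tau> i) else 0)"
    proof (rule sum.cong[OF refl])
      fix i
      show "cc i * (max (\<tau> i) (min (\<tau> j) (\<tau> (Suc i))) - \<tau> i) = (if i < j then cc i * (\<tau> (Suc i) - \<tau> i) else 0)"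
      proof (cases "i < j")
        case True
        then have "min (\<tau> j) (\<tau> (Suc i)) = \<tau> (Suc i)" by (simp add: mono min_absorb2)
        moreover have "max (\<tau> i) (\<tau> (Suc i)) = \<tau> (Suc i)" by (simp add: mono max_absorb2)
        ultimately show ?thesis using True by simp
      next
        case False
        then have "min (\<tau> j) (\<tau> (Suc i)) = \<tau> j" "max (\<tau> i) (\<tau> j) = \<tau> i"
          by (simp_all add: mono min_absorb1 max_absorb1)
        then show ?thesis using False by simp
      qed
    qed
    also have "\<dots> = (\<Sum>i<j. cc i * (\<tau> (Suc i) - \<tau> i))"
    proof -
      have "{..<m} \<inter> {i. i < j} = {..<j}" using that by auto
      then show ?thesis by (simp add: sum.If_cases)
    qed
    also have "\<dots> = (\<Sum>i<j. (\<sigma> (Suc i) - \<tau> (Suc i)) - (\<sigma> i - \<tau> i))"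
    proof (rule sum.cong[OF refl])
      fix i
      have nz: "\<tau> (Suc i) - \<tau> i \<noteq> 0" using smono[of i "Suc i"] by auto
      have "(x / d - 1) * d = x - d" if "d \<noteq> 0" for x d :: real using that by (simp add: field_simps)
      from this[OF nz] show "cc i * (\<tau> (Suc i) - \<tau> i) = (\<sigma> (Suc i) - \<tau> (Suc i)) - (\<sigma> i - \<tau> i)"
        by (simp add: cc_def)
    qed
    also have "\<dots> = \<sigma> j - \<tau> j" using sum_lessThan_telescope[of "\<lambda>i. \<sigma> i - \<tau> i" j] z by simp
    finally show ?thesis by (simp add: lam_def)
  qed
  have lam0: "lam 0 = 0" using lam_tau[of 0] z by simp
  have lamc: "continuous_on {0..} lam"
    unfolding lam_def by (intro continuous_intros)
  have \<eta>0: "0 \<le> \<eta>" using \<eta> by (simp add: sum_nonneg)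
  have L: "\<bar>lam t - lam s - (t - s)\<bar> \<le> \<eta> * (t - s)" if "0 \<le> s" "s < t" for s t
  proof -
    have "lam t - lam s - (t - s) = (\<Sum>i<m. cc i * (max (\<tau> i) (min t (\<tau> (Suc i))) - max (\<tau> i) (min s (\<tau> (Suc i)))))"
      by (simp add: lam_def sum_subtractf[symmetric] algebra_simps)
    also have "\<bar>\<dots>\<bar> \<le> (\<Sum>i<m. \<bar>cc i\<bar> * (t - s))"
      by (rule order_trans[OF sum_abs], rule sum_mono)
        (use that in \<open>auto simp: abs_mult intro!: mult_left_mono clamp_lipschitz\<close>)
    also have "\<dots> = \<eta> * (t - s)" by (simp add: \<eta> cc_def sum_distrib_right)
    finally show ?thesis .
  qed
  note Lam = Lam_perturbation[OF lam0 lamc \<eta>0 \<eta>(2) L]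
  have lm: "lam s < lam t" if "0 \<le> s" "s < t" for s t
    using Lam(1) that by (auto simp: Lam_def strict_mono_on_def)
  have lm': "lam s \<le> lam t" if "0 \<le> s" "s \<le> t" for s t
    using lm[of s t] that by (cases "s = t") auto
  define V where "V = (\<Sum>i\<le>m. \<bar>v i - w i\<bar>)"
  have V: "\<bar>v i - w i\<bar> \<le> V" if "i \<le> m" for i
    unfolding V_def using that by (intro member_le_sum) auto
  have V0: "0 \<le> V" by (simp add: V_def sum_nonneg)
  define bad where "bad = (\<Union>i\<le>m. {min (\<tau> i) (\<sigma> i)..max (\<tau> i) (\<sigma> i)})"
  have badm: "bad \<in> sets lborel" by (auto simp: bad_def)
  have "emeasure lborel bad \<le> (\<Sum>i\<le>m. emeasure lborel {min (\<tau> i) (\<sigma> i)..max (\<tau> i) (\<sigma> i)})"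
    unfolding bad_def by (rule emeasure_subadditive_finite) auto
  also have "\<dots> = (\<Sum>i\<le>m. ennreal \<bar>\<tau> i - \<sigma> i\<bar>)"
    by (rule sum.cong) (auto simp: max_def min_def abs_if)
  also have "\<dots> = ennreal (\<Sum>i\<le>m. \<bar>\<tau> i - \<sigma> i\<bar>)" by (rule sum_ennreal) auto
  finally have bad: "emeasure lborel bad \<le> ennreal (\<Sum>i\<le>m. \<bar>\<tau> i - \<sigma> i\<bar>)" .
  have key: "\<bar>stepf \<tau> v (min t r) - stepf \<sigma> w (min (lam t) r)\<bar> \<le> V"
    if t: "0 \<le> t" and r: "0 \<le> r" "r < N" "r \<notin> bad" for t r
  proof -
    obtain i where i: "\<tau> i \<le> r" "r < \<tau> (Suc i)" using clock_cell[OF c(1) r(1)] .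
    have im: "i < m"
    proof -
      have "\<tau> i < \<tau> m" using i r N by simp
      then show ?thesis by (simp add: smono)
    qed
    have "r \<notin> {min (\<tau> i) (\<sigma> i)..max (\<tau> i) (\<sigma> i)}" "r \<notin> {min (\<tau> (Suc i)) (\<sigma> (Suc i))..max (\<tau> (Suc i)) (\<sigma> (Suc i))}"
      using r im by (auto simp: bad_def simp del: atLeastAtMost_iff)
    then have i2: "\<sigma> i \<le> r" "r < \<sigma> (Suc i)" using i by (auto simp: min_def max_def split: if_splits)
    obtain j where j: "\<tau> j \<le> t" "t < \<tau> (Suc j)" using clock_cell[OF c(1) t] .
    note nn = clock_nonneg[OF c(1)] clock_nonneg[OF c(2)]
    show ?thesis
    proof (cases "j \<le> i")
      case True
      have j2: "\<sigma> j \<le> lam t" using lm'[OF nn(1) j(1)] lam_tau[of j] True im by simp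
      have j3: "lam t < \<sigma> (Suc j)" using lm[OF t j(2)] lam_tau[of "Suc j"] True im by simp
      have "\<tau> j \<le> \<tau> i" "\<sigma> j \<le> \<sigma> i" using True by (simp_all add: mono)
      then have "stepf \<tau> v (min t r) = v j" "stepf \<sigma> w (min (lam t) r) = w j"
        using j j2 j3 i i2 t r nn(2)[of j] sm by (auto intro!: stepf_eq simp: min_def)
      then show ?thesis using V[of j] True im by simp
    next
      \<comment> \<open>The cell of \<open>t\<close> lies beyond that of \<open>r\<close>, so both
        arguments are stopped at \<open>r\<close>.\<close>
      case False
      then have "\<tau> (Suc i) \<le> \<tau> j" by (simp add: mono)
      then have a: "\<tau> (Suc i) \<le> t" using j by simp
      have "\<sigma> (Suc i) \<le> lam t" using lm'[OF nn(1) a] lam_tau[of "Suc i"] im by simp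
      then have "min t r = r" "min (lam t) r = r" using a i i2 by auto
      then have "stepf \<tau> v (min t r) = v i" "stepf \<sigma> w (min (lam t) r) = w i"
        using stepf_eq[OF sm(1) r(1) i] stepf_eq[OF sm(2) r(1) i2] by auto
      then show ?thesis using V[of i] im by simp
    qed
  qed
  define a where "a = 2 * \<eta> + (\<Sum>i\<le>m. \<bar>\<tau> i - \<sigma> i\<bar>) + V + exp (- N)"
  have "skd (stepf \<tau> v) (stepf \<sigma> w) \<le> ennreal a"
  proof (rule skd_leI[OF Lam(1)])
    show "gammaL lam \<le> ennreal a"
      by (rule order_trans[OF Lam(2)]) (use V0 in \<open>auto simp: a_def sum_nonneg intro!: ennreal_leI\<close>)
    have "(\<integral>\<^sup>+ r. indicator {0..} r * ennreal (exp (- r)) *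
           min 1 (SUP t\<in>{0..}. ennreal \<bar>stepf \<tau> v (min t r) - stepf \<sigma> w (min (lam t) r)\<bar>) \<partial>lborel)
      \<le> (\<integral>\<^sup>+ r. indicator bad r + ennreal V * (ennreal (exp (- r)) * indicator {0..} r)
            + ennreal (exp (- r)) * indicator {N..} r \<partial>lborel)"
    proof (rule nn_integral_mono)
      fix r :: real
      let ?m = "min 1 (SUP t\<in>{0..}. ennreal \<bar>stepf \<tau> v (min t r) - stepf \<sigma> w (min (lam t) r)\<bar>)"
      have m1: "?m \<le> 1" by simp
      \<comment> \<open>Negative cut-offs have weight zero, those in \<open>bad\<close> cost at most
        the Lebesgue measure of \<open>bad\<close>, those beyond \<open>N\<close> the exponential
        tail, and for the others the paths differ by at most \<open>V\<close>.\<close>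
      consider "r < 0" | "0 \<le> r" "r \<in> bad" | "0 \<le> r" "N \<le> r" | "0 \<le> r" "r < N" "r \<notin> bad" by fastforce
      then show "indicator {0..} r * ennreal (exp (- r)) * ?m \<le> indicator bad r
          + ennreal V * (ennreal (exp (- r)) * indicator {0..} r) + ennreal (exp (- r)) * indicator {N..} r"
      proof cases
        case 2
        have "ennreal (exp (- r)) \<le> 1" using 2 by (simp add: ennreal_le_1)
        then have "ennreal (exp (- r)) * ?m \<le> 1 * 1" using m1 by (intro mult_mono) auto
        then show ?thesis using 2 by (simp add: add_increasing2)
      next
        case 3
        have "ennreal (exp (- r)) * ?m \<le> ennreal (exp (- r)) * 1" using m1 by (intro mult_mono) auto
        then show ?thesis using 3 by (simp add: add_increasing)
      next
        case 4
        have "?m \<le> ennreal V"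
          by (rule order_trans[OF min.cobounded2], rule SUP_least, rule ennreal_leI) (use key 4 in auto)
        then have "ennreal (exp (- r)) * ?m \<le> ennreal (exp (- r)) * ennreal V" by (intro mult_mono) auto
        then show ?thesis using 4 by (simp add: mult.commute)
      qed simp
    qed
    also have "\<dots> = emeasure lborel bad + ennreal V * ennreal (exp (- 0)) + ennreal (exp (- N))"
      using badm by (subst nn_integral_add, measurable, subst nn_integral_add, measurable,
        subst nn_integral_cmult, measurable) (simp only: nn_integral_exp_tail, simp)
    also have "\<dots> \<le> ennreal (\<Sum>i\<le>m. \<bar>\<tau> i - \<sigma> i\<bar>) + ennreal V * ennreal (exp (- 0)) + ennreal (exp (- N))"
      by (intro add_mono bad order_refl)
    also have "\<dots> = ennreal ((\<Sum>i\<le>m. \<bar>\<tau> i - \<sigma> i\<bar>) + V + exp (- N))"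
      using V0 by (simp add: ennreal_plus sum_nonneg)
    also have "\<dots> \<le> ennreal a" using \<eta>0 by (intro ennreal_leI) (simp add: a_def)
    finally show "(\<integral>\<^sup>+ r. indicator {0..} r * ennreal (exp (- r)) *
           min 1 (SUP t\<in>{0..}. ennreal \<bar>stepf \<tau> v (min t r) - stepf \<sigma> w (min (lam t) r)\<bar>) \<partial>lborel) \<le> ennreal a" .
  qed
  then show ?thesis by (simp add: a_def V_def)
qed

section \<open>Compact sets in the Skorokhod topology\<close>

text \<open>\<open>Dtop\<close> can be unfolded only after the axioms of a topology are established.
  They hold for any distance-like function, by taking the smaller of two radii; nothing is claimed
  about balls being open.\<close>

lemma openin_Dtop:
  "openin Dtop S \<longleftrightarrow> S \<subseteq> Dset \<and> (\<forall>x\<in>S. \<exists>e>0. {y\<in>Dset. skd x y < e} \<subseteq> S)"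
proof -
  have "istopology (\<lambda>S. S \<subseteq> Dset \<and> (\<forall>x\<in>S. \<exists>e>0. {y\<in>Dset. skd x y < e} \<subseteq> S))"
    unfolding istopology_def
  proof (intro conjI allI impI)
    fix S T assume S: "S \<subseteq> Dset \<and> (\<forall>x\<in>S. \<exists>e>0. {y\<in>Dset. skd x y < e} \<subseteq> S)"
      and T: "T \<subseteq> Dset \<and> (\<forall>x\<in>T. \<exists>e>0. {y\<in>Dset. skd x y < e} \<subseteq> T)"
    show "\<forall>x\<in>S \<inter> T. \<exists>e>0. {y\<in>Dset. skd x y < e} \<subseteq> S \<inter> T"
    proof
      fix x assume x: "x \<in> S \<inter> T"
      obtain d where "d > 0" "{y\<in>Dset. skd x y < d} \<subseteq> S" using S x by blast
      moreover obtain e where "e > 0" "{y\<in>Dset. skd x y < e} \<subseteq> T" using T x by blast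
      ultimately show "\<exists>e>0. {y\<in>Dset. skd x y < e} \<subseteq> S \<inter> T"
        by (intro exI[of _ "min d e"]) auto
    qed
    show "S \<inter> T \<subseteq> Dset" using S by auto
  next
    fix \<K> assume K: "\<forall>S\<in>\<K>. S \<subseteq> Dset \<and> (\<forall>x\<in>S. \<exists>e>0. {y\<in>Dset. skd x y < e} \<subseteq> S)"
    show "\<Union>\<K> \<subseteq> Dset" using K by auto
    show "\<forall>x\<in>\<Union>\<K>. \<exists>e>0. {y\<in>Dset. skd x y < e} \<subseteq> \<Union>\<K>"
    proof
      fix x assume "x \<in> \<Union>\<K>"
      then obtain S where S: "S \<in> \<K>" "x \<in> S" by auto
      then obtain e where "e > 0" "{y\<in>Dset. skd x y < e} \<subseteq> S" using K by blast
      then show "\<exists>e>0. {y\<in>Dset. skd x y < e} \<subseteq> \<Union>\<K>" using S by blast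
    qed
  qed
  then show ?thesis by (simp add: Dtop_def)
qed

lemma topspace_Dtop: "topspace Dtop = Dset"
proof
  show "topspace Dtop \<subseteq> Dset" using openin_topspace[of Dtop] unfolding openin_Dtop by blast
  have "openin Dtop Dset" unfolding openin_Dtop by (auto intro!: exI[of _ 1])
  then show "Dset \<subseteq> topspace Dtop" by (rule openin_subset)
qed

text \<open>\<open>skd\<close> is never used as a metric: compact sets are obtained as images of compact metric
  spaces, for which convergence in \<open>skd\<close> towards the limit point suffices.\<close>
lemma compactin_Dtop_image:
  fixes f :: "'a::metric_space \<Rightarrow> real \<Rightarrow> real"
  assumes "compact Y" and D: "f ` Y \<subseteq> Dset"
    and lim: "\<And>y s. y \<in> Y \<Longrightarrow> (\<And>n::nat. s n \<in> Y) \<Longrightarrow> s \<longlonglongrightarrow> y \<Longrightarrow> (\<lambda>n. skd (f y) (f (s n))) \<longlonglongrightarrow> 0"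
  shows "compactin Dtop (f ` Y)"
proof (rule image_compactin)
  show "compactin (top_of_set Y) Y" using \<open>compact Y\<close> by (simp add: compactin_subtopology)
  show "continuous_map (top_of_set Y) Dtop f"
    unfolding continuous_map_def
  proof (intro conjI allI impI)
    show "f \<in> topspace (top_of_set Y) \<rightarrow> topspace Dtop" using D by (auto simp: topspace_Dtop)
    fix U assume U: "openin Dtop U"
    have "\<exists>e>0. ball x e \<inter> Y \<subseteq> {x \<in> Y. f x \<in> U}" if x: "x \<in> Y" "f x \<in> U" for x
    proof (rule ccontr)
      \<comment> \<open>If the preimage is not open at \<open>x\<close>, some sequence in
        \<open>Y\<close> tends to \<open>x\<close> while its images avoid \<open>U\<close>. By
        \<open>lim\<close> the images nevertheless enter every \<open>skd\<close> ball centred at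
        \<open>f x\<close>.\<close>
      assume "\<not> ?thesis"
      then have "\<forall>n::nat. \<exists>z. z \<in> ball x (inverse (Suc n)) \<inter> Y \<and> f z \<notin> U"
        by (metis (no_types, lifting) IntE inverse_positive_iff_positive mem_Collect_eq of_nat_0_less_iff subsetI zero_less_Suc)
      then obtain s where s: "\<And>n::nat. s n \<in> ball x (inverse (Suc n)) \<inter> Y \<and> f (s n) \<notin> U" by metis
      have "(\<lambda>n. dist (s n) x) \<longlonglongrightarrow> 0"
      proof (rule tendsto_sandwich[where f = "\<lambda>_. 0"])
        show "(\<lambda>n. inverse (real (Suc n))) \<longlonglongrightarrow> 0" by (rule LIMSEQ_inverse_real_of_nat)
        show "\<forall>\<^sub>F n in sequentially. dist (s n) x \<le> inverse (real (Suc n))"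
          using s by (auto simp: dist_commute less_imp_le)
      qed auto
      then have "s \<longlonglongrightarrow> x" by (simp add: tendsto_dist_iff[of s])
      then have "(\<lambda>n. skd (f x) (f (s n))) \<longlonglongrightarrow> 0" using lim[OF x(1)] s by auto
      moreover obtain e where e: "e > 0" "{y\<in>Dset. skd (f x) y < e} \<subseteq> U" using U x by (auto simp: openin_Dtop)
      ultimately have "eventually (\<lambda>n. skd (f x) (f (s n)) < e) sequentially" by (auto dest: order_tendstoD)
      then obtain n where "skd (f x) (f (s n)) < e" by (auto simp: eventually_sequentially)
      moreover have "f (s n) \<in> Dset" using D s by auto
      ultimately show False using e s by auto
    qed
    then show "openin (top_of_set Y) {x \<in> topspace (top_of_set Y). f x \<in> U}"
      by (auto simp: openin_contains_ball)
  qed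
qed

section \<open>Product spaces of sequences and step paths over compact code sets\<close>

lemma tendsto_coord:
  fixes s :: "nat \<Rightarrow> 'i \<Rightarrow> 'b::topological_space"
  assumes "s \<longlonglongrightarrow> l" shows "(\<lambda>n. s n i) \<longlonglongrightarrow> l i"
  by (rule continuous_on_tendsto_compose[OF continuous_on_product_coordinates assms]) auto

lemma tendsto_fun_coordwise:
  fixes s :: "nat \<Rightarrow> 'i \<Rightarrow> 'b::topological_space"
  assumes "\<And>i. (\<lambda>n. s n i) \<longlonglongrightarrow> l i" shows "s \<longlonglongrightarrow> l"
proof -
  have "limitin (product_topology (\<lambda>i. euclidean) UNIV) s l sequentially"
    using assms by (simp add: limitin_componentwise)
  then show ?thesis by (simp add: euclidean_product_topology)
qed

lemma compact_box_fun:
  fixes a b :: "'i \<Rightarrow> real"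
  shows "compact {f. \<forall>i. a i \<le> f i \<and> f i \<le> b i}"
proof -
  have "compactin (product_topology (\<lambda>i. euclidean) UNIV) (PiE UNIV (\<lambda>i. {a i..b i}))"
    by (subst compactin_PiE) auto
  then have "compact (PiE UNIV (\<lambda>i. {a i..b i}))" by (simp add: euclidean_product_topology)
  moreover have "PiE UNIV (\<lambda>i. {a i..b i}) = {f. \<forall>i. a i \<le> f i \<and> f i \<le> b i}" by (auto simp: PiE_def)
  ultimately show ?thesis by simp
qed

lemma ennreal_pos_less:
  assumes "(0::ennreal) < a" obtains e where "0 < e" "ennreal e < a"
proof -
  obtain c where c: "0 < c" "c < a" using dense[OF assms] by auto
  then have "c = ennreal (enn2real c)" by (metis ennreal_enn2real less_top order_less_trans top.not_eq_extremum)
  with c that[of "enn2real c"] show thesis by (metis enn2real_positive_iff ennreal_less_zero_iff)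
qed

lemma exp_small:
  fixes e :: real assumes "0 < e" obtains N :: nat where "exp (- real N) < e"
proof -
  obtain N :: nat where "- ln e < N" using reals_Archimedean2 by blast
  then have "exp (- real N) < exp (ln e)" by simp
  then show thesis using that assms by simp
qed

text \<open>By \<open>div\<close>, finitely many steps reach time \<open>N\<close> for all codes at
  once, and later times cost only \<open>exp (- N)\<close>. So coordinatewise convergence makes the
  finite sums of \<open>skd_stepf\<close> small; the slope ratios tend to \<open>1\<close> because
  the cell lengths of the limit clock are fixed and positive.\<close>

lemma compactin_stepf:
  fixes Y :: "((nat \<Rightarrow> real) \<times> (nat \<Rightarrow> real)) set"
  assumes "compact Y" and cl: "\<And>\<tau> v. (\<tau>, v) \<in> Y \<Longrightarrow> clock \<tau>"
    and div: "\<And>N::nat. \<exists>m. \<forall>(\<tau>, v)\<in>Y. real N \<le> \<tau> m"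
  shows "compactin Dtop ((\<lambda>(\<tau>, v). stepf \<tau> v) ` Y)"
proof (rule compactin_Dtop_image[OF assms(1)])
  show "(\<lambda>(\<tau>, v). stepf \<tau> v) ` Y \<subseteq> Dset" using cl stepf_Dset by auto
  fix y and s :: "nat \<Rightarrow> (nat \<Rightarrow> real) \<times> (nat \<Rightarrow> real)"
  assume y: "y \<in> Y" and s: "\<And>n. s n \<in> Y" and lim: "s \<longlonglongrightarrow> y"
  obtain \<tau> v where yy: "y = (\<tau>, v)" by force
  define \<sigma> where "\<sigma> n = fst (s n)" for n
  define w where "w n = snd (s n)" for n
  have sn: "s n = (\<sigma> n, w n)" for n by (simp add: \<sigma>_def w_def)
  have c: "clock \<tau>" "clock (\<sigma> n)" for n using cl y s[of n] by (auto simp: yy sn)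
  have l\<sigma>: "(\<lambda>n. \<sigma> n i) \<longlonglongrightarrow> \<tau> i" for i
    using tendsto_coord[OF tendsto_fst[OF lim]] by (simp add: yy \<sigma>_def)
  have lw: "(\<lambda>n. w n i) \<longlonglongrightarrow> v i" for i
    using tendsto_coord[OF tendsto_snd[OF lim]] by (simp add: yy w_def)
  have pos: "\<tau> (Suc i) - \<tau> i \<noteq> 0" for i
    using c(1) strict_monoD[of \<tau> i "Suc i"] by (simp add: clock_def)
  have "(\<lambda>n. skd (stepf \<tau> v) (stepf (\<sigma> n) (w n))) \<longlonglongrightarrow> 0"
  proof (rule order_tendstoI)
    fix a :: ennreal assume "0 < a"
    then obtain e where e: "0 < e" "ennreal e < a" by (rule ennreal_pos_less)
    have e2: "0 < e/2" using e by simp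
    obtain N :: nat where N: "exp (- real N) < e/2" using exp_small[OF e2] .
    obtain m where m: "\<And>\<tau> v. (\<tau>, v) \<in> Y \<Longrightarrow> real N \<le> \<tau> m" using div[of N] by fast
    have mN: "real N \<le> \<tau> m" "real N \<le> \<sigma> n m" for n using m y s[of n] by (auto simp: yy sn)
    define \<eta> where "\<eta> n = (\<Sum>i<m. \<bar>(\<sigma> n (Suc i) - \<sigma> n i) / (\<tau> (Suc i) - \<tau> i) - 1\<bar>)" for n
    have "\<eta> \<longlonglongrightarrow> (\<Sum>i<m. \<bar>(\<tau> (Suc i) - \<tau> i) / (\<tau> (Suc i) - \<tau> i) - 1\<bar>)"
      unfolding \<eta>_def by (intro tendsto_intros l\<sigma> pos)
    then have l\<eta>: "\<eta> \<longlonglongrightarrow> 0" using pos by simp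
    have "(\<lambda>n. 2 * \<eta> n + (\<Sum>i\<le>m. \<bar>\<tau> i - \<sigma> n i\<bar>) + (\<Sum>i\<le>m. \<bar>v i - w n i\<bar>))
       \<longlonglongrightarrow> 2 * 0 + (\<Sum>i\<le>m. \<bar>\<tau> i - \<tau> i\<bar>) + (\<Sum>i\<le>m. \<bar>v i - v i\<bar>)"
      by (intro tendsto_intros l\<eta> l\<sigma> lw)
    then have "eventually (\<lambda>n. 2 * \<eta> n + (\<Sum>i\<le>m. \<bar>\<tau> i - \<sigma> n i\<bar>) + (\<Sum>i\<le>m. \<bar>v i - w n i\<bar>) < e/2) sequentially"
      using e2 by (intro order_tendstoD) auto
    moreover have "eventually (\<lambda>n. \<eta> n < 1/2) sequentially"
      using l\<eta> by (intro order_tendstoD) auto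
    ultimately show "eventually (\<lambda>n. skd (stepf \<tau> v) (stepf (\<sigma> n) (w n)) < a) sequentially"
    proof eventually_elim
      case (elim n)
      have "skd (stepf \<tau> v) (stepf (\<sigma> n) (w n)) \<le>
        ennreal (2 * \<eta> n + (\<Sum>i\<le>m. \<bar>\<tau> i - \<sigma> n i\<bar>) + (\<Sum>i\<le>m. \<bar>v i - w n i\<bar>) + exp (- real N))"
        by (rule skd_stepf[OF c mN \<eta>_def]) (use elim in simp)
      also have "\<dots> \<le> ennreal e" using elim N by (intro ennreal_leI) linarith
      finally show ?case using e by simp
    qed
  qed simp
  then show "(\<lambda>n. skd (case y of (\<tau>, v) \<Rightarrow> stepf \<tau> v) (case s n of (\<tau>, v) \<Rightarrow> stepf \<tau> v)) \<longlonglongrightarrow> 0"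
    by (simp add: yy sn)
qed

section \<open>Locally uniform convergence and equicontinuous paths\<close>

lemma skd_uniform:
  assumes e: "0 \<le> e" and N: "\<And>t. 0 \<le> t \<Longrightarrow> t \<le> N \<Longrightarrow> \<bar>x t - y t\<bar> \<le> e"
  shows "skd x y \<le> ennreal (e + exp (- N))"
proof -
  have L: "(\<lambda>t::real. t) \<in> Lam" "gammaL (\<lambda>t::real. t) \<le> ennreal (2 * 0)"
    using Lam_perturbation[of "\<lambda>t. t" 0] by simp_all
  show ?thesis
  proof (rule skd_leI[OF L(1)])
    show "gammaL (\<lambda>t::real. t) \<le> ennreal (e + exp (- N))" by (rule order_trans[OF L(2)]) simp
    have "(\<integral>\<^sup>+ v. indicator {0..} v * ennreal (exp (- v)) *
           min 1 (SUP t\<in>{0..}. ennreal \<bar>x (min t v) - y (min t v)\<bar>) \<partial>lborel) \<le>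
       (\<integral>\<^sup>+ v. ennreal e * (ennreal (exp (- v)) * indicator {0..} v)
            + ennreal (exp (- v)) * indicator {N..} v \<partial>lborel)"
    proof (rule nn_integral_mono)
      fix r :: real
      let ?m = "min 1 (SUP t\<in>{0..}. ennreal \<bar>x (min t r) - y (min t r)\<bar>)"
      have m1: "?m \<le> 1" by simp
      consider "r < 0" | "0 \<le> r" "N \<le> r" | "0 \<le> r" "r < N" by fastforce
      then show "indicator {0..} r * ennreal (exp (- r)) * ?m \<le>
          ennreal e * (ennreal (exp (- r)) * indicator {0..} r) + ennreal (exp (- r)) * indicator {N..} r"
      proof cases
        case 2
        have "ennreal (exp (- r)) * ?m \<le> ennreal (exp (- r)) * 1" using m1 by (intro mult_mono) auto
        then show ?thesis using 2 by (simp add: add_increasing)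
      next
        case 3
        have "?m \<le> ennreal e"
          by (rule order_trans[OF min.cobounded2], rule SUP_least, rule ennreal_leI) (use N 3 in auto)
        then have "ennreal (exp (- r)) * ?m \<le> ennreal (exp (- r)) * ennreal e" by (intro mult_mono) auto
        then show ?thesis using 3 by (simp add: mult.commute)
      qed simp
    qed
    also have "\<dots> = ennreal e * ennreal (exp (- 0)) + ennreal (exp (- N))"
      by (subst nn_integral_add, measurable,
        subst nn_integral_cmult, measurable) (simp only: nn_integral_exp_tail)
    also have "\<dots> = ennreal (e + exp (- N))" using e by (simp add: ennreal_plus)
    finally show "(\<integral>\<^sup>+ v. indicator {0..} v * ennreal (exp (- v)) *
           min 1 (SUP t\<in>{0..}. ennreal \<bar>x (min t v) - y (min t v)\<bar>) \<partial>lborel) \<le> ennreal (e + exp (- N))" .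
  qed
qed

lemma skd_tendsto_locally_uniform:
  assumes "\<And>T::nat. uniform_limit {0..real T} f x sequentially"
  shows "(\<lambda>n. skd x (f n)) \<longlonglongrightarrow> 0"
proof (rule order_tendstoI)
  fix a :: ennreal assume "0 < a"
  then obtain e where e: "0 < e" "ennreal e < a" by (rule ennreal_pos_less)
  have e2: "0 < e/2" using e by simp
  obtain N :: nat where N: "exp (- real N) < e/2" using exp_small[OF e2] .
  have "eventually (\<lambda>n. \<forall>t\<in>{0..real N}. dist (f n t) (x t) < e/2) sequentially"
    using assms[of N] e2 unfolding uniform_limit_iff by blast
  then show "eventually (\<lambda>n. skd x (f n) < a) sequentially"
  proof eventually_elim
    case (elim n)
    have "skd x (f n) \<le> ennreal (e/2 + exp (- real N))"
      by (rule skd_uniform) (use e elim in \<open>auto simp: dist_real_def abs_minus_commute less_imp_le\<close>)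
    also have "\<dots> \<le> ennreal e" using N by (intro ennreal_leI) simp
    finally show ?case using e by simp
  qed
qed simp

definition rho8 :: "real \<Rightarrow> real" where "rho8 r = sqrt (sqrt (sqrt r))"

text \<open>The linear term absorbs drift, reflections and mesh errors, the root the martingale
  part. Since \<open>sqrt\<close> is odd, both are increasing and continuous on the whole real
  line.\<close>

definition omega :: "real \<Rightarrow> real" where "omega r = r + rho8 r"

lemma rho8_mono: "r \<le> s \<Longrightarrow> rho8 r \<le> rho8 s"
  by (simp add: rho8_def)

lemma omega_mono: "r \<le> s \<Longrightarrow> omega r \<le> omega s"
  by (simp add: omega_def add_mono rho8_mono)

lemma omega_0 [simp]: "omega 0 = 0"
  by (simp add: omega_def rho8_def)

lemma tendsto_omega [tendsto_intros]: "(f \<longlongrightarrow> l) F \<Longrightarrow> ((\<lambda>x. omega (f x)) \<longlongrightarrow> omega l) F"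
  unfolding omega_def rho8_def by (intro tendsto_intros)

lemma continuous_on_omega [continuous_intros]:
  "continuous_on S f \<Longrightarrow> continuous_on S (\<lambda>x. omega (f x))"
  unfolding omega_def rho8_def by (intro continuous_intros)

text \<open>Clocks and values of a step path at mesh \<open>h\<close> that is equicontinuous up to an error of order
  \<open>h\<close>. Index \<open>n\<close> is compared with real time through \<open>n h\<^sup>2\<close>, the minimal duration of
  \<open>n\<close> steps up to the factor \<open>\<kappa>\<close>, which keeps the set closed.\<close>
definition step_codes :: "real \<Rightarrow> real \<Rightarrow> real \<Rightarrow> (nat \<Rightarrow> real) \<Rightarrow> real \<Rightarrow> ((nat \<Rightarrow> real) \<times> (nat \<Rightarrow> real)) set" where
  "step_codes \<kappa> G C L h = {(\<tau>, v). \<tau> 0 = 0 \<and>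
     (\<forall>n. \<kappa> * h\<^sup>2 \<le> \<tau> (Suc n) - \<tau> n \<and> \<tau> (Suc n) - \<tau> n \<le> G * h) \<and> \<bar>v 0\<bar> \<le> C \<and>
     (\<forall>N n m :: nat. real n * h\<^sup>2 \<le> real N \<and> real m * h\<^sup>2 \<le> real N \<longrightarrow>
        \<bar>v n - v m\<bar> \<le> L N * omega (\<bar>\<tau> n - \<tau> m\<bar> + h))}"

text \<open>The real-time counterpart of \<open>step_codes\<close>: a time up to
  \<open>\<kappa> * N\<close> falls into a step whose index \<open>n\<close> satisfies
  \<open>n * h\<^sup>2 \<le> N\<close>. The error \<open>(G + 1) * h\<close> is the error
  \<open>h\<close> of the codes plus one step length. At mesh \<open>0\<close> the paths are
  continuous on the half-line.\<close>

definition equi_paths :: "real \<Rightarrow> real \<Rightarrow> real \<Rightarrow> (nat \<Rightarrow> real) \<Rightarrow> real \<Rightarrow> (real \<Rightarrow> real) set" where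
  "equi_paths \<kappa> G C L h = {x. (\<forall>t\<le>0. x t = x 0) \<and> \<bar>x 0\<bar> \<le> C \<and>
     (\<forall>N s t. 0 \<le> s \<and> 0 \<le> t \<and> s \<le> \<kappa> * real N \<and> t \<le> \<kappa> * real N \<longrightarrow>
        \<bar>x s - x t\<bar> \<le> L N * omega (\<bar>s - t\<bar> + (G + 1) * h))}"

lemma equi_pathsI:
  assumes "\<And>t. t \<le> 0 \<Longrightarrow> x t = x 0" "\<bar>x 0\<bar> \<le> C"
    and "\<And>N s t. 0 \<le> s \<Longrightarrow> 0 \<le> t \<Longrightarrow> s \<le> \<kappa> * real N \<Longrightarrow> t \<le> \<kappa> * real N \<Longrightarrow>
        \<bar>x s - x t\<bar> \<le> L N * omega (\<bar>s - t\<bar> + (G + 1) * h)"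
  shows "x \<in> equi_paths \<kappa> G C L h"
  unfolding equi_paths_def using assms by blast

lemma equi_pathsD:
  assumes "x \<in> equi_paths \<kappa> G C L h"
  shows "t \<le> 0 \<Longrightarrow> x t = x 0" "\<bar>x 0\<bar> \<le> C"
    and "0 \<le> s \<Longrightarrow> 0 \<le> t \<Longrightarrow> s \<le> \<kappa> * real N \<Longrightarrow> t \<le> \<kappa> * real N \<Longrightarrow>
        \<bar>x s - x t\<bar> \<le> L N * omega (\<bar>s - t\<bar> + (G + 1) * h)"
  using assms unfolding equi_paths_def by blast+

lemma step_codes_growth:
  assumes "(\<tau>, v) \<in> step_codes \<kappa> G C L h"
  shows "\<kappa> * (real n * h\<^sup>2) \<le> \<tau> n" "\<tau> n \<le> G * h * real n"
proof -
  have Y: "\<tau> 0 = 0" "\<kappa> * h\<^sup>2 \<le> \<tau> (Suc n) - \<tau> n" "\<tau> (Suc n) - \<tau> n \<le> G * h" for n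
    using assms by (auto simp: step_codes_def)
  show "\<kappa> * (real n * h\<^sup>2) \<le> \<tau> n"
  proof (induction n)
    case (Suc n) then show ?case using Y(2)[of n] by (simp add: algebra_simps)
  qed (simp add: Y)
  show "\<tau> n \<le> G * h * real n"
  proof (induction n)
    case (Suc n) then show ?case using Y(3)[of n] by (simp add: algebra_simps)
  qed (simp add: Y)
qed

lemma step_codes_clock:
  assumes Y: "(\<tau>, v) \<in> step_codes \<kappa> G C L h" and "0 < \<kappa>" "0 < h"
  shows "clock \<tau>"
proof -
  have pos: "0 < \<kappa> * h\<^sup>2" using assms by simp
  have "\<tau> n < \<tau> (Suc n)" for n
    using Y pos by (auto simp: step_codes_def algebra_simps dest!: spec[of _ n])
  then have "strict_mono \<tau>" by (simp add: strict_mono_Suc_iff)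
  moreover have "\<exists>n. x < \<tau> n" for x
  proof -
    obtain n :: nat where "x / (\<kappa> * h\<^sup>2) < real n" using reals_Archimedean2 by blast
    then have "x < \<kappa> * (real n * h\<^sup>2)" using pos by (simp add: divide_less_eq algebra_simps)
    then show ?thesis using step_codes_growth(1)[OF Y, of n] by (intro exI[of _ n]) simp
  qed
  ultimately show ?thesis using Y by (auto simp: clock_def step_codes_def)
qed

lemma step_codes_equi_paths:
  assumes Y: "(\<tau>, v) \<in> step_codes \<kappa> G C L h" and pos: "0 < \<kappa>" "0 < h" and L: "\<And>N. 0 \<le> L N"
  shows "stepf \<tau> v \<in> equi_paths \<kappa> G C L h"
proof -
  have c: "clock \<tau>" using step_codes_clock[OF Y pos] .
  have sm: "strict_mono \<tau>" and z: "\<tau> 0 = 0" using c by (auto simp: clock_def)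
  have "\<bar>stepf \<tau> v s - stepf \<tau> v t\<bar> \<le> L N * omega (\<bar>s - t\<bar> + (G + 1) * h)"
    if st: "0 \<le> s" "0 \<le> t" "s \<le> \<kappa> * real N" "t \<le> \<kappa> * real N" for N s t
  proof -
    obtain n where n: "\<tau> n \<le> s" "s < \<tau> (Suc n)" using clock_cell[OF c st(1)] .
    obtain m where m: "\<tau> m \<le> t" "t < \<tau> (Suc m)" using clock_cell[OF c st(2)] .
    have "\<kappa> * (real n * h\<^sup>2) \<le> \<kappa> * real N" "\<kappa> * (real m * h\<^sup>2) \<le> \<kappa> * real N"
      using step_codes_growth(1)[OF Y, of n] step_codes_growth(1)[OF Y, of m] n m st by linarith+
    then have nm: "real n * h\<^sup>2 \<le> real N" "real m * h\<^sup>2 \<le> real N" using pos by simp_all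
    have g: "\<tau> (Suc n) - \<tau> n \<le> G * h" for n using Y by (auto simp: step_codes_def)
    have "\<bar>stepf \<tau> v s - stepf \<tau> v t\<bar> = \<bar>v n - v m\<bar>"
      using stepf_eq[OF sm st(1) n] stepf_eq[OF sm st(2) m] by metis
    also have "\<dots> \<le> L N * omega (\<bar>\<tau> n - \<tau> m\<bar> + h)" using Y nm by (auto simp: step_codes_def)
    also have "\<dots> \<le> L N * omega (\<bar>s - t\<bar> + (G + 1) * h)"
    proof (intro mult_left_mono omega_mono L)
      have "\<bar>\<tau> n - \<tau> m\<bar> \<le> \<bar>s - t\<bar> + G * h" using g[of n] g[of m] n m by linarith
      then show "\<bar>\<tau> n - \<tau> m\<bar> + h \<le> \<bar>s - t\<bar> + (G + 1) * h" by (simp add: algebra_simps)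
    qed
    finally show ?thesis .
  qed
  moreover have "stepf \<tau> v 0 = v 0"
    using stepf_eq[OF sm, of 0 0 v] sm z strict_monoD[OF sm, of 0 1] by simp
  moreover have "\<bar>v 0\<bar> \<le> C" using Y by (simp add: step_codes_def)
  ultimately show ?thesis by (intro equi_pathsI) (simp add: stepf_def, simp, blast)
qed

lemma continuous_on_fst_coord [continuous_intros]:
  "continuous_on S (\<lambda>y :: (nat \<Rightarrow> real) \<times> (nat \<Rightarrow> real). fst y i)"
  "continuous_on S (\<lambda>y :: (nat \<Rightarrow> real) \<times> (nat \<Rightarrow> real). snd y i)"
  by (rule continuous_on_product_then_coordinatewise[OF continuous_on_fst[OF continuous_on_id]],
      rule continuous_on_product_then_coordinatewise[OF continuous_on_snd[OF continuous_on_id]])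

text \<open>Every condition is a non-strict inequality in finitely many coordinates, under premises
  that do not mention the code, so the set is closed. It lies in a product of intervals: the step
  bounds control the clock, and the modulus between \<open>n\<close> and \<open>0\<close> controls
  \<open>v n\<close>.\<close>

lemma compact_step_codes:
  assumes "0 < h" "0 \<le> \<kappa>" "0 \<le> G" and L: "\<And>N. 0 \<le> L N"
  shows "compact (step_codes \<kappa> G C L h)"
proof -
  let ?Y = "step_codes \<kappa> G C L h"
  let ?B = "\<lambda>n. C + L (nat \<lceil>real n * h\<^sup>2\<rceil>) * omega (G * h * real n + h)"
  have "closed {y. fst y 0 = 0 \<and> (\<forall>n. \<kappa> * h\<^sup>2 \<le> fst y (Suc n) - fst y n \<and> fst y (Suc n) - fst y n \<le> G * h)
      \<and> \<bar>snd y 0\<bar> \<le> C \<and> (\<forall>N n m :: nat. real n * h\<^sup>2 \<le> real N \<and> real m * h\<^sup>2 \<le> real N \<longrightarrow>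
        \<bar>snd y n - snd y m\<bar> \<le> L N * omega (\<bar>fst y n - fst y m\<bar> + h))}"
    by (intro closed_Collect_conj closed_Collect_all closed_Collect_imp open_Collect_const
        closed_Collect_le closed_Collect_eq continuous_intros)
  also have "{y. fst y 0 = 0 \<and> (\<forall>n. \<kappa> * h\<^sup>2 \<le> fst y (Suc n) - fst y n \<and> fst y (Suc n) - fst y n \<le> G * h)
      \<and> \<bar>snd y 0\<bar> \<le> C \<and> (\<forall>N n m :: nat. real n * h\<^sup>2 \<le> real N \<and> real m * h\<^sup>2 \<le> real N \<longrightarrow>
        \<bar>snd y n - snd y m\<bar> \<le> L N * omega (\<bar>fst y n - fst y m\<bar> + h))} = ?Y"
    by (auto simp: step_codes_def)
  finally have cl: "closed ?Y" .
  have sub: "?Y \<subseteq> {f. \<forall>n. 0 \<le> f n \<and> f n \<le> G * h * real n} \<times> {f. \<forall>n. - ?B n \<le> f n \<and> f n \<le> ?B n}"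
  proof safe
    fix \<tau> v n assume Y: "(\<tau>, v) \<in> ?Y"
    have "0 \<le> \<kappa> * (real n * h\<^sup>2)" using assms by simp
    then show t: "0 \<le> \<tau> n" "\<tau> n \<le> G * h * real n" using step_codes_growth[OF Y, of n] by linarith+
    have "real n * h\<^sup>2 \<le> real (nat \<lceil>real n * h\<^sup>2\<rceil>)" by (rule real_nat_ceiling_ge)
    moreover have "\<forall>N n m :: nat. real n * h\<^sup>2 \<le> real N \<and> real m * h\<^sup>2 \<le> real N \<longrightarrow>
        \<bar>v n - v m\<bar> \<le> L N * omega (\<bar>\<tau> n - \<tau> m\<bar> + h)" using Y by (simp add: step_codes_def)
    ultimately have "\<bar>v n - v 0\<bar> \<le> L (nat \<lceil>real n * h\<^sup>2\<rceil>) * omega (\<bar>\<tau> n - \<tau> 0\<bar> + h)"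
      by (metis mult_zero_left of_nat_0 of_nat_0_le_iff)
    also have "\<dots> \<le> L (nat \<lceil>real n * h\<^sup>2\<rceil>) * omega (G * h * real n + h)"
      using t Y by (intro mult_left_mono omega_mono L) (auto simp: step_codes_def)
    finally have "\<bar>v n\<bar> \<le> ?B n" using Y by (auto simp: step_codes_def)
    then show "- ?B n \<le> v n" "v n \<le> ?B n" by linarith+
  qed
  have "compact ({f. \<forall>n. 0 \<le> f n \<and> f n \<le> G * h * real n} \<times> {f. \<forall>n. - ?B n \<le> f n \<and> f n \<le> ?B n})"
    by (intro compact_Times compact_box_fun)
  from compact_Int_closed[OF this cl] show ?thesis using sub by (simp add: Int_absorb1)
qed

lemma compactin_step_codes:
  assumes "0 < h" "0 < \<kappa>" "0 \<le> G" and L: "\<And>N. 0 \<le> L N"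
  shows "compactin Dtop ((\<lambda>(\<tau>, v). stepf \<tau> v) ` step_codes \<kappa> G C L h)"
proof (rule compactin_stepf)
  show "compact (step_codes \<kappa> G C L h)" using assms by (intro compact_step_codes) auto
  show "clock \<tau>" if "(\<tau>, v) \<in> step_codes \<kappa> G C L h" for \<tau> v
    using step_codes_clock[OF that] assms by simp
  fix N :: nat
  have pos: "0 < \<kappa> * h\<^sup>2" using assms by simp
  obtain m :: nat where "real N / (\<kappa> * h\<^sup>2) < real m" using reals_Archimedean2 by blast
  then have m: "real N < \<kappa> * (real m * h\<^sup>2)" using pos by (simp add: divide_less_eq algebra_simps)
  have "real N \<le> \<tau> m" if "(\<tau>, v) \<in> step_codes \<kappa> G C L h" for \<tau> v
    using step_codes_growth(1)[OF that, of m] m by linarith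
  then show "\<exists>m. \<forall>(\<tau>, v)\<in>step_codes \<kappa> G C L h. real N \<le> \<tau> m" by (intro exI[of _ m]) auto
qed

text \<open>Values at the nonnegative rationals, indexed by numerator and spacing. They embed paths
  into a metrizable product, where sequential compactness of a box replaces the diagonal
  argument.\<close>

definition grid_values :: "(real \<Rightarrow> real) \<Rightarrow> nat \<times> nat \<Rightarrow> real" where
  "grid_values x = (\<lambda>(j, k). x (real j / real (Suc k)))"

lemma equi_paths_grid:
  fixes t :: real
  assumes x: "x \<in> equi_paths \<kappa> G C L h" and L: "\<And>N. 0 \<le> L N"
    and t: "0 \<le> t" "t \<le> \<kappa> * real N"
  shows "\<bar>x t - grid_values x (nat \<lfloor>t * Suc k\<rfloor>, k)\<bar> \<le> L N * omega (1 / Suc k + (G + 1) * h)"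
proof -
  let ?j = "nat \<lfloor>t * Suc k\<rfloor>" and ?q = "real (nat \<lfloor>t * Suc k\<rfloor>) / Suc k"
  have f: "real ?j \<le> t * Suc k" "t * Suc k < real ?j + 1" using t by (auto simp: of_nat_nat)
  have q: "0 \<le> ?q" "?q \<le> t" using f by (simp_all add: divide_le_eq)
  have "t < (real ?j + 1) / Suc k" using f(2) by (simp add: less_divide_eq)
  then have q2: "t - ?q \<le> 1 / Suc k" by (simp add: add_divide_distrib)
  have "\<bar>x t - x ?q\<bar> \<le> L N * omega (\<bar>t - ?q\<bar> + (G + 1) * h)"
    by (rule equi_pathsD(3)[OF x t(1) q(1) t(2)]) (use t(2) q(2) in linarith)
  also have "\<dots> \<le> L N * omega (1 / Suc k + (G + 1) * h)"
    using q q2 by (intro mult_left_mono omega_mono L) auto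
  finally show ?thesis by (simp add: grid_values_def)
qed

text \<open>The numerator \<open>2\<close> leaves room for a grid spacing and a mesh error of the
  same size.\<close>

lemma omega_small:
  assumes "0 < e" "0 \<le> c"
  obtains k :: nat where "c * omega (2 / Suc k) < e"
proof -
  have "(\<lambda>k. inverse (real (Suc k))) \<longlonglongrightarrow> 0" by (rule LIMSEQ_inverse_real_of_nat)
  then have "(\<lambda>k. c * omega (2 * inverse (real (Suc k)))) \<longlonglongrightarrow> c * omega (2 * 0)"
    by (intro tendsto_intros)
  then have "eventually (\<lambda>k. c * omega (2 * inverse (real (Suc k))) < e) sequentially"
    using assms by (intro order_tendstoD) auto
  then show thesis using that by (auto simp: eventually_sequentially divide_inverse)
qed

text \<open>Arzela-Ascoli for paths that may jump: equicontinuity up to an error of order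
  \<open>h n\<close> suffices because this error vanishes. The grid values converge along a
  subsequence, and every time up to \<open>T\<close> is close to one of finitely many grid
  points.\<close>

lemma equi_paths_Ascoli:
  fixes x :: "nat \<Rightarrow> real \<Rightarrow> real"
  assumes x: "\<And>n. x n \<in> equi_paths \<kappa> G C L (h n)" and h: "\<And>n. 0 \<le> h n" "h \<longlonglongrightarrow> 0"
    and pos: "0 < \<kappa>" "0 \<le> G" and L: "\<And>N. 0 \<le> L N"
  obtains y r where "strict_mono r" "y \<in> equi_paths \<kappa> G C L 0"
    "\<And>T::nat. uniform_limit {0..real T} (\<lambda>n. x (r n)) y sequentially"
proof -
  have "Bseq h" using h(2) by (auto intro: convergent_imp_Bseq convergentI)
  then obtain hm where hm: "\<And>n. h n \<le> hm" by (auto simp: Bseq_def abs_le_iff)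
  have "\<exists>N::nat. t \<le> \<kappa> * real N" for t
  proof -
    obtain N :: nat where "t / \<kappa> < N" using reals_Archimedean2 by blast
    then show ?thesis using pos by (intro exI[of _ N]) (simp add: divide_less_eq mult.commute)
  qed
  then obtain NN :: "real \<Rightarrow> nat" where NN: "\<And>t. t \<le> \<kappa> * real (NN t)" by metis
  let ?b = "\<lambda>(j, k). C + L (NN (real j / real (Suc k))) * omega (real j / real (Suc k) + (G + 1) * hm)"
  have "grid_values (x n) \<in> {f. \<forall>i. - ?b i \<le> f i \<and> f i \<le> ?b i}" for n
  proof (intro CollectI allI)
    fix i :: "nat \<times> nat"
    obtain j k where i: "i = (j, k)" by force
    let ?q = "real j / real (Suc k)"
    have q: "0 \<le> ?q" by simp
    have "\<bar>x n ?q - x n 0\<bar> \<le> L (NN ?q) * omega (\<bar>?q - 0\<bar> + (G + 1) * h n)"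
      using NN[of ?q] q pos by (intro equi_pathsD(3)[OF x]) auto
    also have "\<dots> \<le> L (NN ?q) * omega (?q + (G + 1) * hm)"
      using hm[of n] pos by (intro mult_left_mono omega_mono L add_mono) auto
    finally have "\<bar>x n ?q\<bar> \<le> ?b (j, k)" using equi_pathsD(2)[OF x, of n] by simp
    then show "- ?b i \<le> grid_values (x n) i \<and> grid_values (x n) i \<le> ?b i"
      by (simp add: i grid_values_def abs_le_iff)
  qed
  moreover have "seq_compact {f. \<forall>i. - ?b i \<le> f i \<and> f i \<le> ?b i}"
    by (rule compact_imp_seq_compact[OF compact_box_fun])
  ultimately obtain l r where r: "strict_mono r" and l: "((\<lambda>n. grid_values (x n)) \<circ> r) \<longlonglongrightarrow> l"
    by (metis (no_types, lifting) seq_compactE)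
  have lc: "(\<lambda>n. grid_values (x (r n)) i) \<longlonglongrightarrow> l i" for i
    using tendsto_coord[OF l] by (simp add: o_def)
  have hr: "(\<lambda>n. h (r n)) \<longlonglongrightarrow> 0" using LIMSEQ_subseq_LIMSEQ[OF h(2) r] by (simp add: o_def)
  have uc: "uniformly_Cauchy_on {0..T} (\<lambda>n. x (r n))" for T :: real
    unfolding uniformly_Cauchy_on_def
  proof (intro allI impI)
    fix e :: real assume e: "0 < e"
    define N where "N = NN T"
    have "0 < e/3" using e by simp
    then obtain k :: nat where k: "L N * omega (2 / Suc k) < e/3" using omega_small L by blast
    define J where "J = nat \<lceil>\<bar>T\<bar> * Suc k\<rceil>"
    have "(\<lambda>n. (G + 1) * h (r n)) \<longlonglongrightarrow> (G + 1) * 0" by (intro tendsto_intros hr)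
    then have "eventually (\<lambda>n. (G + 1) * h (r n) < 1 / Suc k) sequentially" by (rule order_tendstoD) simp
    \<comment> \<open>Two errors of \<open>e/3\<close> between path and grid and two of
      \<open>e/6\<close> between grid values and their limits add up to \<open>e\<close>.\<close>
    moreover have "eventually (\<lambda>n. \<forall>j\<in>{..J}. dist (grid_values (x (r n)) (j, k)) (l (j, k)) < e/6) sequentially"
      by (intro eventually_ball_finite finite_atMost ballI tendstoD[OF lc]) (use e in simp)
    ultimately have "eventually (\<lambda>n. (G + 1) * h (r n) < 1 / Suc k \<and>
        (\<forall>j\<le>J. dist (grid_values (x (r n)) (j, k)) (l (j, k)) < e/6)) sequentially"
      by eventually_elim simp
    then obtain M where M: "\<And>n. n \<ge> M \<Longrightarrow> (G + 1) * h (r n) < 1 / Suc k"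
      "\<And>n j. n \<ge> M \<Longrightarrow> j \<le> J \<Longrightarrow> dist (grid_values (x (r n)) (j, k)) (l (j, k)) < e/6"
      by (auto simp: eventually_sequentially)
    have "dist (x (r m) t) (x (r n) t) < e" if t: "t \<in> {0..T}" and mn: "M \<le> m" "M \<le> n" for t m n
    proof -
      define j where "j = nat \<lfloor>t * Suc k\<rfloor>"
      have jJ: "j \<le> J"
      proof -
        have "t * real (Suc k) \<le> \<bar>T\<bar> * real (Suc k)" using t by (intro mult_right_mono) auto
        then show ?thesis unfolding j_def J_def by (intro nat_mono) linarith
      qed
      have tN: "0 \<le> t" "t \<le> \<kappa> * real N" using t NN[of T] by (auto simp: N_def)
      have *: "\<bar>x (r i) t - grid_values (x (r i)) (j, k)\<bar> < e/3" if "M \<le> i" for i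
      proof -
        have "\<bar>x (r i) t - grid_values (x (r i)) (j, k)\<bar> \<le> L N * omega (1 / Suc k + (G + 1) * h (r i))"
          unfolding j_def by (rule equi_paths_grid[OF x L tN])
        also have "\<dots> \<le> L N * omega (2 / Suc k)"
        proof (intro mult_left_mono omega_mono L)
          have "2 / real (Suc k) = 1 / Suc k + 1 / Suc k" by simp
          then show "1 / real (Suc k) + (G + 1) * h (r i) \<le> 2 / real (Suc k)"
            using M(1)[OF that] by linarith
        qed
        finally show ?thesis using k by simp
      qed
      have "\<bar>grid_values (x (r m)) (j, k) - l (j, k)\<bar> < e/6" "\<bar>grid_values (x (r n)) (j, k) - l (j, k)\<bar> < e/6"
        using M(2)[OF _ jJ] mn by (auto simp: dist_real_def)
      with *[OF mn(1)] *[OF mn(2)] show ?thesis unfolding dist_real_def by linarith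
    qed
    then show "\<exists>M. \<forall>t\<in>{0..T}. \<forall>m\<ge>M. \<forall>n\<ge>M. dist (x (r m) t) (x (r n) t) < e" by blast
  qed
  define y where "y t = lim (\<lambda>n. x (r n) (max 0 t))" for t
  have ul: "uniform_limit {0..T} (\<lambda>n. x (r n)) y sequentially" for T :: real
  proof -
    have "uniform_limit {0..T} (\<lambda>n. x (r n)) (\<lambda>t. lim (\<lambda>n. x (r n) t)) sequentially"
      using Cauchy_uniformly_convergent[OF uc[of T]] by (simp add: uniformly_convergent_uniform_limit_iff)
    then show ?thesis by (rule uniform_limit_cong'[THEN iffD1, rotated -1]) (auto simp: y_def)
  qed
  have pl: "(\<lambda>n. x (r n) t) \<longlonglongrightarrow> y t" if "0 \<le> t" for t
    using tendsto_uniform_limitI[OF ul[of t], of t] that by simp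
  have "y \<in> equi_paths \<kappa> G C L 0"
    unfolding equi_paths_def
  proof (intro CollectI conjI allI impI)
    show "y t = y 0" if "t \<le> 0" for t using that by (simp add: y_def)
    show "\<bar>y 0\<bar> \<le> C"
      by (rule LIMSEQ_le_const2[OF tendsto_rabs[OF pl]]) (use equi_pathsD(2)[OF x] in auto)
    fix N s t assume st: "0 \<le> s \<and> 0 \<le> t \<and> s \<le> \<kappa> * real N \<and> t \<le> \<kappa> * real N"
    show "\<bar>y s - y t\<bar> \<le> L N * omega (\<bar>s - t\<bar> + (G + 1) * 0)"
    proof (rule LIMSEQ_le)
      show "(\<lambda>n. \<bar>x (r n) s - x (r n) t\<bar>) \<longlonglongrightarrow> \<bar>y s - y t\<bar>"
        using st by (intro tendsto_intros pl) auto
      show "(\<lambda>n. L N * omega (\<bar>s - t\<bar> + (G + 1) * h (r n))) \<longlonglongrightarrow> L N * omega (\<bar>s - t\<bar> + (G + 1) * 0)"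
        by (intro tendsto_intros hr)
      show "\<exists>M. \<forall>n\<ge>M. \<bar>x (r n) s - x (r n) t\<bar> \<le> L N * omega (\<bar>s - t\<bar> + (G + 1) * h (r n))"
        using equi_pathsD(3)[OF x] st by blast
    qed
  qed
  with r ul that show thesis by blast
qed

lemma equi_paths_Dset:
  assumes x: "x \<in> equi_paths \<kappa> G C L 0" and pos: "0 < \<kappa>"
  shows "x \<in> Dset"
proof -
  have cont: "(x \<longlongrightarrow> x t) (at t within {0..})" if t: "0 \<le> t" for t
  proof -
    obtain N :: nat where "(t + 1) / \<kappa> < N" using reals_Archimedean2 by blast
    then have N: "t + 1 < \<kappa> * real N" using pos by (simp add: divide_less_eq mult.commute)
    have "((\<lambda>s. L N * omega \<bar>s - t\<bar>) \<longlongrightarrow> L N * omega \<bar>t - t\<bar>) (at t within {0..})"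
      by (intro tendsto_intros)
    then have "((\<lambda>s. L N * omega \<bar>s - t\<bar>) \<longlongrightarrow> 0) (at t within {0..})" by simp
    then have "((\<lambda>s. x s - x t) \<longlongrightarrow> 0) (at t within {0..})"
    proof (rule Lim_null_comparison[rotated])
      have "eventually (\<lambda>s. dist s t < 1) (at t within {0..})"
        by (auto simp: eventually_at intro!: exI[of _ 1])
      moreover have "eventually (\<lambda>s. s \<in> {0..}) (at t within {0..})" by (simp add: eventually_at_filter)
      ultimately show "eventually (\<lambda>s. norm (x s - x t) \<le> L N * omega \<bar>s - t\<bar>) (at t within {0..})"
      proof eventually_elim
        case (elim s)
        then have "0 \<le> s" "s \<le> \<kappa> * real N" "t \<le> \<kappa> * real N" using N by (auto simp: dist_real_def)
        then show ?case using equi_pathsD(3)[OF x, of s t N] t by simp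
      qed
    qed
    then show ?thesis by (simp add: LIM_zero_iff)
  qed
  have "continuous (at_right t) x" if "0 \<le> t" for t
    unfolding continuous_within by (rule tendsto_within_subset[OF cont[OF that]]) (use that in auto)
  moreover have "(x \<longlongrightarrow> x t) (at_left t)" if "0 < t" for t
  proof -
    have "at_left t = at t within ({0..} \<inter> {..<t})"
      by (rule at_within_nhd[of t "{0<..}"]) (use that in auto)
    then show ?thesis using tendsto_within_subset[OF cont[of t], of "{0..} \<inter> {..<t}"] that by auto
  qed
  moreover have "\<forall>t\<le>0. x t = x 0" using equi_pathsD(1)[OF x] by blast
  ultimately show ?thesis unfolding Dset_def by blast
qed

lemma tendsto_if_subseqs:
  fixes f :: "nat \<Rightarrow> 'b::topological_space"
  assumes "\<And>r0 :: nat \<Rightarrow> nat. strict_mono r0 \<Longrightarrow> \<exists>r. strict_mono r \<and> (\<lambda>n. f (r0 (r n))) \<longlonglongrightarrow> l"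
  shows "f \<longlonglongrightarrow> l"
proof (rule topological_tendstoI, rule ccontr)
  fix S assume S: "open S" "l \<in> S" and "\<not> eventually (\<lambda>n. f n \<in> S) sequentially"
  then have "\<forall>m. \<exists>n\<ge>m. f n \<notin> S" by (auto simp: eventually_sequentially)
  then have "infinite {n. f n \<notin> S}" by (auto simp: infinite_nat_iff_unbounded_le)
  then obtain r0 :: "nat \<Rightarrow> nat" where r0: "strict_mono r0" "\<And>n. f (r0 n) \<notin> S"
    using infinite_enumerate by blast
  obtain r where "(\<lambda>n. f (r0 (r n))) \<longlonglongrightarrow> l" using assms[OF r0(1)] by blast
  then have "eventually (\<lambda>n. f (r0 (r n)) \<in> S) sequentially" using S by (rule topological_tendstoD)
  then show False using r0(2) by simp
qed

text \<open>The Ascoli argument is sequential, whereas \<open>Dtop\<close> is known only through its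
  open sets. Coding by \<open>grid_values\<close> bridges the gap: the code set is a subset of a
  metric space, hence compact once sequentially compact; equicontinuity makes the code injective,
  and the decoder maps convergent sequences to \<open>skd\<close> convergent ones.\<close>

lemma compactin_equi_paths:
  assumes pos: "0 < \<kappa>" "0 \<le> G" and L: "\<And>N. 0 \<le> L N"
  shows "compactin Dtop (equi_paths \<kappa> G C L 0)"
proof -
  let ?E = "equi_paths \<kappa> G C L 0"
  have AA: "\<exists>y r. strict_mono r \<and> y \<in> ?E \<and> (grid_values \<circ> x \<circ> r) \<longlonglongrightarrow> grid_values y \<and> (\<lambda>n. skd y (x (r n))) \<longlonglongrightarrow> 0"
    if xE: "\<And>n::nat. x n \<in> ?E" for x
  proof -
    obtain y r where r: "strict_mono r" "y \<in> ?E"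
      and ul: "\<And>T::nat. uniform_limit {0..real T} (\<lambda>n. x (r n)) y sequentially"
      by (rule equi_paths_Ascoli[of x \<kappa> G C L "\<lambda>_. 0", OF xE _ _ pos L]) auto
    have "(\<lambda>n. grid_values (x (r n)) (j, k)) \<longlonglongrightarrow> grid_values y (j, k)" for j k
    proof -
      have "real j / real (Suc k) \<le> real j" by (simp add: divide_le_eq mult_le_cancel_left1)
      then show ?thesis
        using tendsto_uniform_limitI[OF ul[of j], of "real j / real (Suc k)"] by (simp add: grid_values_def)
    qed
    then have "(\<lambda>n. grid_values (x (r n))) \<longlonglongrightarrow> grid_values y"
      by (intro tendsto_fun_coordwise) auto
    then show ?thesis using r skd_tendsto_locally_uniform[OF ul] by (auto simp: o_def)
  qed
  have inj: "inj_on grid_values ?E"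
  proof (rule inj_onI, rule ext)
    fix x y and t :: real assume xy: "x \<in> ?E" "y \<in> ?E" "grid_values x = grid_values y"
    have *: "x t = y t" if t: "0 \<le> t" for t
    proof -
      obtain N :: nat where "t / \<kappa> < N" using reals_Archimedean2 by blast
      then have N: "t \<le> \<kappa> * real N" using pos by (simp add: divide_less_eq mult.commute)
      have "\<bar>x t - y t\<bar> \<le> e" if e: "0 < e" for e
      proof -
        have "0 < e/2" using e by simp
        then obtain k :: nat where k: "L N * omega (2 / Suc k) < e/2" using omega_small L by blast
        have "L N * omega (1 / Suc k + (G + 1) * 0) \<le> L N * omega (2 / Suc k)"
          by (intro mult_left_mono omega_mono L) (simp add: field_simps)
        then show ?thesis
          using equi_paths_grid[OF xy(1) L t N, of k] equi_paths_grid[OF xy(2) L t N, of k] k xy(3) by simp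
      qed
      then have "\<bar>x t - y t\<bar> \<le> 0" by (rule field_le_epsilon) simp
      then show ?thesis by simp
    qed
    show "x t = y t"
      using *[of t] *[of 0] equi_pathsD(1)[OF xy(1), of t] equi_pathsD(1)[OF xy(2), of t]
      by (cases "0 \<le> t") simp_all
  qed
  define d where "d = inv_into ?E grid_values"
  have d: "d (grid_values x) = x" if "x \<in> ?E" for x using inj that by (simp add: d_def)
  have "compact (grid_values ` ?E)"
    unfolding compact_eq_seq_compact_metric seq_compact_def
  proof (intro allI impI)
    fix f :: "nat \<Rightarrow> nat \<times> nat \<Rightarrow> real" assume f: "\<forall>n. f n \<in> grid_values ` ?E"
    then have "\<forall>n. \<exists>x. x \<in> ?E \<and> f n = grid_values x" by auto
    then obtain x where x: "\<And>n. x n \<in> ?E" "\<And>n. f n = grid_values (x n)" by metis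
    then have "f = grid_values \<circ> x" by auto
    then show "\<exists>l\<in>grid_values ` ?E. \<exists>r. strict_mono r \<and> (f \<circ> r) \<longlonglongrightarrow> l" using AA[of x] x by blast
  qed
  then have "compactin Dtop (d ` (grid_values ` ?E))"
  proof (rule compactin_Dtop_image)
    show "d ` grid_values ` ?E \<subseteq> Dset" using d equi_paths_Dset pos by auto
    fix y and s :: "nat \<Rightarrow> nat \<times> nat \<Rightarrow> real"
    assume y: "y \<in> grid_values ` ?E" and s: "\<And>n. s n \<in> grid_values ` ?E" and lim: "s \<longlonglongrightarrow> y"
    show "(\<lambda>n. skd (d y) (d (s n))) \<longlonglongrightarrow> 0"
    \<comment> \<open>Ascoli gives a limit only along a further subsequence, but its code must be
      \<open>y\<close>, so all these limits are the path \<open>d y\<close>.\<close>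
    proof (rule tendsto_if_subseqs)
      fix r0 :: "nat \<Rightarrow> nat" assume r0: "strict_mono r0"
      have dE: "d (s n) \<in> ?E" for n using s[of n] d by auto
      obtain z r where r: "strict_mono r" "z \<in> ?E" and z: "(grid_values \<circ> (\<lambda>n. d (s (r0 n))) \<circ> r) \<longlonglongrightarrow> grid_values z"
        and k: "(\<lambda>n. skd z (d (s (r0 (r n))))) \<longlonglongrightarrow> 0"
        using AA[of "\<lambda>n. d (s (r0 n))"] dE by auto
      have gd: "grid_values (d (s n)) = s n" for n using s[of n] d by auto
      have "(\<lambda>n. s (r0 (r n))) \<longlonglongrightarrow> y"
        using LIMSEQ_subseq_LIMSEQ[OF lim strict_mono_o[OF r0 r(1)]] by (simp add: o_def)
      moreover have "(\<lambda>n. s (r0 (r n))) \<longlonglongrightarrow> grid_values z" using z by (simp add: o_def gd)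
      ultimately have "y = grid_values z" by (rule LIMSEQ_unique)
      then have "d y = z" using d r by simp
      then show "\<exists>r. strict_mono r \<and> (\<lambda>n. skd (d y) (d (s (r0 (r n))))) \<longlonglongrightarrow> 0" using k r by auto
    qed
  qed
  moreover have "d ` (grid_values ` ?E) = ?E" using d by (auto simp: image_iff)
  ultimately show ?thesis by simp
qed

text \<open>The union of a finite subcover of \<open>K0\<close> is an open set that swallows all but
  finitely many of the \<open>K k\<close>.\<close>

lemma compactin_sequence_Un:
  assumes K0: "compactin X K0" and K: "\<And>k :: nat. compactin X (K k)"
    and ev: "\<And>V. openin X V \<Longrightarrow> K0 \<subseteq> V \<Longrightarrow> eventually (\<lambda>k. K k \<subseteq> V) sequentially"
  shows "compactin X (K0 \<union> (\<Union>k. K k))"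
  unfolding compactin_def
proof (intro conjI allI impI)
  show "K0 \<union> (\<Union>k. K k) \<subseteq> topspace X" using K0 K by (auto simp: compactin_def)
  fix \<U> assume U: "(\<forall>U\<in>\<U>. openin X U) \<and> K0 \<union> (\<Union>k. K k) \<subseteq> \<Union>\<U>"
  then obtain F0 where F0: "finite F0" "F0 \<subseteq> \<U>" "K0 \<subseteq> \<Union>F0"
    using K0 unfolding compactin_def by (metis Un_subset_iff)
  have "eventually (\<lambda>k. K k \<subseteq> \<Union>F0) sequentially" using U F0 by (intro ev openin_Union) auto
  then obtain M where M: "\<And>k. k \<ge> M \<Longrightarrow> K k \<subseteq> \<Union>F0" by (auto simp: eventually_sequentially)
  have "compactin X (\<Union>k<M. K k)" by (rule compactin_Union) (use K in auto)
  moreover have "(\<Union>k<M. K k) \<subseteq> \<Union>\<U>" using U by (meson UNIV_I UN_least UN_subset_iff le_supE)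
  ultimately obtain F1 where F1: "finite F1" "F1 \<subseteq> \<U>" "(\<Union>k<M. K k) \<subseteq> \<Union>F1"
    using U unfolding compactin_def by metis
  have "K k \<subseteq> \<Union>(F0 \<union> F1)" for k
    using M[of k] F1(3) by (cases "k < M") auto
  then have "K0 \<union> (\<Union>k. K k) \<subseteq> \<Union>(F0 \<union> F1)" using F0(3) by (simp add: UN_subset_iff le_supI1)
  then show "\<exists>\<F>. finite \<F> \<and> \<F> \<subseteq> \<U> \<and> K0 \<union> (\<Union>k. K k) \<subseteq> \<Union>\<F>"
    using F0 F1 by (intro exI[of _ "F0 \<union> F1"]) simp
qed

text \<open>If infinitely many meshes had step paths outside an open \<open>V\<close> around the
  continuous limit set, Ascoli would give a subsequence converging to a member of that set, and so
  eventually inside \<open>V\<close>.\<close>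

lemma compactin_step_paths:
  assumes pos: "0 < \<kappa>" "0 \<le> G" "0 < B" and L: "\<And>N. 0 \<le> L N"
  shows "compactin Dtop (equi_paths \<kappa> G C L 0 \<union>
    (\<Union>k::nat. (\<lambda>(\<tau>, v). stepf \<tau> v) ` step_codes \<kappa> G C L (B / Suc k)))"
proof (rule compactin_sequence_Un)
  show "compactin Dtop (equi_paths \<kappa> G C L 0)" by (rule compactin_equi_paths[OF pos(1,2) L])
  show "compactin Dtop ((\<lambda>(\<tau>, v). stepf \<tau> v) ` step_codes \<kappa> G C L (B / Suc k))" for k
    using pos L by (intro compactin_step_codes) auto
  fix V assume V: "openin Dtop V" "equi_paths \<kappa> G C L 0 \<subseteq> V"
  show "eventually (\<lambda>k. (\<lambda>(\<tau>, v). stepf \<tau> v) ` step_codes \<kappa> G C L (B / Suc k) \<subseteq> V) sequentially"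
  proof (rule ccontr)
    assume "\<not> ?thesis"
    then have "\<forall>m. \<exists>k\<ge>m. \<exists>y\<in>step_codes \<kappa> G C L (B / Suc k). stepf (fst y) (snd y) \<notin> V"
      by (fastforce simp: eventually_sequentially)
    then obtain k y where k: "\<And>m::nat. k m \<ge> m" and y: "\<And>m. y m \<in> step_codes \<kappa> G C L (B / Suc (k m))"
      "\<And>m. stepf (fst (y m)) (snd (y m)) \<notin> V" by metis
    define h where "h m = B / Suc (k m)" for m
    define x where "x m = stepf (fst (y m)) (snd (y m))" for m
    have hp: "0 < h m" for m using pos by (simp add: h_def)
    have "(\<lambda>m. B * inverse (real (Suc m))) \<longlonglongrightarrow> B * 0"
      by (intro tendsto_intros LIMSEQ_inverse_real_of_nat)
    then have lim: "(\<lambda>m. B * inverse (real (Suc m))) \<longlonglongrightarrow> 0" by simp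
    have h0: "h \<longlonglongrightarrow> 0"
    proof (rule tendsto_sandwich[OF _ _ tendsto_const lim])
      show "eventually (\<lambda>m. 0 \<le> h m) sequentially" using hp by (simp add: less_imp_le)
      show "eventually (\<lambda>m. h m \<le> B * inverse (real (Suc m))) sequentially"
        using pos k by (auto simp: h_def field_simps intro!: always_eventually mult_left_mono)
    qed
    have xE: "x m \<in> equi_paths \<kappa> G C L (h m)" for m
      unfolding x_def using y(1)[of m] by (intro step_codes_equi_paths[OF _ pos(1) hp L]) (simp add: h_def)
    have xD: "x m \<in> Dset" for m
      unfolding x_def using y(1)[of m]
      by (intro stepf_Dset step_codes_clock[where v = "snd (y m)", OF _ pos(1) hp[of m]]) (simp add: h_def)
    obtain z r where r: "strict_mono r" "z \<in> equi_paths \<kappa> G C L 0"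
      and ul: "\<And>T::nat. uniform_limit {0..real T} (\<lambda>n. x (r n)) z sequentially"
      by (rule equi_paths_Ascoli[of x \<kappa> G C L h, OF xE less_imp_le[OF hp] h0 pos(1,2) L]) blast
    obtain e where e: "e > 0" "{y\<in>Dset. skd z y < e} \<subseteq> V" using V(1)[unfolded openin_Dtop] V(2) r(2) by blast
    have "eventually (\<lambda>n. skd z (x (r n)) < e) sequentially"
      using skd_tendsto_locally_uniform[OF ul] e(1) by (rule order_tendstoD)
    then obtain n where "skd z (x (r n)) < e" by (auto simp: eventually_sequentially)
    then show False using e xD y(2) by (auto simp: x_def)
  qed
qed

text \<open>Every element of \<open>Hset B\<close> has the form \<open>B / Suc k\<close>, so the meshes only accumulate at \<open>0\<close>.\<close>
lemma tight_family_step_paths: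
  assumes pos: "0 < \<kappa>" "0 \<le> G" "0 < B"
    and X: "\<And>\<epsilon>. 0 < \<epsilon> \<Longrightarrow> \<exists>L. (\<forall>N. 0 \<le> L N) \<and> (\<forall>h\<in>Hset B. \<exists>A\<in>sets (M h). 1 - \<epsilon> \<le> measure (M h) A \<and>
        (\<forall>\<omega>\<in>A. \<exists>\<tau> v. (\<tau>, v) \<in> step_codes \<kappa> G C L h \<and> X h \<omega> = stepf \<tau> v))"
  shows "tight_family (Hset B) M X Dtop"
  unfolding tight_family_def
proof (intro allI impI)
  fix \<epsilon> :: real assume "0 < \<epsilon>"
  from X[OF this] obtain L where L': "(\<forall>N. 0 \<le> L N) \<and> (\<forall>h\<in>Hset B. \<exists>A\<in>sets (M h). 1 - \<epsilon> \<le> measure (M h) A \<and>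
        (\<forall>\<omega>\<in>A. \<exists>\<tau> v. (\<tau>, v) \<in> step_codes \<kappa> G C L h \<and> X h \<omega> = stepf \<tau> v))"
    by (rule exE)
  note L = conjunct1[OF L', rule_format] and LA = bspec[OF conjunct2[OF L']]
  let ?K = "equi_paths \<kappa> G C L 0 \<union>
    (\<Union>k::nat. (\<lambda>(\<tau>, v). stepf \<tau> v) ` step_codes \<kappa> G C L (B / Suc k))"
  have "\<exists>A\<in>sets (M h). A \<subseteq> {\<omega> \<in> space (M h). X h \<omega> \<in> ?K} \<and> 1 - \<epsilon> \<le> measure (M h) A" if h: "h \<in> Hset B" for h
  proof -
    obtain A where A: "A \<in> sets (M h)" "1 - \<epsilon> \<le> measure (M h) A"
      "\<And>\<omega>. \<omega> \<in> A \<Longrightarrow> \<exists>\<tau> v. (\<tau>, v) \<in> step_codes \<kappa> G C L h \<and> X h \<omega> = stepf \<tau> v" using LA[OF h] by blast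
    obtain k :: nat where k: "0 < k" "B = real k * h" "0 < h" using h by (auto simp: Hset_def)
    then have "h = B / Suc (k - 1)" by simp
    then have "X h \<omega> \<in> ?K" if "\<omega> \<in> A" for \<omega> using A(3)[OF that] by (fastforce simp: image_iff)
    then show ?thesis using A sets.sets_into_space[OF A(1)] by (intro bexI[of _ A]) auto
  qed
  then show "\<exists>K. compactin Dtop K \<and> (\<forall>h\<in>Hset B. \<exists>A\<in>sets (M h).
      A \<subseteq> {\<omega> \<in> space (M h). X h \<omega> \<in> K} \<and> 1 - \<epsilon> \<le> measure (M h) A)"
    using compactin_step_paths[where C = C, OF pos L] by (intro exI[of _ ?K]) simp
qed

lemma tight_family_prod:
  assumes p: "\<And>h. h \<in> H \<Longrightarrow> prob_space (M h)"
    and X: "tight_family H M X S" and Y: "tight_family H M Y T"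
  shows "tight_family H M (\<lambda>h \<omega>. (X h \<omega>, Y h \<omega>)) (prod_topology S T)"
  unfolding tight_family_def
proof (intro allI impI)
  fix \<epsilon> :: real assume "0 < \<epsilon>"
  then have e: "0 < \<epsilon>/2" by simp
  from X[unfolded tight_family_def, rule_format, OF e] obtain K where K': "compactin S K \<and>
    (\<forall>h\<in>H. \<exists>A\<in>sets (M h). A \<subseteq> {\<omega> \<in> space (M h). X h \<omega> \<in> K} \<and> 1 - \<epsilon>/2 \<le> measure (M h) A)" by (rule exE)
  note K = conjunct1[OF K'] bspec[OF conjunct2[OF K']]
  from Y[unfolded tight_family_def, rule_format, OF e] obtain J where J': "compactin T J \<and>
    (\<forall>h\<in>H. \<exists>A\<in>sets (M h). A \<subseteq> {\<omega> \<in> space (M h). Y h \<omega> \<in> J} \<and> 1 - \<epsilon>/2 \<le> measure (M h) A)" by (rule exE)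
  note J = conjunct1[OF J'] bspec[OF conjunct2[OF J']]
  have "\<exists>A\<in>sets (M h). A \<subseteq> {\<omega> \<in> space (M h). (X h \<omega>, Y h \<omega>) \<in> K \<times> J} \<and> 1 - \<epsilon> \<le> measure (M h) A"
    if h: "h \<in> H" for h
  proof -
    interpret prob_space "M h" by (rule p[OF h])
    obtain A where A: "A \<in> events" "A \<subseteq> {\<omega> \<in> space (M h). X h \<omega> \<in> K}" "1 - \<epsilon>/2 \<le> prob A" using K(2)[OF h] by blast
    obtain A' where A': "A' \<in> events" "A' \<subseteq> {\<omega> \<in> space (M h). Y h \<omega> \<in> J}" "1 - \<epsilon>/2 \<le> prob A'" using J(2)[OF h] by blast
    have "prob (A \<union> A') = prob A + prob A' - prob (A \<inter> A')" using A A' by (intro measure_Un3) (auto simp: fmeasurable_eq_sets)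
    moreover have "1 - \<epsilon> = (1 - \<epsilon>/2) + (1 - \<epsilon>/2) - 1" by simp
    ultimately have "1 - \<epsilon> \<le> prob (A \<inter> A')" using A(3) A'(3) prob_le_1[of "A \<union> A'"] by linarith
    then show ?thesis using A A' by (intro bexI[of _ "A \<inter> A'"]) auto
  qed
  moreover have "compactin (prod_topology S T) (K \<times> J)" using K(1) J(1) by (simp add: compactin_Times)
  ultimately show "\<exists>K. compactin (prod_topology S T) K \<and> (\<forall>h\<in>H. \<exists>A\<in>sets (M h).
      A \<subseteq> {\<omega> \<in> space (M h). (X h \<omega>, Y h \<omega>) \<in> K} \<and> 1 - \<epsilon> \<le> measure (M h) A)" by blast
qed

section \<open>Compact sets of paths with separated jumps\<close>

definition jump_codes :: "(nat \<Rightarrow> real) \<Rightarrow> real \<Rightarrow> ((nat \<Rightarrow> real) \<times> (nat \<Rightarrow> real)) set" where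
  "jump_codes d m = {(\<tau>, v). \<tau> 0 = 0 \<and>
     (\<forall>n. d (2 * n) \<le> \<tau> (Suc n) - \<tau> n \<and> \<tau> (Suc n) - \<tau> n \<le> 2) \<and>
     (\<forall>N n. real N \<le> real n * d N \<longrightarrow> real N \<le> \<tau> n) \<and> (\<forall>n. 0 \<le> v n \<and> v n \<le> m)}"

text \<open>Here \<open>d N\<close> bounds the gaps that start before time \<open>N\<close>. As
  ticks are at most \<open>2\<close> apart, the \<open>n\<close>-th tick comes no later than
  \<open>2 * n\<close>, which explains the index in \<open>d (2 * n)\<close>. These gaps may be
  summable, so divergence uniform over the codes rests on the clause that compares \<open>N\<close>
  with \<open>n * d N\<close>.\<close>

lemma compactin_jump_codes:
  assumes d: "\<And>N. 0 < d N"
  shows "compactin Dtop ((\<lambda>(\<tau>, v). stepf \<tau> v) ` jump_codes d m)"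
proof -
  have ex: "\<exists>n. real N \<le> real n * d N" for N
  proof -
    obtain n :: nat where "real N / d N < n" using reals_Archimedean2 by blast
    then show ?thesis using d[of N] by (intro exI[of _ n]) (simp add: divide_less_eq)
  qed
  have div: "\<exists>n. \<forall>(\<tau>, v)\<in>jump_codes d m. real N \<le> \<tau> n" for N
    using ex[of N] by (auto simp: jump_codes_def)
  show ?thesis
  proof (rule compactin_stepf[OF _ _ div])
    have "closed {y. fst y 0 = 0 \<and> (\<forall>n. d (2 * n) \<le> fst y (Suc n) - fst y n \<and> fst y (Suc n) - fst y n \<le> 2) \<and>
       (\<forall>N n. real N \<le> real n * d N \<longrightarrow> real N \<le> fst y n) \<and> (\<forall>n::nat. 0 \<le> snd y n \<and> snd y n \<le> m)}"
      by (intro closed_Collect_conj closed_Collect_all closed_Collect_imp open_Collect_const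
          closed_Collect_le closed_Collect_eq continuous_intros)
    also have "{y. fst y 0 = 0 \<and> (\<forall>n. d (2 * n) \<le> fst y (Suc n) - fst y n \<and> fst y (Suc n) - fst y n \<le> 2) \<and>
       (\<forall>N n. real N \<le> real n * d N \<longrightarrow> real N \<le> fst y n) \<and> (\<forall>n::nat. 0 \<le> snd y n \<and> snd y n \<le> m)} = jump_codes d m"
      by (auto simp: jump_codes_def)
    finally have cl: "closed (jump_codes d m)" .
    have sub: "jump_codes d m \<subseteq> {f. \<forall>n. 0 \<le> f n \<and> f n \<le> 2 * real n} \<times> {f. \<forall>n. 0 \<le> f n \<and> f n \<le> m}"
    proof safe
      fix \<tau> v n assume Y: "(\<tau>, v) \<in> jump_codes d m"
      then have g: "d (2 * n) \<le> \<tau> (Suc n) - \<tau> n" "\<tau> (Suc n) - \<tau> n \<le> 2" "\<tau> 0 = 0" for n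
        by (auto simp: jump_codes_def)
      show "0 \<le> \<tau> n" by (induction n) (use g(1) g(3) d in \<open>auto intro: order_trans less_imp_le simp: algebra_simps\<close>, smt (verit) d g(1))
      show "\<tau> n \<le> 2 * real n"
      proof (induction n)
        case (Suc n) then show ?case using g(2)[of n] by simp
      qed (simp add: g)
      show "0 \<le> v n" "v n \<le> m" using Y by (auto simp: jump_codes_def)
    qed
    have "compact ({f. \<forall>n. 0 \<le> f n \<and> f n \<le> 2 * real n} \<times> {f. \<forall>n. 0 \<le> f n \<and> f n \<le> m})"
      by (intro compact_Times compact_box_fun)
    from compact_Int_closed[OF this cl] show "compact (jump_codes d m)" using sub by (simp add: Int_absorb1)
    fix \<tau> v assume Y: "(\<tau>, v) \<in> jump_codes d m"
    have "d (2 * n) \<le> \<tau> (Suc n) - \<tau> n" for n using Y by (auto simp: jump_codes_def)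
    then have "\<tau> n < \<tau> (Suc n)" for n using d[of "2 * n"] by (smt (verit))
    then have "strict_mono \<tau>" by (simp add: strict_mono_Suc_iff)
    moreover have "\<exists>n. x < \<tau> n" for x
    proof -
      obtain N :: nat where "x < real N" using reals_Archimedean2 by blast
      moreover obtain n where "real N \<le> \<tau> n" using div[of N] Y by auto
      ultimately show ?thesis by (intro exI[of _ n]) simp
    qed
    ultimately show "clock \<tau>" using Y by (auto simp: clock_def jump_codes_def)
  qed
qed

text \<open>Separation puts at most one element into each cell of length \<open>\<delta>\<close>, so
  an element with the least cell index is the least element.\<close>

lemma least_in_separated:
  fixes S :: "real set"
  assumes "S \<noteq> {}" and lb: "\<And>s. s \<in> S \<Longrightarrow> a \<le> s" and \<delta>: "0 < \<delta>"
    and sep: "\<And>s s'. s \<in> S \<Longrightarrow> s' \<in> S \<Longrightarrow> s < s' \<Longrightarrow> \<delta> \<le> s' - s"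
  shows "\<exists>s\<in>S. \<forall>s'\<in>S. s \<le> s'"
proof -
  obtain s0 where "s0 \<in> S" using assms(1) by auto
  then obtain s where s: "s \<in> S" "\<And>s'. s' \<in> S \<Longrightarrow> nat \<lfloor>(s - a) / \<delta>\<rfloor> \<le> nat \<lfloor>(s' - a) / \<delta>\<rfloor>"
    using ex_has_least_nat[of "\<lambda>s. s \<in> S" s0 "\<lambda>s. nat \<lfloor>(s - a) / \<delta>\<rfloor>"] by blast
  have "s \<le> s'" if s': "s' \<in> S" for s'
  proof (rule ccontr)
    assume "\<not> s \<le> s'"
    then have "s' + \<delta> \<le> s" using sep[OF s' s(1)] by linarith
    then have "(s' + \<delta> - a) / \<delta> \<le> (s - a) / \<delta>" using \<delta> by (intro divide_right_mono) auto
    moreover have "(s' + \<delta> - a) / \<delta> = (s' - a) / \<delta> + 1" using \<delta> by (simp add: field_simps)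
    ultimately have "\<lfloor>(s' - a) / \<delta>\<rfloor> + 1 \<le> \<lfloor>(s - a) / \<delta>\<rfloor>" by linarith
    moreover have "0 \<le> \<lfloor>(s' - a) / \<delta>\<rfloor>" using lb[OF s'] \<delta> by simp
    ultimately show False using s(2)[OF s'] by linarith
  qed
  then show ?thesis using s(1) by blast
qed

text \<open>A forced clock tick \<open>t + 1\<close> is inserted only when no jump follows within \<open>(t, t + 2]\<close>, so ticks
  never come close to jumps.\<close>
lemma jump_path_recode:
  fixes f :: "real \<Rightarrow> real" and S :: "real set"
  assumes d: "\<And>N. 0 < d N" "\<And>N. d N \<le> 1" "\<And>N N'. N \<le> N' \<Longrightarrow> d N' \<le> d N"
    and S0: "\<And>s. s \<in> S \<Longrightarrow> d 0 \<le> s"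
    and sep: "\<And>N s s'. s \<in> S \<Longrightarrow> s' \<in> S \<Longrightarrow> s < s' \<Longrightarrow> s \<le> real N \<Longrightarrow> d N \<le> s' - s"
    and f0: "\<And>t. t \<le> 0 \<Longrightarrow> f t = f 0"
    and fc: "\<And>s t. 0 \<le> s \<Longrightarrow> s \<le> t \<Longrightarrow> S \<inter> {s<..t} = {} \<Longrightarrow> f s = f t"
    and fm: "\<And>t. 0 \<le> f t" "\<And>t. f t \<le> m"
  shows "\<exists>\<tau> v. (\<tau>, v) \<in> jump_codes d m \<and> f = stepf \<tau> v"
proof -
  define nxt where "nxt t = (if S \<inter> {t<..t+2} = {} then t + 1
     else SOME s. s \<in> S \<inter> {t<..t+2} \<and> (\<forall>s'\<in>S \<inter> {t<..t+2}. s \<le> s'))" for t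
  have nx: "nxt t \<in> S \<inter> {t<..t+2} \<and> (\<forall>s'\<in>S \<inter> {t<..t+2}. nxt t \<le> s')" if ne: "S \<inter> {t<..t+2} \<noteq> {}" for t
  proof -
    obtain N :: nat where N: "t + 2 < real N" using reals_Archimedean2 by blast
    have "\<exists>s\<in>S \<inter> {t<..t+2}. \<forall>s'\<in>S \<inter> {t<..t+2}. s \<le> s'"
      by (rule least_in_separated[OF ne, of t "d N"]) (use d N in \<open>auto intro!: sep\<close>)
    then have "\<exists>s. s \<in> S \<inter> {t<..t+2} \<and> (\<forall>s'\<in>S \<inter> {t<..t+2}. s \<le> s')" by blast
    from someI_ex[OF this] show ?thesis unfolding nxt_def using ne by simp
  qed
  have nx1: "t < nxt t" "nxt t \<le> t + 2" "S \<inter> {t<..<nxt t} = {}" for t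
  proof -
    show "t < nxt t" "nxt t \<le> t + 2" using nx[of t] by (cases "S \<inter> {t<..t+2} = {}"; auto simp: nxt_def)+
    show "S \<inter> {t<..<nxt t} = {}"
    proof (cases "S \<inter> {t<..t+2} = {}")
      case True
      then have "nxt t = t + 1" by (simp add: nxt_def)
      moreover have "{t<..<t+1} \<subseteq> {t<..t+2}" by auto
      ultimately show ?thesis using True by auto
    next
      case False
      have "s \<notin> {t<..<nxt t}" if "s \<in> S" for s
        using nx[OF False] that by (auto dest!: bspec[of _ _ s])
      then show ?thesis by blast
    qed
  qed
  \<comment> \<open>Invariant of the ticks: each is \<open>0\<close>, a jump, or a forced tick with
    no jump in the unit interval after it. In each case the distance to the next tick is bounded
    below, by \<open>S0\<close>, by \<open>sep\<close>, or by \<open>1\<close>.\<close>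
  define I where "I t \<longleftrightarrow> 0 \<le> t \<and> (t = 0 \<or> t \<in> S \<or> S \<inter> {t<..t+1} = {})" for t
  have Inx: "I (nxt t)" if "I t" for t
  proof (cases "S \<inter> {t<..t+2} = {}")
    case True
    then have "nxt t = t + 1" by (simp add: nxt_def)
    moreover have "S \<inter> {t+1<..t+1+1} = {}" using True by auto
    ultimately show ?thesis using that by (auto simp: I_def)
  next
    case False
    from nx[OF this] show ?thesis using that nx1(1)[of t] by (auto simp: I_def)
  qed
  have gap: "d N \<le> nxt t - t" if t: "I t" "t \<le> real N" for t N
  proof (cases "S \<inter> {t<..t+2} = {}")
    case True
    then show ?thesis using d(2)[of N] by (simp add: nxt_def)
  next
    case False
    note n = nx[OF this]
    from t(1) consider "t = 0" | "t \<in> S" | "S \<inter> {t<..t+1} = {}" by (auto simp: I_def)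
    then show ?thesis
    proof cases
      case 1 then show ?thesis using S0[of "nxt t"] n d(3)[of 0 N] by auto
    next
      case 2 then show ?thesis using sep[of t "nxt t" N] n t by auto
    next
      case 3
      then have "t + 1 < nxt t" using n by (meson IntD1 IntI disjoint_iff greaterThanAtMost_iff not_le nx1(1))
      then show ?thesis using d(2)[of N] by linarith
    qed
  qed
  define \<tau> where "\<tau> n = (nxt ^^ n) 0" for n :: nat
  have \<tau>0: "\<tau> 0 = 0" and \<tau>S: "\<tau> (Suc n) = nxt (\<tau> n)" for n by (simp_all add: \<tau>_def)
  have I\<tau>: "I (\<tau> n)" for n by (induction n) (auto simp: \<tau>0 \<tau>S Inx, simp add: I_def)
  have \<tau>2: "\<tau> n \<le> 2 * real n" for n
  proof (induction n)
    case (Suc n) then show ?case using nx1(2)[of "\<tau> n"] by (simp add: \<tau>S)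
  qed (simp add: \<tau>0)
  have g1: "d (2 * n) \<le> \<tau> (Suc n) - \<tau> n" for n
    using gap[OF I\<tau>[of n], of "2 * n"] \<tau>2[of n] by (simp add: \<tau>S)
  \<comment> \<open>Every gap that starts before time \<open>N\<close> is at least
    \<open>d N\<close>, so \<open>n\<close> steps either pass \<open>N\<close> or cover
    \<open>n * d N\<close>.\<close>
  have g2: "real N \<le> \<tau> n \<or> real n * d N \<le> \<tau> n" for N n
  proof (induction n)
    case (Suc n)
    show ?case
    proof (cases "real N \<le> \<tau> n")
      case True then show ?thesis using nx1(1)[of "\<tau> n"] by (simp add: \<tau>S)
    next
      case False
      then show ?thesis using gap[OF I\<tau>[of n], of N] Suc by (simp add: \<tau>S algebra_simps)
    qed
  qed (simp add: \<tau>0)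
  have Y: "(\<tau>, \<lambda>n. f (\<tau> n)) \<in> jump_codes d m"
    unfolding jump_codes_def
  proof (intro CollectI case_prodI conjI allI impI)
    show "\<tau> (Suc n) - \<tau> n \<le> 2" for n using nx1(2)[of "\<tau> n"] by (simp add: \<tau>S)
    show "real N \<le> \<tau> n" if "real N \<le> real n * d N" for N n using g2[of N n] that by linarith
  qed (use \<tau>0 g1 fm in auto)
  have sm: "strict_mono \<tau>" using nx1(1) by (simp add: strict_mono_Suc_iff \<tau>S)
  have cl: "clock \<tau>"
  proof -
    have "\<exists>n. x < \<tau> n" for x
    proof -
      obtain N :: nat where N: "x < real N" using reals_Archimedean2 by blast
      obtain n :: nat where "real N / d N < n" using reals_Archimedean2 by blast
      then have "real N \<le> real n * d N" using d(1)[of N] by (simp add: divide_less_eq)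
      then have "real N \<le> \<tau> n" using g2[of N n] by linarith
      then show ?thesis using N by (intro exI[of _ n]) simp
    qed
    then show ?thesis using sm \<tau>0 by (simp add: clock_def)
  qed
  have "f t = stepf \<tau> (\<lambda>n. f (\<tau> n)) t" for t
  proof -
    have *: "f t = stepf \<tau> (\<lambda>n. f (\<tau> n)) t" if t: "0 \<le> t" for t
    proof -
      obtain n where n: "\<tau> n \<le> t" "t < \<tau> (Suc n)" using clock_cell[OF cl t] .
      have "{\<tau> n<..t} \<subseteq> {\<tau> n<..<nxt (\<tau> n)}" using n by (auto simp: \<tau>S)
      then have "S \<inter> {\<tau> n<..t} = {}" using nx1(3)[of "\<tau> n"] by blast
      then have "f (\<tau> n) = f t" using n clock_nonneg[OF cl] by (intro fc) auto
      then show ?thesis using stepf_eq[OF sm t n, of "\<lambda>n. f (\<tau> n)"] by simp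
    qed
    show ?thesis using *[of t] *[of 0] f0[of t] stepf_neg[of t \<tau> "\<lambda>n. f (\<tau> n)"] by (cases "0 \<le> t") simp_all
  qed
  then show ?thesis using Y by blast
qed

section \<open>Probability measures on a compact space\<close>

text \<open>The indicator of a closed set is a decreasing limit of continuous cut-offs of the
  distance, and the closed sets form an intersection-stable generator of the Borel sets.\<close>

lemma prob_eq_if_integral_continuous_eq:
  fixes M N :: "'a::metric_space measure"
  assumes "prob_space M" "prob_space N" and sets: "sets M = sets borel" "sets N = sets borel"
    and eq: "\<And>f :: 'a \<Rightarrow> real. continuous_on UNIV f \<Longrightarrow> (\<And>z. 0 \<le> f z \<and> f z \<le> 1) \<Longrightarrow> (\<integral>z. f z \<partial>M) = (\<integral>z. f z \<partial>N)"
  shows "M = N"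
proof -
  interpret M: prob_space M by fact
  interpret N: prob_space N by fact
  have cl: "emeasure M C = emeasure N C" if C: "closed C" for C
  proof (cases "C = {}")
    \<comment> \<open>Nonemptiness matters: \<open>infdist\<close> to the empty set is
      \<open>0\<close>, so the cut-offs would tend to \<open>1\<close> there.\<close>
    case False
    define f where "f n z = max 0 (1 - real n * infdist z C)" for n z
    have fc: "continuous_on UNIV (f n)" for n unfolding f_def by (intro continuous_intros)
    have f01: "0 \<le> f n z \<and> f n z \<le> 1" for n z by (auto simp: f_def infdist_nonneg)
    have lim: "(\<lambda>n. f n z) \<longlonglongrightarrow> indicator C z" for z
    proof (cases "z \<in> C")
      case True then show ?thesis by (simp add: f_def)
    next
      case nz: False
      then have "0 < infdist z C" using C False in_closed_iff_infdist_zero[OF C False, of z] infdist_nonneg[of z C] by auto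
      then obtain m :: nat where m: "1 / infdist z C < m" using reals_Archimedean2 by blast
      have "f n z = 0" if "n \<ge> m" for n
      proof -
        have "1 / infdist z C < real n" using m that by linarith
        then have "1 < real n * infdist z C" using \<open>0 < infdist z C\<close> by (simp add: divide_less_eq)
        then show ?thesis by (simp add: f_def)
      qed
      then have "eventually (\<lambda>n. f n z = indicator C z) sequentially"
        using nz by (auto simp: eventually_sequentially)
      then show ?thesis by (rule tendsto_eventually)
    qed
    have L: "(\<lambda>n. \<integral>z. f n z \<partial>K) \<longlonglongrightarrow> measure K C" if "prob_space K" "sets K = sets borel" for K :: "'a measure"
    proof -
      interpret K: prob_space K by fact
      note [measurable_cong] = that(2)
      have [measurable]: "f n \<in> borel_measurable K" for n
        using borel_measurable_continuous_onI[OF fc[of n]] by (simp cong: measurable_cong_sets)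
      have Cm: "C \<in> sets K" using C that by auto
      have "(\<lambda>n. \<integral>z. f n z \<partial>K) \<longlonglongrightarrow> (\<integral>z. indicator C z \<partial>K)"
        by (rule integral_dominated_convergence[where w = "\<lambda>_. 1"]) (use f01 lim Cm in auto)
      then show ?thesis using Cm by simp
    qed
    have "measure M C = measure N C"
      using LIMSEQ_unique[OF L[OF assms(1) sets(1)]] L[OF assms(2) sets(2)] eq[OF fc f01] by simp
    then show ?thesis by (simp add: M.emeasure_eq_measure N.emeasure_eq_measure)
  qed simp
  show ?thesis
  proof (rule measure_eqI_generator_eq[where E = "Collect closed" and \<Omega> = UNIV and A = "\<lambda>_. UNIV"])
    show "Int_stable (Collect closed :: 'a set set)" by (auto simp: Int_stable_def)
    show "sets M = sigma_sets UNIV (Collect closed)" "sets N = sigma_sets UNIV (Collect closed)"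
      using sets by (simp_all add: borel_eq_closed)
    show "emeasure M UNIV \<noteq> \<infinity>" by simp
  qed (use cl in auto)
qed

lemma integral_finite_range:
  fixes F :: "'w \<Rightarrow> real"
  assumes "prob_space M" and W: "finite W" "\<And>x. x \<in> space M \<Longrightarrow> g x \<in> W"
    and m: "\<And>w. w \<in> W \<Longrightarrow> {x\<in>space M. g x = w} \<in> sets M"
  shows "(\<integral>x. F (g x) \<partial>M) = (\<Sum>w\<in>W. F w * measure M {x\<in>space M. g x = w})"
proof -
  interpret prob_space M by fact
  have "(\<integral>x. F (g x) \<partial>M) = (\<integral>x. (\<Sum>w\<in>W. F w * indicator {x\<in>space M. g x = w} x) \<partial>M)"
  proof (rule Bochner_Integration.integral_cong[OF refl])
    fix x assume x: "x \<in> space M"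
    have "(\<Sum>w\<in>W. F w * indicator {x\<in>space M. g x = w} x) = (\<Sum>w\<in>W. if w = g x then F w else 0)"
      by (rule sum.cong) (use x in \<open>auto simp: indicator_def\<close>)
    also have "\<dots> = F (g x)" using W x by (simp add: sum.delta)
    finally show "F (g x) = (\<Sum>w\<in>W. F w * indicator {x\<in>space M. g x = w} x)" by simp
  qed
  also have "\<dots> = (\<Sum>w\<in>W. \<integral>x. F w * indicator {x\<in>space M. g x = w} x \<partial>M)"
    by (rule Bochner_Integration.integral_sum) (use m in \<open>auto intro!: integrable_mult_right integrable_real_indicator simp: emeasure_eq_measure\<close>)
  also have "\<dots> = (\<Sum>w\<in>W. F w * measure M {x\<in>space M. g x = w})"
    by (rule sum.cong) (use m in auto)
  finally show ?thesis .
qed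

section \<open>Probability measures coded by masses on a binary tree\<close>

locale bit_coding =
  fixes Z :: "'a::{metric_space,second_countable_topology} set" and Bs :: "nat \<Rightarrow> 'a set"
  assumes Z: "compact Z" "Z \<noteq> {}" and Bs: "\<And>k. open (Bs k)"
    and mesh: "\<And>e. 0 < e \<Longrightarrow> \<exists>k. \<forall>z\<in>Z. \<forall>z'\<in>Z. (\<forall>i<k. z \<in> Bs i \<longleftrightarrow> z' \<in> Bs i) \<longrightarrow> dist z z' < e"
begin

definition bits :: "nat \<Rightarrow> 'a \<Rightarrow> bool list" where
  "bits k z = map (\<lambda>i. z \<in> Bs i) [0..<k]"

definition rep :: "bool list \<Rightarrow> 'a" where
  "rep w = (SOME z. z \<in> Z \<and> bits (length w) z = w)"

text \<open>Consistent families of cell masses. The last clause keeps mass away from words that no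
  point realizes, for which \<open>rep\<close> is arbitrary; so every node that
  \<open>decode\<close> visits has a representative in its cell. All clauses are closed conditions
  on finitely many coordinates.\<close>

definition weights :: "(bool list \<Rightarrow> real) set" where
  "weights = {p. p [] = 1 \<and> (\<forall>w. 0 \<le> p w \<and> p w = p (w @ [False]) + p (w @ [True])) \<and>
     (\<forall>w. (\<forall>z\<in>Z. bits (length w) z \<noteq> w) \<longrightarrow> p w = 0)}"

text \<open>Words are ordered lexicographically with \<open>False\<close> first. Each
  \<open>True\<close> in \<open>w\<close> skips the \<open>False\<close> sibling at that depth, and
  the skipped masses add up to the left end of the interval of \<open>w\<close>.\<close>

definition left_end :: "(bool list \<Rightarrow> real) \<Rightarrow> bool list \<Rightarrow> real" where
  "left_end p w = (\<Sum>i<length w. if w ! i then p (take i w @ [False]) else 0)"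

primrec node :: "(bool list \<Rightarrow> real) \<Rightarrow> real \<Rightarrow> nat \<Rightarrow> bool list" where
  "node p x 0 = []"
| "node p x (Suc k) = node p x k @ [left_end p (node p x k) + p (node p x k @ [False]) \<le> x]"

definition decode :: "(bool list \<Rightarrow> real) \<Rightarrow> real \<Rightarrow> 'a" where
  "decode p x = lim (\<lambda>k. rep (node p x k))"

text \<open>The intervals \<open>[left_end p w, left_end p w + p w)\<close> over words \<open>w\<close> of a fixed length
  partition \<open>[0, 1)\<close>, so Lebesgue measure pushed through \<open>decode p\<close> gives the cell of \<open>w\<close> mass \<open>p w\<close>.\<close>
definition decode_measure :: "(bool list \<Rightarrow> real) \<Rightarrow> 'a measure" where
  "decode_measure p = distr (restrict_space lborel {0..<1}) borel (decode p)"

lemma length_bits [simp]: "length (bits k z) = k" by (simp add: bits_def)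

lemma take_bits: "k \<le> j \<Longrightarrow> take k (bits j z) = bits k z"
  by (simp add: bits_def take_map)

lemma bits_Suc: "bits (Suc k) z = bits k z @ [z \<in> Bs k]" by (simp add: bits_def)

lemma bits_eq: "bits k z = bits k z' \<Longrightarrow> i < k \<Longrightarrow> z \<in> Bs i \<longleftrightarrow> z' \<in> Bs i"
  by (simp add: bits_def)

lemma mesh_bits:
  assumes "0 < e"
  obtains k where "\<And>z z'. z \<in> Z \<Longrightarrow> z' \<in> Z \<Longrightarrow> bits k z = bits k z' \<Longrightarrow> dist z z' < e"
  using mesh[OF assms] bits_eq by metis

lemma rep:
  assumes "z \<in> Z" "bits (length w) z = w"
  shows "rep w \<in> Z" "bits (length w) (rep w) = w"
  unfolding rep_def using someI[of "\<lambda>z. z \<in> Z \<and> bits (length w) z = w" z] assms by auto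

lemma left_end_snoc: "left_end p (w @ [b]) = left_end p w + (if b then p (w @ [False]) else 0)"
proof -
  have "(\<Sum>i<length w. if (w @ [b]) ! i then p (take i (w @ [b]) @ [False]) else 0) = left_end p w"
    unfolding left_end_def by (rule sum.cong) (auto simp: nth_append)
  then show ?thesis by (simp add: left_end_def)
qed

lemma length_node [simp]: "length (node p x k) = k" by (induction k) auto

lemma weightsD:
  assumes "p \<in> weights"
  shows "p [] = 1" "0 \<le> p w" "p w = p (w @ [False]) + p (w @ [True])"
    "p w \<noteq> 0 \<Longrightarrow> \<exists>z\<in>Z. bits (length w) z = w"
  using assms unfolding weights_def by blast+

lemma left_end_bounds:
  assumes p: "p \<in> weights" shows "0 \<le> left_end p w \<and> left_end p w + p w \<le> 1"
proof (induction w rule: rev_induct)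
  case Nil then show ?case using weightsD(1)[OF p] by (simp add: left_end_def)
next
  case (snoc b w)
  then show ?case using weightsD(3)[OF p, of w] weightsD(2)[OF p, of "w @ [False]"] weightsD(2)[OF p, of "w @ [True]"]
    by (cases b) (auto simp: left_end_snoc)
qed

lemma node_bounds:
  assumes p: "p \<in> weights" and x: "x \<in> {0..<1}"
  shows "left_end p (node p x k) \<le> x \<and> x < left_end p (node p x k) + p (node p x k)"
proof (induction k)
  case 0 then show ?case using x weightsD(1)[OF p] by (simp add: left_end_def)
next
  case (Suc k)
  then show ?case using weightsD(3)[OF p, of "node p x k"] by (auto simp: left_end_snoc)
qed

lemma node_unique:
  assumes p: "p \<in> weights" and x: "x \<in> {0..<1}"
  shows "left_end p w \<le> x \<Longrightarrow> x < left_end p w + p w \<Longrightarrow> node p x (length w) = w"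
proof (induction w rule: rev_induct)
  case (snoc b w)
  have "left_end p w \<le> x" "x < left_end p w + p w"
    using snoc.prems weightsD(3)[OF p, of w] weightsD(2)[OF p, of "w @ [False]"] weightsD(2)[OF p, of "w @ [True]"]
    by (cases b; simp add: left_end_snoc)+
  then have "node p x (length w) = w" by (rule snoc.IH)
  then show ?case using snoc.prems by (cases b) (auto simp: left_end_snoc)
qed simp

lemma node_take: "k \<le> j \<Longrightarrow> take k (node p x j) = node p x k"
  by (induction j) (auto simp: le_Suc_eq)

lemma node_rep:
  assumes p: "p \<in> weights" and x: "x \<in> {0..<1}"
  shows "rep (node p x k) \<in> Z" "bits k (rep (node p x k)) = node p x k"
proof -
  have "p (node p x k) \<noteq> 0" using node_bounds[OF p x, of k] by auto
  from weightsD(4)[OF p this] obtain z where "z \<in> Z" "bits (length (node p x k)) z = node p x k" by blast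
  from rep[OF this] show "rep (node p x k) \<in> Z" "bits k (rep (node p x k)) = node p x k" by auto
qed

lemma node_rep_bits:
  assumes p: "p \<in> weights" and x: "x \<in> {0..<1}" and "k \<le> j"
  shows "bits k (rep (node p x j)) = node p x k"
  using node_rep(2)[OF p x, of j] take_bits[OF \<open>k \<le> j\<close>] node_take[OF \<open>k \<le> j\<close>] by metis

lemma decode:
  assumes p: "p \<in> weights" and x: "x \<in> {0..<1}"
  shows "decode p x \<in> Z" "(\<lambda>k. rep (node p x k)) \<longlonglongrightarrow> decode p x"
proof -
  let ?s = "\<lambda>k. rep (node p x k)"
  have "Cauchy ?s"
  proof (rule metric_CauchyI)
    fix e :: real assume "0 < e"
    then obtain k where k: "\<And>z z'. z \<in> Z \<Longrightarrow> z' \<in> Z \<Longrightarrow> bits k z = bits k z' \<Longrightarrow> dist z z' < e"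
      by (rule mesh_bits) blast
    show "\<exists>M. \<forall>m\<ge>M. \<forall>n\<ge>M. dist (?s m) (?s n) < e"
      using node_rep(1)[OF p x] node_rep_bits[OF p x] by (intro exI[of _ k] allI impI k) auto
  qed
  then obtain l where l: "l \<in> Z" "?s \<longlonglongrightarrow> l"
    using completeE[OF compact_imp_complete[OF Z(1)], of ?s] node_rep(1)[OF p x] by blast
  then show "decode p x \<in> Z" "?s \<longlonglongrightarrow> decode p x" using limI[OF l(2)] by (simp_all add: decode_def)
qed

text \<open>Cells need not be closed, so a decoded point may lie outside the cells along its branch.
  It is still a limit of representatives that share the first \<open>k\<close> bits, and a
  non-strict bound on \<open>f\<close> survives the limit.\<close>

lemma cell_approximation:
  fixes f :: "'a \<Rightarrow> real"
  assumes f: "continuous_on Z f" and e: "0 < e"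
  obtains k where "\<And>z. z \<in> Z \<Longrightarrow> \<bar>f z - f (rep (bits k z))\<bar> \<le> e"
    "\<And>p x. p \<in> weights \<Longrightarrow> x \<in> {0..<1} \<Longrightarrow> \<bar>f (decode p x) - f (rep (node p x k))\<bar> \<le> e"
proof -
  have "uniformly_continuous_on Z f" using f Z by (intro compact_uniformly_continuous)
  then obtain d where d: "0 < d" "\<And>z z'. z \<in> Z \<Longrightarrow> z' \<in> Z \<Longrightarrow> dist z z' < d \<Longrightarrow> dist (f z) (f z') < e"
    using e unfolding uniformly_continuous_on_def by (metis dist_commute)
  obtain k where k: "\<And>z z'. z \<in> Z \<Longrightarrow> z' \<in> Z \<Longrightarrow> bits k z = bits k z' \<Longrightarrow> dist z z' < d"
    using mesh_bits[OF d(1)] by blast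
  show thesis
  proof (rule that[of k])
    fix z assume z: "z \<in> Z"
    have "rep (bits k z) \<in> Z" "bits k (rep (bits k z)) = bits k z" using rep[OF z, of "bits k z"] by simp_all
    then have "dist (f z) (f (rep (bits k z))) < e" using z by (intro d(2) k) auto
    then show "\<bar>f z - f (rep (bits k z))\<bar> \<le> e" by (simp add: dist_real_def)
  next
    fix p x assume px: "p \<in> weights" "x \<in> {0..<1::real}"
    have "(\<lambda>j. f (rep (node p x j))) \<longlonglongrightarrow> f (decode p x)"
      by (rule continuous_on_tendsto_compose[OF f decode(2)[OF px] decode(1)[OF px]])
        (use node_rep(1)[OF px] in auto)
    then have "(\<lambda>j. \<bar>f (rep (node p x j)) - f (rep (node p x k))\<bar>) \<longlonglongrightarrow> \<bar>f (decode p x) - f (rep (node p x k))\<bar>"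
      by (intro tendsto_intros)
    moreover have "\<bar>f (rep (node p x j)) - f (rep (node p x k))\<bar> \<le> e" if "j \<ge> k" for j
    proof -
      have "dist (f (rep (node p x j))) (f (rep (node p x k))) < e"
        using node_rep(1)[OF px] node_rep_bits[OF px] that by (intro d(2) k) auto
      then show ?thesis by (simp add: dist_real_def)
    qed
    ultimately show "\<bar>f (decode p x) - f (rep (node p x k))\<bar> \<le> e" by (intro LIMSEQ_le_const2) auto
  qed
qed

abbreviation unit_M :: "real measure" where "unit_M \<equiv> restrict_space lborel {0..<1}"

lemma prob_unit_M: "prob_space unit_M"
  by (rule prob_spaceI) (simp add: emeasure_restrict_space space_restrict_space)

lemma space_unit_M [simp]: "space unit_M = {0..<1}" by (simp add: space_restrict_space)

lemma node_sets:
  assumes p: "p \<in> weights"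
  shows "{x \<in> space unit_M. node p x k = w} \<in> sets unit_M"
    "length w = k \<Longrightarrow> measure unit_M {x \<in> space unit_M. node p x k = w} = p w"
proof -
  have *: "{x \<in> {0..<1}. node p x k = w} = {left_end p w..<left_end p w + p w}" if "length w = k"
    using left_end_bounds[OF p, of w] node_bounds[OF p, of _ k] node_unique[OF p, of _ w] that by force
  show "{x \<in> space unit_M. node p x k = w} \<in> sets unit_M"
  proof (cases "length w = k")
    case True
    have "{left_end p w..<left_end p w + p w} \<subseteq> {0..<1}"
      using left_end_bounds[OF p, of w] by auto
    then show ?thesis using *[OF True] by (simp add: sets_restrict_space_iff)
  next
    case False
    then have "{x \<in> space unit_M. node p x k = w} = {}" by auto
    then show ?thesis by (simp only: sets.empty_sets)
  qed
  assume k: "length w = k"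
  have "{left_end p w..<left_end p w + p w} \<subseteq> {0..<1}" using left_end_bounds[OF p, of w] by auto
  then show "measure unit_M {x \<in> space unit_M. node p x k = w} = p w"
    using weightsD(2)[OF p, of w] *[OF k] by (simp add: measure_restrict_space del: atLeastLessThan_iff)
qed

lemma measurable_node:
  assumes p: "p \<in> weights"
  shows "(\<lambda>x. f (node p x k)) \<in> measurable unit_M (borel :: 'b::topological_space measure)"
proof -
  have "(\<lambda>x. node p x k) \<in> measurable unit_M (count_space UNIV)"
    using node_sets(1)[OF p] by (subst measurable_count_space_eq_countable) (auto simp: vimage_def Int_def conj_commute)
  then show ?thesis by (rule measurable_compose) simp
qed

lemma bits_sets: "{z. bits k z = w} \<in> sets borel"
proof (induction k arbitrary: w)
  case 0 show ?case by (cases "w = []") (auto simp: bits_def)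
next
  case (Suc k)
  show ?case
  proof (cases w rule: rev_cases)
    case Nil then show ?thesis by (simp add: bits_Suc)
  next
    case (snoc v b)
    have "(if b then Bs k else - Bs k) \<in> sets borel" using Bs by auto
    then have "{z. bits k z = v} \<inter> (if b then Bs k else - Bs k) \<in> sets borel" using Suc by auto
    moreover have "{z. bits k z = v} \<inter> (if b then Bs k else - Bs k) = {z. bits (Suc k) z = w}"
      unfolding snoc bits_Suc by auto
    ultimately show ?thesis by simp
  qed
qed

lemma measurable_decode:
  assumes p: "p \<in> weights" shows "decode p \<in> borel_measurable unit_M"
proof (rule borel_measurable_LIMSEQ_metric[where f = "\<lambda>k x. rep (node p x k)"])
  fix k
  show "(\<lambda>x. rep (node p x k)) \<in> borel_measurable unit_M" by (rule measurable_node[OF p])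
qed (use decode(2)[OF p] in auto)

lemma finite_words: "finite {w :: bool list. length w = k}"
  using finite_lists_length_eq[of "UNIV :: bool set" k] by simp

lemma decode_measure:
  assumes p: "p \<in> weights"
  shows "prob_space (decode_measure p)" "sets (decode_measure p) = sets borel" "emeasure (decode_measure p) Z = 1"
proof -
  note m = measurable_decode[OF p]
  interpret prob_space unit_M by (rule prob_unit_M)
  show "prob_space (decode_measure p)" unfolding decode_measure_def using m by (rule prob_space_distr)
  show "sets (decode_measure p) = sets borel" by (simp add: decode_measure_def)
  have "Z \<in> sets borel" using Z by (simp add: compact_imp_closed)
  then have "emeasure (decode_measure p) Z = emeasure unit_M (decode p -` Z \<inter> space unit_M)"
    unfolding decode_measure_def by (rule emeasure_distr[OF m])
  also have "decode p -` Z \<inter> space unit_M = space unit_M" using decode(1)[OF p] by auto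
  finally show "emeasure (decode_measure p) Z = 1" using emeasure_space_1 by simp
qed

lemma measurable_indicator_Z:
  fixes f :: "'a \<Rightarrow> real"
  assumes "continuous_on Z f"
  shows "(\<lambda>z. indicator Z z * f z) \<in> borel_measurable borel"
  using borel_measurable_continuous_on_indicator[OF _ assms] Z by (simp add: compact_imp_closed)

lemma bounded_on_Z:
  fixes f :: "'a \<Rightarrow> real"
  assumes "continuous_on Z f"
  obtains C where "0 \<le> C" "\<And>z. \<bar>indicator Z z * f z\<bar> \<le> C"
proof -
  have "bounded (f ` Z)" using assms Z by (intro compact_imp_bounded compact_continuous_image)
  then obtain C where C: "0 < C" "\<And>z. z \<in> Z \<Longrightarrow> \<bar>f z\<bar> \<le> C" by (auto simp: bounded_pos)
  show thesis by (rule that[of C]) (use C in \<open>auto simp: indicator_def\<close>)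
qed

text \<open>The depth \<open>k\<close> depends on \<open>f\<close> and \<open>e\<close> only. This
  makes integrals continuous in \<open>p\<close>, and the second bound uses the same finite sum for
  a given measure, so that it can be compared with the decoding of its own cell masses.\<close>

lemma integral_decode_measure:
  fixes f :: "'a \<Rightarrow> real"
  assumes f: "continuous_on Z f" and e: "0 < e"
  obtains k where
    "\<And>p. p \<in> weights \<Longrightarrow> \<bar>(\<integral>z. indicator Z z * f z \<partial>decode_measure p) - (\<Sum>w | length w = k. f (rep w) * p w)\<bar> \<le> e"
    "\<And>\<mu> p. prob_space \<mu> \<Longrightarrow> sets \<mu> = sets borel \<Longrightarrow> emeasure \<mu> Z = 1 \<Longrightarrow>
      p = (\<lambda>w. measure \<mu> {z \<in> Z. bits (length w) z = w}) \<Longrightarrow>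
      \<bar>(\<integral>z. indicator Z z * f z \<partial>\<mu>) - (\<Sum>w | length w = k. f (rep w) * p w)\<bar> \<le> e"
proof -
  obtain k where k: "\<And>z. z \<in> Z \<Longrightarrow> \<bar>f z - f (rep (bits k z))\<bar> \<le> e"
    "\<And>p x. p \<in> weights \<Longrightarrow> x \<in> {0..<1} \<Longrightarrow> \<bar>f (decode p x) - f (rep (node p x k))\<bar> \<le> e"
    using cell_approximation[OF f e] by blast
  obtain C where C: "0 \<le> C" "\<And>z. \<bar>indicator Z z * f z\<bar> \<le> C" using bounded_on_Z[OF f] by blast
  have fC: "\<bar>f z\<bar> \<le> C" if "z \<in> Z" for z using C(2)[of z] that by simp
  note mf = measurable_indicator_Z[OF f]
  have close: "\<bar>(\<integral>x. a x \<partial>M) - (\<integral>x. b x \<partial>M)\<bar> \<le> e"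
    if M: "prob_space M" and i: "integrable M a" "integrable M b" and ab: "AE x in M. \<bar>a x - b x\<bar> \<le> e" for M :: "'c measure" and a b :: "'c \<Rightarrow> real"
  proof -
    interpret prob_space M by fact
    have "\<bar>(\<integral>x. a x \<partial>M) - (\<integral>x. b x \<partial>M)\<bar> = \<bar>\<integral>x. a x - b x \<partial>M\<bar>" using i by simp
    also have "\<dots> \<le> (\<integral>x. \<bar>a x - b x\<bar> \<partial>M)" by (rule integral_abs_bound)
    also have "\<dots> \<le> (\<integral>x. e \<partial>M)" using i ab by (intro integral_mono_AE) auto
    finally show ?thesis by (simp add: prob_space)
  qed
  show thesis
  proof (rule that[of k])
    fix p assume p: "p \<in> weights"
    interpret prob_space unit_M by (rule prob_unit_M)
    note m = measurable_decode[OF p]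
    have 1: "(\<integral>z. indicator Z z * f z \<partial>decode_measure p) = (\<integral>x. indicator Z (decode p x) * f (decode p x) \<partial>unit_M)"
      unfolding decode_measure_def by (rule integral_distr[OF m mf])
    have mn: "(\<lambda>x. f (rep (node p x k))) \<in> borel_measurable unit_M" by (rule measurable_node[OF p])
    have 2: "(\<integral>x. f (rep (node p x k)) \<partial>unit_M) = (\<Sum>w | length w = k. f (rep w) * measure unit_M {x \<in> space unit_M. node p x k = w})"
      by (rule integral_finite_range[OF prob_unit_M finite_words]) (use node_sets(1)[OF p] in auto)
    have 3: "\<dots> = (\<Sum>w | length w = k. f (rep w) * p w)"
    proof (rule sum.cong[OF refl])
      fix w :: "bool list" assume "w \<in> {w. length w = k}"
      then have "length w = k" by simp
      from node_sets(2)[OF p this] show "f (rep w) * measure unit_M {x \<in> space unit_M. node p x k = w} = f (rep w) * p w"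
        by (simp only:)
    qed
    have "\<bar>(\<integral>x. indicator Z (decode p x) * f (decode p x) \<partial>unit_M) - (\<integral>x. f (rep (node p x k)) \<partial>unit_M)\<bar> \<le> e"
    proof (rule close[OF prob_unit_M])
      show "integrable unit_M (\<lambda>x. indicator Z (decode p x) * f (decode p x))"
        using C measurable_compose[OF m mf] by (intro integrable_const_bound[of _ C]) auto
      show "integrable unit_M (\<lambda>x. f (rep (node p x k)))"
        using mn by (intro integrable_const_bound[of _ C]) (auto intro!: fC node_rep(1)[OF p])
      show "AE x in unit_M. \<bar>indicator Z (decode p x) * f (decode p x) - f (rep (node p x k))\<bar> \<le> e"
        using decode(1)[OF p] k(2)[OF p] by (intro AE_I2) auto
    qed
    then show "\<bar>(\<integral>z. indicator Z z * f z \<partial>decode_measure p) - (\<Sum>w | length w = k. f (rep w) * p w)\<bar> \<le> e"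
      using 1 2 3 by simp
  next
    fix \<mu> p assume \<mu>: "prob_space \<mu>" "sets \<mu> = sets borel" "emeasure \<mu> Z = 1"
      and p: "p = (\<lambda>w. measure \<mu> {z \<in> Z. bits (length w) z = w})"
    interpret prob_space \<mu> by fact
    have sp: "space \<mu> = UNIV" using sets_eq_imp_space_eq[OF \<mu>(2)] by simp
    have Zs: "Z \<in> sets \<mu>" using Z \<mu> by (simp add: compact_imp_closed)
    have aeZ: "AE z in \<mu>. z \<in> Z" using \<mu>(3) Zs by (simp add: AE_in_set_eq_1 emeasure_eq_measure)
    have bm: "{z. bits k z = w} \<in> sets \<mu>" for w k using bits_sets \<mu>(2) by simp
    have eqp: "measure \<mu> {z. bits k z = w} = p w" if "length w = k" for w
      unfolding p that
      by (rule finite_measure_eq_AE) (use aeZ bm[of k w] Zs that in \<open>auto intro!: sets.Int simp: Int_def[symmetric] Collect_conj_eq\<close>)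
    have 2: "(\<integral>z. f (rep (bits k z)) \<partial>\<mu>) = (\<Sum>w | length w = k. f (rep w) * measure \<mu> {z \<in> space \<mu>. bits k z = w})"
      by (rule integral_finite_range[OF \<mu>(1) finite_words]) (use bm sp in auto)
    have 3: "\<dots> = (\<Sum>w | length w = k. f (rep w) * p w)"
      by (rule sum.cong[OF refl]) (use eqp sp in simp)
    have "bits k \<in> measurable \<mu> (count_space UNIV)"
      using bm by (subst measurable_count_space_eq_countable) (auto simp: vimage_def sp)
    then have mn: "(\<lambda>z. f (rep (bits k z))) \<in> borel_measurable \<mu>" by (rule measurable_compose) simp
    have "\<bar>(\<integral>z. indicator Z z * f z \<partial>\<mu>) - (\<integral>z. f (rep (bits k z)) \<partial>\<mu>)\<bar> \<le> e"
    proof (rule close[OF \<mu>(1)])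
      show "integrable \<mu> (\<lambda>z. indicator Z z * f z)"
        using C mf \<mu>(2) by (intro integrable_const_bound[of _ C]) (auto cong: measurable_cong_sets)
      show "integrable \<mu> (\<lambda>z. f (rep (bits k z)))"
        using mn by (intro integrable_const_bound[of _ C]) (use aeZ in \<open>auto intro!: fC rep(1)\<close>)
      show "AE z in \<mu>. \<bar>indicator Z z * f z - f (rep (bits k z))\<bar> \<le> e"
        using aeZ by eventually_elim (use k(1) in simp)
    qed
    then show "\<bar>(\<integral>z. indicator Z z * f z \<partial>\<mu>) - (\<Sum>w | length w = k. f (rep w) * p w)\<bar> \<le> e"
      using 2 3 by simp
  qed
qed

text \<open>Up to \<open>e/3\<close> each integral is a finite sum over the words of one fixed
  length, and such sums converge with the coordinates.\<close>

lemma tendsto_integral_decode_measure: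
  fixes f :: "'a \<Rightarrow> real"
  assumes f: "continuous_on Z f" and p: "p \<in> weights" "\<And>n. s n \<in> weights" and lim: "\<And>w. (\<lambda>n. s n w) \<longlonglongrightarrow> p w"
  shows "(\<lambda>n. \<integral>z. indicator Z z * f z \<partial>decode_measure (s n)) \<longlonglongrightarrow> (\<integral>z. indicator Z z * f z \<partial>decode_measure p)"
proof (rule LIMSEQ_I)
  fix e :: real assume e: "0 < e"
  then have "0 < e/3" by simp
  note h3 = this
  obtain k where k: "\<And>p. p \<in> weights \<Longrightarrow> \<bar>(\<integral>z. indicator Z z * f z \<partial>decode_measure p) - (\<Sum>w | length w = k. f (rep w) * p w)\<bar> \<le> e/3"
    and "\<And>\<mu> p. prob_space \<mu> \<Longrightarrow> sets \<mu> = sets borel \<Longrightarrow> emeasure \<mu> Z = 1 \<Longrightarrow>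
          p = (\<lambda>w. measure \<mu> {z \<in> Z. bits (length w) z = w}) \<Longrightarrow>
          \<bar>(\<integral>z. indicator Z z * f z \<partial>\<mu>) - (\<Sum>w | length w = k. f (rep w) * p w)\<bar> \<le> e/3"
    by (rule integral_decode_measure[OF f h3]) (rule that)
  have "(\<lambda>n. \<Sum>w | length w = k. f (rep w) * s n w) \<longlonglongrightarrow> (\<Sum>w | length w = k. f (rep w) * p w)"
    by (intro tendsto_intros lim)
  from LIMSEQ_D[OF this h3] obtain N where N: "\<forall>n\<ge>N. norm ((\<Sum>w | length w = k. f (rep w) * s n w) - (\<Sum>w | length w = k. f (rep w) * p w)) < e/3"
    by (rule exE)
  have "norm ((\<integral>z. indicator Z z * f z \<partial>decode_measure (s n)) - (\<integral>z. indicator Z z * f z \<partial>decode_measure p)) < e" if "n \<ge> N" for n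
    using k[OF p(1)] k[OF p(2), of n] N[rule_format, OF that] unfolding real_norm_def by linarith
  then show "\<exists>N. \<forall>n\<ge>N. norm ((\<integral>z. indicator Z z * f z \<partial>decode_measure (s n)) - (\<integral>z. indicator Z z * f z \<partial>decode_measure p)) < e" by blast
qed

text \<open>For every tolerance, a measure and the decoding of its cell masses have integrals close
  to the same finite sum, so continuous functions cannot distinguish them. In this way the masses of
  single cells under the decoded measure never have to be computed.\<close>

lemma decode_measure_surj:
  assumes \<mu>: "prob_space \<mu>" "sets \<mu> = sets borel" "emeasure \<mu> Z = 1"
  shows "\<exists>p\<in>weights. decode_measure p = \<mu>"
proof -
  interpret prob_space \<mu> by fact
  have sp: "space \<mu> = UNIV" using sets_eq_imp_space_eq[OF \<mu>(2)] by simp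
  have Zs: "Z \<in> sets \<mu>" using Z \<mu> by (simp add: compact_imp_closed)
  have aeZ: "AE z in \<mu>. z \<in> Z" using \<mu>(3) Zs by (simp add: AE_in_set_eq_1 emeasure_eq_measure)
  define p where "p = (\<lambda>w. measure \<mu> {z \<in> Z. bits (length w) z = w})"
  have bm: "{z \<in> Z. bits k z = w} \<in> sets \<mu>" for w k
    using sets.Int[OF Zs, of "{z. bits k z = w}"] bits_sets[of k w] \<mu>(2) by (simp add: Int_def)
  have pw: "p \<in> weights"
    unfolding weights_def
  proof (intro CollectI conjI allI impI)
    have "measure \<mu> Z = 1" using \<mu>(3) by (simp add: emeasure_eq_measure)
    then show "p [] = 1" by (simp add: p_def bits_def)
    fix w
    show "0 \<le> p w" by (simp add: p_def)
    have "{z \<in> Z. bits (length w) z = w} = {z \<in> Z. bits (Suc (length w)) z = w @ [False]} \<union> {z \<in> Z. bits (Suc (length w)) z = w @ [True]}"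
      by (auto simp: bits_Suc)
    then show "p w = p (w @ [False]) + p (w @ [True])"
      unfolding p_def by (simp add: finite_measure_Union[OF bm bm] disjoint_iff)
    show "p w = 0" if "\<forall>z\<in>Z. bits (length w) z \<noteq> w"
    proof -
      have "{z \<in> Z. bits (length w) z = w} = {}" using that by auto
      then show ?thesis by (simp only: p_def measure_empty)
    qed
  qed
  note d = decode_measure[OF pw]
  have "decode_measure p = \<mu>"
  proof (rule prob_eq_if_integral_continuous_eq[OF d(1) \<mu>(1) d(2) \<mu>(2)])
    fix f :: "'a \<Rightarrow> real" assume f: "continuous_on UNIV f"
    have fZ: "continuous_on Z f" by (rule continuous_on_subset[OF f]) simp
    have mf: "f \<in> borel_measurable borel" using f by (rule borel_measurable_continuous_onI)
    have drop: "(\<integral>z. indicator Z z * f z \<partial>K) = (\<integral>z. f z \<partial>K)" if K: "prob_space K" "sets K = sets borel" "emeasure K Z = 1" for K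
    proof (rule integral_cong_AE)
      interpret K: prob_space K by fact
      have "Z \<in> sets K" using Z K by (simp add: compact_imp_closed)
      then have "AE z in K. z \<in> Z" using K(3) by (simp add: K.AE_in_set_eq_1 K.emeasure_eq_measure)
      then show "AE z in K. indicator Z z * f z = f z" by eventually_elim simp
      show "(\<lambda>z. indicator Z z * f z) \<in> borel_measurable K" using measurable_indicator_Z[OF fZ] K(2) by (simp cong: measurable_cong_sets)
      show "f \<in> borel_measurable K" using mf K(2) by (simp cong: measurable_cong_sets)
    qed
    have "\<bar>(\<integral>z. indicator Z z * f z \<partial>decode_measure p) - (\<integral>z. indicator Z z * f z \<partial>\<mu>)\<bar> \<le> 0"
    proof (rule field_le_epsilon)
      fix e :: real assume "0 < e"
      then have "0 < e/2" by simp
      note h2 = this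
      obtain k where "\<And>p. p \<in> weights \<Longrightarrow> \<bar>(\<integral>z. indicator Z z * f z \<partial>decode_measure p) - (\<Sum>w | length w = k. f (rep w) * p w)\<bar> \<le> e/2"
        "\<And>\<mu> p. prob_space \<mu> \<Longrightarrow> sets \<mu> = sets borel \<Longrightarrow> emeasure \<mu> Z = 1 \<Longrightarrow>
          p = (\<lambda>w. measure \<mu> {z \<in> Z. bits (length w) z = w}) \<Longrightarrow>
          \<bar>(\<integral>z. indicator Z z * f z \<partial>\<mu>) - (\<Sum>w | length w = k. f (rep w) * p w)\<bar> \<le> e/2"
        by (rule integral_decode_measure[OF fZ h2]) (rule that)
      from this(1)[OF pw] this(2)[OF \<mu> p_def]
      show "\<bar>(\<integral>z. indicator Z z * f z \<partial>decode_measure p) - (\<integral>z. indicator Z z * f z \<partial>\<mu>)\<bar> \<le> 0 + e" by linarith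
    qed
    then show "(\<integral>z. f z \<partial>decode_measure p) = (\<integral>z. f z \<partial>\<mu>)" using drop[OF d] drop[OF \<mu>] by simp
  qed
  then show ?thesis using pw by blast
qed

end

text \<open>The bits record membership in an enumerated countable basis. Finitely many basis sets of
  small diameter cover \<open>Z\<close>, and two points with equal bits up to the largest index
  involved lie in a common one.\<close>

lemma ex_bit_coding:
  fixes Z :: "'a::{metric_space,second_countable_topology} set"
  assumes Z: "compact Z" "Z \<noteq> {}"
  obtains Bs where "bit_coding Z Bs"
proof -
  obtain \<B> :: "'a set set" where B: "countable \<B>" "topological_basis \<B>" using ex_countable_basis by blast
  have ne: "\<B> \<noteq> {}" using B(2) topological_basisE[OF B(2) open_UNIV UNIV_I] by blast
  have op: "open b" if "b \<in> \<B>" for b using B(2) that by (rule topological_basis_open)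
  have "bit_coding Z (from_nat_into \<B>)"
  proof
    show "compact Z" "Z \<noteq> {}" by fact+
    show "open (from_nat_into \<B> k)" for k using from_nat_into[OF ne] op by blast
    fix e :: real assume e: "0 < e"
    define \<C> where "\<C> = {b \<in> \<B>. \<forall>z\<in>b. \<forall>z'\<in>b. dist z z' < e}"
    have "Z \<subseteq> \<Union>\<C>"
    proof
      fix z assume "z \<in> Z"
      obtain b where b: "b \<in> \<B>" "z \<in> b" "b \<subseteq> ball z (e/2)"
        using topological_basisE[OF B(2) open_ball, of z z "e/2"] e by auto
      have "dist u v < e" if "u \<in> b" "v \<in> b" for u v
      proof -
        have "dist z u < e/2" "dist z v < e/2" using that b(3) by auto
        then show ?thesis using dist_triangle_half_r[of z u e v] by simp
      qed
      then show "z \<in> \<Union>\<C>" using b by (auto simp: \<C>_def)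
    qed
    moreover have "\<And>b. b \<in> \<C> \<Longrightarrow> open b" using op by (auto simp: \<C>_def)
    ultimately obtain F where F: "F \<subseteq> \<C>" "finite F" "Z \<subseteq> \<Union>F" using compactE[OF Z(1)] by metis
    obtain k where k: "\<And>b. b \<in> F \<Longrightarrow> to_nat_on \<B> b < k"
      using F(2) by (metis finite_imageI finite_nat_set_iff_bounded imageI)
    have "dist z z' < e" if zz: "z \<in> Z" "z' \<in> Z" and same: "\<forall>i<k. z \<in> from_nat_into \<B> i \<longleftrightarrow> z' \<in> from_nat_into \<B> i" for z z'
    proof -
      obtain b where b: "b \<in> F" "z \<in> b" using F(3) zz(1) by auto
      then have "b \<in> \<B>" using F(1) by (auto simp: \<C>_def)
      then have "from_nat_into \<B> (to_nat_on \<B> b) = b" using B(1) by simp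
      then have "z' \<in> b" using same k[OF b(1)] b(2) by metis
      then show ?thesis using b F(1) by (auto simp: \<C>_def)
    qed
    then show "\<exists>k. \<forall>z\<in>Z. \<forall>z'\<in>Z. (\<forall>i<k. z \<in> from_nat_into \<B> i \<longleftrightarrow> z' \<in> from_nat_into \<B> i) \<longrightarrow> dist z z' < e"
      by blast
  qed
  then show thesis by (rule that)
qed

section \<open>Compactness of relaxed controls\<close>

definition exp_law :: "real measure" where
  "exp_law = density lborel (\<lambda>t. ennreal (exp (- t)) * indicator {0..} t)"

text \<open>This is the uniform law on the unit interval. Written as an image of
  \<open>exp_law\<close>, it lets densities in \<open>\<theta>\<close> be pulled back to exponential
  time.\<close>

definition time_law :: "real measure" where
  "time_law = distr exp_law borel (\<lambda>t. exp (- t))"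

text \<open>The substitution \<open>\<theta> = exp (-t)\<close> turns a relaxed control into a probability measure on the
  compact set \<open>U \<times> [0, 1]\<close>; \<open>unroll\<close> undoes it.\<close>
definition ctrl_law :: "(real \<Rightarrow> ctrl) \<Rightarrow> (ctrl \<times> real) measure" where
  "ctrl_law v = distr exp_law borel (\<lambda>t. (v t, exp (- t)))"

definition unroll :: "(ctrl \<times> real) measure \<Rightarrow> (ctrl \<times> real) measure" where
  "unroll \<mu> = distr (density \<mu> (\<lambda>z. ennreal (1 / snd z))) borel (\<lambda>z. (fst z, - ln (snd z)))"

lemma sets_exp_law [measurable_cong]: "sets exp_law = sets borel"
  by (simp add: exp_law_def)

lemma space_exp_law [simp]: "space exp_law = UNIV"
  by (simp add: exp_law_def)

lemma prob_exp_law: "prob_space exp_law"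
proof (rule prob_spaceI)
  have "emeasure exp_law UNIV = (\<integral>\<^sup>+ t. ennreal (exp (- t)) * indicator {0..} t \<partial>lborel)"
    unfolding exp_law_def by (subst emeasure_density) auto
  then show "emeasure exp_law (space exp_law) = 1" by (simp add: nn_integral_exp_tail)
qed

lemma density_exp_law: "density exp_law (\<lambda>t. ennreal (1 / exp (- t))) = density lborel (indicator {0..})"
proof -
  have "density exp_law (\<lambda>t. ennreal (1 / exp (- t)))
      = density lborel (\<lambda>t. (ennreal (exp (- t)) * indicator {0..} t) * ennreal (1 / exp (- t)))"
    unfolding exp_law_def by (rule density_density_eq) auto
  also have "(\<lambda>t::real. (ennreal (exp (- t)) * indicator {0..} t) * ennreal (1 / exp (- t))) = indicator {0..}"
  proof
    fix t :: real
    have "ennreal (exp (- t)) * ennreal (1 / exp (- t)) = 1" by (simp flip: ennreal_mult)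
    then show "(ennreal (exp (- t)) * indicator {0..} t) * ennreal (1 / exp (- t)) = indicator {0..} t"
      by (simp add: indicator_def)
  qed
  finally show ?thesis .
qed

lemma measurable_unroll [measurable]:
  "(\<lambda>z. (fst z, - ln (snd z))) \<in> borel_measurable (borel :: (ctrl \<times> real) measure)"
  "(\<lambda>z. ennreal (1 / snd z)) \<in> borel_measurable (borel :: (ctrl \<times> real) measure)"
  "(\<lambda>z. 1 / snd z) \<in> borel_measurable (borel :: (ctrl \<times> real) measure)"
proof -
  have [measurable]: "snd \<in> borel_measurable (borel :: (ctrl \<times> real) measure)"
    "fst \<in> borel_measurable (borel :: (ctrl \<times> real) measure)"
    by (auto intro!: borel_measurable_continuous_onI continuous_intros)
  show "(\<lambda>z. (fst z, - ln (snd z))) \<in> borel_measurable (borel :: (ctrl \<times> real) measure)"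
    "(\<lambda>z. ennreal (1 / snd z)) \<in> borel_measurable (borel :: (ctrl \<times> real) measure)"
    "(\<lambda>z. 1 / snd z) \<in> borel_measurable (borel :: (ctrl \<times> real) measure)" by measurable
qed

lemma unroll_ctrl_law:
  assumes [measurable]: "v \<in> borel_measurable borel"
  shows "unroll (ctrl_law v) = relaxed_rep v"
proof -
  have [measurable]: "(\<lambda>t. (v t, exp (- t))) \<in> borel_measurable exp_law" by measurable
  have "density (ctrl_law v) (\<lambda>z. ennreal (1 / snd z)) = distr (density exp_law (\<lambda>t. ennreal (1 / exp (- t)))) borel (\<lambda>t. (v t, exp (- t)))"
    unfolding ctrl_law_def by (subst density_distr) (auto simp: measurable_unroll)
  then have "unroll (ctrl_law v) = distr (distr (density lborel (indicator {0..})) borel (\<lambda>t. (v t, exp (- t)))) borel (\<lambda>z. (fst z, - ln (snd z)))"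
    by (simp add: unroll_def density_exp_law)
  also have "\<dots> = relaxed_rep v"
    unfolding relaxed_rep_def by (subst distr_distr) (auto simp: o_def)
  finally show ?thesis .
qed

text \<open>Fixing the time marginal does two things: it survives weak limits, and it forbids mass
  at \<open>\<theta> = 0\<close>, that is, at infinite time, where \<open>unroll\<close> would lose
  it.\<close>

definition ctrl_laws :: "ctrl set \<Rightarrow> (ctrl \<times> real) measure set" where
  "ctrl_laws U = {\<mu>. prob_space \<mu> \<and> sets \<mu> = sets borel \<and> emeasure \<mu> (U \<times> {0..1}) = 1 \<and>
     distr \<mu> borel snd = time_law}"

lemma measurable_fst_snd_borel [measurable]:
  "snd \<in> borel_measurable (borel :: (ctrl \<times> real) measure)"
  "fst \<in> borel_measurable (borel :: (ctrl \<times> real) measure)"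
  by (auto intro!: borel_measurable_continuous_onI continuous_intros)

lemma AE_exp_law: "AE t in exp_law. 0 \<le> t"
  unfolding exp_law_def by (subst AE_density) (auto simp: indicator_def)

lemma ctrl_law_in:
  assumes [measurable]: "v \<in> borel_measurable borel" and v: "\<And>t. 0 \<le> t \<Longrightarrow> v t \<in> U" and U: "compact U"
  shows "ctrl_law v \<in> ctrl_laws U"
proof -
  have m [measurable]: "(\<lambda>t. (v t, exp (- t))) \<in> borel_measurable exp_law" by measurable
  interpret E: prob_space exp_law by (rule prob_exp_law)
  have p: "prob_space (ctrl_law v)" unfolding ctrl_law_def by (rule E.prob_space_distr[OF m])
  have c: "U \<times> {0..1::real} \<in> sets borel" using U by (intro borel_closed closed_Times compact_imp_closed) auto
  have "AE z in ctrl_law v. z \<in> U \<times> {0..1}"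
    unfolding ctrl_law_def using c
    by (subst AE_distr_iff[OF m]) (use AE_exp_law v in \<open>auto elim!: eventually_mono\<close>)
  then have "emeasure (ctrl_law v) (U \<times> {0..1}) = 1"
    using c by (intro prob_space.emeasure_eq_1_AE[OF p]) (auto simp: ctrl_law_def)
  moreover have "distr (ctrl_law v) borel snd = time_law"
    unfolding ctrl_law_def time_law_def by (subst distr_distr) (auto simp: o_def)
  ultimately show ?thesis using p by (simp add: ctrl_laws_def ctrl_law_def)
qed

lemma ctrl_lawsD:
  assumes \<mu>: "\<mu> \<in> ctrl_laws U" and U: "compact U"
  shows "AE z in \<mu>. fst z \<in> U \<and> 0 < snd z \<and> snd z \<le> 1"
proof -
  interpret prob_space \<mu> using \<mu> by (simp add: ctrl_laws_def)
  have s [measurable_cong]: "sets \<mu> = sets borel" using \<mu> by (simp add: ctrl_laws_def)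
  have c: "U \<times> {0..1::real} \<in> sets \<mu>" unfolding s using U by (intro borel_closed closed_Times compact_imp_closed) auto
  have 1: "AE z in \<mu>. z \<in> U \<times> {0..1}"
    using \<mu> c by (simp add: AE_in_set_eq_1 emeasure_eq_measure ctrl_laws_def)
  have "AE \<theta> in time_law. 0 < \<theta>"
    unfolding time_law_def by (subst AE_distr_iff) auto
  moreover have "distr \<mu> borel snd = time_law" using \<mu> unfolding ctrl_laws_def by blast
  ultimately have "AE \<theta> in distr \<mu> borel snd. 0 < \<theta>" by metis
  then have "AE z in \<mu>. 0 < snd z" by (subst (asm) AE_distr_iff) auto
  with 1 show ?thesis by eventually_elim auto
qed

text \<open>The density in \<open>unroll\<close> depends on time alone, and time is transformed
  separately from the control. So the new marginal is determined by the old one, and for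
  \<open>time_law\<close> the factor \<open>1 / \<theta>\<close> cancels the exponential
  density.\<close>

lemma unroll_time_marginal:
  assumes \<mu>: "\<mu> \<in> ctrl_laws U"
  shows "distr (unroll \<mu>) borel snd = density lborel (indicator {0..})"
proof -
  have s [measurable_cong]: "sets \<mu> = sets borel" using \<mu> by (simp add: ctrl_laws_def)
  have "distr (unroll \<mu>) borel snd = distr (density \<mu> (\<lambda>z. ennreal (1 / snd z))) borel (\<lambda>z. - ln (snd z))"
    unfolding unroll_def by (subst distr_distr) (auto simp: o_def)
  also have "\<dots> = distr (distr (density \<mu> (\<lambda>z. ennreal (1 / snd z))) borel snd) borel (\<lambda>\<theta>. - ln \<theta>)"
    by (subst distr_distr) (auto simp: o_def)
  also have "distr (density \<mu> (\<lambda>z. ennreal (1 / snd z))) borel snd = density (distr \<mu> borel snd) (\<lambda>\<theta>. ennreal (1 / \<theta>))"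
    by (subst density_distr) auto
  also have "\<dots> = distr (density exp_law (\<lambda>t. ennreal (1 / exp (- t)))) borel (\<lambda>t. exp (- t))"
    using \<mu> unfolding ctrl_laws_def time_law_def by (auto simp: density_distr)
  also have "distr \<dots> borel (\<lambda>\<theta>. - ln \<theta>) = density lborel (indicator {0..})"
    unfolding density_exp_law by (subst distr_distr) (auto simp: o_def intro!: distr_id2)
  finally show ?thesis .
qed

lemma unroll_Rset:
  assumes \<mu>: "\<mu> \<in> ctrl_laws (Uset P)" and U: "compact (Uset P)"
  shows "unroll \<mu> \<in> Rset P"
proof -
  have s [measurable_cong]: "sets \<mu> = sets borel" using \<mu> by (simp add: ctrl_laws_def)
  have s': "sets (unroll \<mu>) = sets borel" by (simp add: unroll_def)
  have sp: "space (unroll \<mu>) = UNIV" by (simp add: unroll_def)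
  have Ub [measurable]: "Uset P \<in> sets borel" using U by (simp add: compact_imp_closed)
  have 1: "AE z in unroll \<mu>. fst z \<in> Uset P"
  proof -
    have "AE z in density \<mu> (\<lambda>z. ennreal (1 / snd z)). fst z \<in> Uset P"
      using ctrl_lawsD[OF \<mu> U] by (subst AE_density) (auto elim!: eventually_mono)
    then show ?thesis unfolding unroll_def by (subst AE_distr_iff) auto
  qed
  have e: "emeasure (unroll \<mu>) (snd -` A) = emeasure (density lborel (indicator {0..})) A" if A: "A \<in> sets borel" for A
  proof -
    have "emeasure (distr (unroll \<mu>) borel snd) A = emeasure (unroll \<mu>) (snd -` A \<inter> space (unroll \<mu>))"
      by (rule emeasure_distr) (use A s' in \<open>auto cong: measurable_cong_sets\<close>)
    then show ?thesis using unroll_time_marginal[OF \<mu>] by (simp add: sp)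
  qed
  have i: "emeasure (density lborel (indicator {0..})) A = emeasure lborel (A \<inter> {0..})" if A: "A \<in> sets borel" for A :: "real set"
  proof -
    have "emeasure (density lborel (indicator {0..})) A = (\<integral>\<^sup>+ t. indicator (A \<inter> {0..}) t \<partial>lborel)"
      using A by (simp add: emeasure_density indicator_inter_arith mult.commute)
    also have "\<dots> = emeasure lborel (A \<inter> {0..})" using A by (intro nn_integral_indicator) auto
    finally show ?thesis .
  qed
  have m1: "Uset P \<times> B \<in> sets (unroll \<mu>)" if "closed B" for B :: "real set"
    unfolding s' using that by (intro borel_closed closed_Times compact_imp_closed[OF U])
  have m2: "snd -` B \<in> sets (unroll \<mu>)" if "B \<in> sets borel" for B :: "real set"
    using measurable_sets[OF measurable_fst_snd_borel(1) that] s' by simp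
  have 2: "emeasure (unroll \<mu>) (Uset P \<times> {0..T}) = ennreal T" if "0 \<le> T" for T
  proof -
    have "emeasure (unroll \<mu>) (Uset P \<times> {0..T}) = emeasure (unroll \<mu>) (snd -` {0..T})"
      by (rule emeasure_eq_AE) (use 1 in eventually_elim, use m1 m2 in auto)
    also have "\<dots> = ennreal T" using that by (simp add: e i Int_atLeastAtMost)
    finally show ?thesis .
  qed
  have "AE z in unroll \<mu>. snd z \<in> {0..}"
  proof (rule AE_I')
    have "emeasure (unroll \<mu>) (snd -` {..<0}) = 0"
    proof -
      have "{..<0} \<inter> {0..} = ({} :: real set)" by auto
      then show ?thesis by (simp add: e i)
    qed
    then show "snd -` {..<0} \<in> null_sets (unroll \<mu>)" using m2 by (auto simp: null_sets_def)
  qed auto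
  then have "AE z in unroll \<mu>. z \<notin> - (Uset P \<times> {0..})" using 1 by eventually_elim auto
  moreover have "- (Uset P \<times> {0..}) \<in> sets (unroll \<mu>)"
    using sets.compl_sets[OF m1[of "{0..}"]] by (simp add: sp Compl_eq_Diff_UNIV)
  ultimately have "emeasure (unroll \<mu>) (- (Uset P \<times> {0..})) = 0"
    using AE_iff_null_sets by blast
  with 2 s' show ?thesis by (simp add: Rset_def)
qed

text \<open>In exponential time the layer is an interval of length
  \<open>T + ln (exp (- T) + e)\<close>, on which the density is at most \<open>1\<close>. The
  length tends to \<open>0\<close> with \<open>e\<close>.\<close>

lemma time_law_small:
  fixes \<mu> :: "(ctrl \<times> real) measure"
  assumes \<mu>: "\<mu> \<in> ctrl_laws U" and e: "0 < e" and T: "0 \<le> T"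
  shows "measure \<mu> {z. snd z \<in> {exp (- T)..exp (- T) + e}} \<le> T + ln (exp (- T) + e)"
proof -
  interpret prob_space \<mu> using \<mu> by (simp add: ctrl_laws_def)
  have s [measurable_cong]: "sets \<mu> = sets borel" using \<mu> by (simp add: ctrl_laws_def)
  have sp: "space \<mu> = UNIV" using sets_eq_imp_space_eq[OF s] by simp
  let ?I = "{exp (- T)..exp (- T) + e}"
  have pos: "0 < exp (- T) + e" using e by (simp add: add_pos_pos)
  have nn: "0 \<le> T + ln (exp (- T) + e)"
  proof -
    have "ln (exp (- T)) \<le> ln (exp (- T) + e)" using e pos by (subst ln_le_cancel_iff) auto
    then show ?thesis by simp
  qed
  have "emeasure \<mu> {z. snd z \<in> ?I} = emeasure (distr \<mu> borel snd) ?I"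
    by (subst emeasure_distr) (auto simp: sp vimage_def)
  also have "\<dots> = emeasure exp_law {t. exp (- t) \<in> ?I}"
    using \<mu> by (simp add: ctrl_laws_def time_law_def emeasure_distr vimage_def)
  also have "\<dots> = (\<integral>\<^sup>+ t. ennreal (exp (- t)) * indicator {0..} t * indicator {t. exp (- t) \<in> ?I} t \<partial>lborel)"
    unfolding exp_law_def by (subst emeasure_density) auto
  also have "\<dots> \<le> (\<integral>\<^sup>+ t. indicator {- ln (exp (- T) + e)..T} t \<partial>lborel)"
  proof (rule nn_integral_mono)
    fix t :: real
    show "ennreal (exp (- t)) * indicator {0..} t * indicator {t. exp (- t) \<in> ?I} t \<le> indicator {- ln (exp (- T) + e)..T} t"
    proof (cases "0 \<le> t \<and> exp (- t) \<in> ?I")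
      case True
      then have "- t \<le> ln (exp (- T) + e)" using pos by (simp add: ln_ge_iff)
      moreover have "t \<le> T" using True by simp
      moreover have "ennreal (exp (- t)) \<le> 1" using True by (simp add: ennreal_le_1)
      ultimately show ?thesis by (simp add: indicator_def)
    qed (auto simp: indicator_def)
  qed
  also have "\<dots> = ennreal (T + ln (exp (- T) + e))" using nn by simp
  finally show ?thesis using nn by (simp add: emeasure_eq_measure)
qed

section \<open>Smoothing the time cut-off and continuity of unrolling\<close>

definition ramp :: "real \<Rightarrow> real \<Rightarrow> real \<Rightarrow> real" where
  "ramp a e \<theta> = min 1 (max 0 ((\<theta> - a) / e))"

text \<open>A test function on times up to \<open>T\<close> lives on
  \<open>\<theta> \<ge> exp (- T)\<close> and breaks off there. The ramp replaces the sharp edge,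
  and the \<open>max\<close> keeps the logarithm and the quotient within the domain of
  \<open>f\<close> where the ramp vanishes.\<close>

definition smooth_rep :: "(ctrl \<times> real \<Rightarrow> real) \<Rightarrow> real \<Rightarrow> real \<Rightarrow> ctrl \<times> real \<Rightarrow> real" where
  "smooth_rep f T e z = ramp (exp (- T)) e (snd z) *
     (f (fst z, - ln (max (exp (- T)) (snd z))) / max (exp (- T)) (snd z))"

lemma continuous_on_smooth_rep:
  assumes f: "continuous_on (U \<times> {0..T}) f" and "0 \<le> T" "0 < e"
  shows "continuous_on (U \<times> {0..1}) (smooth_rep f T e)"
proof -
  have pos: "0 < max (exp (- T)) \<theta>" for \<theta> :: real by (simp add: less_max_iff_disj)
  have "continuous_on (U \<times> {0..1}) (\<lambda>z. f (fst z, - ln (max (exp (- T)) (snd z))))"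
  proof (rule continuous_on_compose2[OF f])
    show "continuous_on (U \<times> {0..1}) (\<lambda>z. (fst z, - ln (max (exp (- T)) (snd z))))"
      by (intro continuous_intros) (use pos in \<open>auto simp: less_imp_neq[OF pos, symmetric]\<close>)
    have "0 \<le> - ln (max (exp (- T)) \<theta>)" "- ln (max (exp (- T)) \<theta>) \<le> T" if "\<theta> \<le> 1" for \<theta>
    proof -
      have "ln (max (exp (- T)) \<theta>) \<le> ln 1" using pos that assms by (subst ln_le_cancel_iff) auto
      then show "0 \<le> - ln (max (exp (- T)) \<theta>)" by simp
      have "ln (exp (- T)) \<le> ln (max (exp (- T)) \<theta>)" using pos by (subst ln_le_cancel_iff) auto
      then show "- ln (max (exp (- T)) \<theta>) \<le> T" by simp
    qed
    then show "(\<lambda>z. (fst z, - ln (max (exp (- T)) (snd z)))) ` (U \<times> {0..1}) \<subseteq> U \<times> {0..T}" by auto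
  qed
  then show ?thesis unfolding smooth_rep_def ramp_def
    by (intro continuous_intros) (use assms in \<open>auto simp: less_imp_neq[OF pos, symmetric]\<close>)
qed

text \<open>The two integrands differ only on the layer where the ramp rises, and both are bounded
  by \<open>D / exp (- T)\<close>. Hence the constant does not depend on the measure, and
  \<open>time_law_small\<close> gives an error uniform over \<open>ctrl_laws U\<close>.\<close>

lemma unroll_integral_approx:
  fixes f :: "ctrl \<times> real \<Rightarrow> real"
  assumes U: "compact U" and T: "0 \<le> T" and f: "continuous_on (U \<times> {0..T}) f"
  obtains C where "0 \<le> C" "\<And>\<mu> e. \<mu> \<in> ctrl_laws U \<Longrightarrow> 0 < e \<Longrightarrow>
    \<bar>(\<integral>p. indicator (U \<times> {0..T}) p * f p \<partial>unroll \<mu>) - (\<integral>z. indicator (U \<times> {0..1}) z * smooth_rep f T e z \<partial>\<mu>)\<bar>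
      \<le> C * (T + ln (exp (- T) + e))"
proof -
  let ?a = "exp (- T)"
  have a: "0 < ?a" "?a \<le> 1" using T by auto
  have cUT: "compact (U \<times> {0..T})" using U by (intro compact_Times) auto
  then have "bounded (f ` (U \<times> {0..T}))" using f by (intro compact_imp_bounded compact_continuous_image)
  then obtain D where D: "0 < D" "\<And>z. z \<in> U \<times> {0..T} \<Longrightarrow> \<bar>f z\<bar> \<le> D" unfolding bounded_pos by (metis imageI real_norm_def)
  have mf: "(\<lambda>p. indicator (U \<times> {0..T}) p * f p) \<in> borel_measurable borel"
    using borel_measurable_continuous_on_indicator[OF _ f] cUT by (simp add: compact_imp_closed)
  show thesis
  proof (rule that[of "D / ?a"])
    show "0 \<le> D / ?a" using D a by simp
    fix \<mu> e assume \<mu>: "\<mu> \<in> ctrl_laws U" and e: "0 < (e::real)"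
    interpret prob_space \<mu> using \<mu> by (simp add: ctrl_laws_def)
    have s [measurable_cong]: "sets \<mu> = sets borel" using \<mu> by (simp add: ctrl_laws_def)
    have sp: "space \<mu> = UNIV" using sets_eq_imp_space_eq[OF s] by simp
    note ae = ctrl_lawsD[OF \<mu> U]
    define H where "H z = (1 / snd z) * (indicator (U \<times> {0..T}) (fst z, - ln (snd z)) * f (fst z, - ln (snd z)))" for z :: "ctrl \<times> real"
    define G where "G z = indicator (U \<times> {0..1}) z * smooth_rep f T e z" for z
    have m1: "(\<lambda>z. indicator (U \<times> {0..T}) (fst z, - ln (snd z)) * f (fst z, - ln (snd z))) \<in> borel_measurable \<mu>"
      using measurable_compose[OF measurable_unroll(1) mf] s by (simp cong: measurable_cong_sets)
    have mH: "H \<in> borel_measurable \<mu>" unfolding H_def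
      using m1 measurable_unroll(3) s by (auto intro!: borel_measurable_times cong: measurable_cong_sets)
    have cU1: "compact (U \<times> {0..1::real})" using U by (intro compact_Times) auto
    have mG: "G \<in> borel_measurable \<mu>"
      using borel_measurable_continuous_on_indicator[OF _ continuous_on_smooth_rep[OF f T e]] cU1 s
      unfolding G_def by (simp add: compact_imp_closed cong: measurable_cong_sets)
    have "(\<integral>p. indicator (U \<times> {0..T}) p * f p \<partial>unroll \<mu>) =
        (\<integral>z. indicator (U \<times> {0..T}) (fst z, - ln (snd z)) * f (fst z, - ln (snd z)) \<partial>density \<mu> (\<lambda>z. ennreal (1 / snd z)))"
      unfolding unroll_def by (rule integral_distr) (use mf s in \<open>auto cong: measurable_cong_sets\<close>)
    also have "\<dots> = (\<integral>z. (1 / snd z) *\<^sub>R (indicator (U \<times> {0..T}) (fst z, - ln (snd z)) * f (fst z, - ln (snd z))) \<partial>\<mu>)"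
    proof (rule integral_density[OF m1])
      show "(\<lambda>z. 1 / snd z) \<in> borel_measurable \<mu>"
        using measurable_unroll(3) s by (simp cong: measurable_cong_sets)
      show "AE z in \<mu>. 0 \<le> 1 / snd z" using ae by eventually_elim simp
    qed
    also have "\<dots> = (\<integral>z. H z \<partial>\<mu>)" by (simp add: H_def)
    finally have 1: "(\<integral>p. indicator (U \<times> {0..T}) p * f p \<partial>unroll \<mu>) = (\<integral>z. H z \<partial>\<mu>)" .
    have bd: "\<bar>H z\<bar> \<le> D / ?a \<and> \<bar>G z\<bar> \<le> D / ?a \<and> \<bar>H z - G z\<bar> \<le> D / ?a * indicator {z. snd z \<in> {?a..?a + e}} z"
      if z: "fst z \<in> U \<and> 0 < snd z \<and> snd z \<le> 1" for z
    proof -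
      obtain u \<theta> where zz: "z = (u, \<theta>)" by (rule prod.exhaust)
      have u: "u \<in> U" "0 < \<theta>" "\<theta> \<le> 1" using z by (auto simp: zz)
      show ?thesis
      proof (cases "\<theta> < ?a")
        case True
        then have "T < - ln \<theta>" using u ln_less_cancel_iff[of \<theta> ?a] by simp
        then have H0: "H z = 0" by (simp add: H_def zz)
        have "(\<theta> - ?a) / e \<le> 0" using True e by (simp add: divide_nonpos_pos)
        then have "G z = 0" by (simp add: G_def zz smooth_rep_def ramp_def)
        then show ?thesis using H0 D a by simp
      next
        case False
        then have t: "- ln \<theta> \<le> T" "0 \<le> - ln \<theta>" using u ln_le_cancel_iff[of ?a \<theta>] by auto
        define r where "r = f (u, - ln \<theta>) / \<theta>"
        have r: "\<bar>r\<bar> \<le> D / ?a"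
          unfolding r_def abs_divide using D(2)[of "(u, - ln \<theta>)"] u t D(1) False by (intro frac_le) auto
        have Hr: "H z = r" using u t by (simp add: H_def zz r_def)
        have Gr: "G z = ramp ?a e \<theta> * r" using u False by (simp add: G_def zz smooth_rep_def r_def max_absorb2)
        have c: "0 \<le> ramp ?a e \<theta>" "ramp ?a e \<theta> \<le> 1" by (auto simp: ramp_def)
        have "\<bar>ramp ?a e \<theta> * r\<bar> \<le> 1 * (D / ?a)" unfolding abs_mult using c r by (intro mult_mono) auto
        moreover have "\<bar>r - ramp ?a e \<theta> * r\<bar> \<le> D / ?a * indicator {z. snd z \<in> {?a..?a + e}} z"
        proof (cases "\<theta> \<le> ?a + e")
          case True
          have "r - ramp ?a e \<theta> * r = (1 - ramp ?a e \<theta>) * r" by (simp add: algebra_simps)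
          then have "\<bar>r - ramp ?a e \<theta> * r\<bar> = (1 - ramp ?a e \<theta>) * \<bar>r\<bar>" using c by (simp add: abs_mult)
          also have "\<dots> \<le> 1 * (D / ?a)" using c r by (intro mult_mono) auto
          finally show ?thesis using True False by (simp add: zz)
        next
          case F: False
          then have "1 \<le> (\<theta> - ?a) / e" using e by (simp add: le_divide_eq)
          then have "ramp ?a e \<theta> = 1" by (simp add: ramp_def)
          then show ?thesis using F by (simp add: zz)
        qed
        ultimately show ?thesis using r unfolding Hr Gr by simp
      qed
    qed
    have "AE z in \<mu>. norm (H z) \<le> D / ?a" using ae by eventually_elim (use bd in simp)
    then have iH: "integrable \<mu> H" using mH by (rule integrable_const_bound)
    have "AE z in \<mu>. norm (G z) \<le> D / ?a" using ae by eventually_elim (use bd in simp)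
    then have iG: "integrable \<mu> G" using mG by (rule integrable_const_bound)
    have ms: "{z. snd z \<in> {?a..?a + e}} \<in> sets \<mu>"
      using measurable_sets[OF measurable_fst_snd_borel(1), of "{?a..?a + e}"] s by (simp add: vimage_def)
    have "\<bar>(\<integral>z. H z \<partial>\<mu>) - (\<integral>z. G z \<partial>\<mu>)\<bar> = \<bar>\<integral>z. H z - G z \<partial>\<mu>\<bar>" using iH iG by simp
    also have "\<dots> \<le> (\<integral>z. \<bar>H z - G z\<bar> \<partial>\<mu>)" by (rule integral_abs_bound)
    also have "\<dots> \<le> (\<integral>z. D / ?a * indicator {z. snd z \<in> {?a..?a + e}} z \<partial>\<mu>)"
    proof (rule integral_mono_AE)
      show "AE z in \<mu>. \<bar>H z - G z\<bar> \<le> D / ?a * indicator {z. snd z \<in> {?a..?a + e}} z"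
        using ae by eventually_elim (use bd in blast)
    qed (use iH iG ms in \<open>auto intro!: integrable_mult_right integrable_real_indicator simp: emeasure_eq_measure\<close>)
    also have "\<dots> = D / ?a * measure \<mu> {z. snd z \<in> {?a..?a + e}}" using ms by simp
    also have "\<dots> \<le> D / ?a * (T + ln (?a + e))"
      using time_law_small[OF \<mu> e T] D a by (intro mult_left_mono) auto
    finally show "\<bar>(\<integral>p. indicator (U \<times> {0..T}) p * f p \<partial>unroll \<mu>) - (\<integral>z. indicator (U \<times> {0..1}) z * smooth_rep f T e z \<partial>\<mu>)\<bar>
      \<le> D / ?a * (T + ln (?a + e))" using 1 by (simp add: G_def[abs_def])
  qed
qed

text \<open>The set is an image of those weights whose decoded measure has time marginal
  \<open>time_law\<close>. They form a closed set because integrals of continuous functions of time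
  converge and determine the marginal. The image map is continuous because each integral in the
  subbasis of \<open>Rtop P\<close> is a uniform limit of continuous functions of the
  weights.\<close>

lemma compact_unrolled_controls:
  assumes U: "compact (Uset P)" "Uset P \<noteq> {}"
  shows "compactin (Rtop P) (unroll ` ctrl_laws (Uset P))"
proof -
  let ?U = "Uset P"
  have cZ: "compact (?U \<times> {0..1::real})" "?U \<times> {0..1::real} \<noteq> {}" using U by (auto intro: compact_Times)
  obtain Bs where bc: "bit_coding (?U \<times> {0..1::real}) Bs" using ex_bit_coding[OF cZ] .
  interpret bit_coding "?U \<times> {0..1::real}" Bs by (rule bc)
  have comp: "compact weights"
  proof -
    have ct: "continuous_on S (\<lambda>p :: bool list \<Rightarrow> real. p w)" for S w
      by (rule continuous_on_product_then_coordinatewise[OF continuous_on_id])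
    have cl: "closed weights" unfolding weights_def
      by (intro closed_Collect_conj closed_Collect_all closed_Collect_imp open_Collect_const
          closed_Collect_le closed_Collect_eq continuous_intros ct)
    have sub: "weights \<subseteq> {p. \<forall>w. 0 \<le> p w \<and> p w \<le> 1}"
    proof safe
      fix p w assume p: "p \<in> weights"
      show "0 \<le> p w" by (rule weightsD(2)[OF p])
      show "p w \<le> 1" using left_end_bounds[OF p, of w] by linarith
    qed
    have "compact ({p :: bool list \<Rightarrow> real. \<forall>w. 0 \<le> p w \<and> p w \<le> 1} \<inter> weights)"
      by (rule compact_Int_closed[OF compact_box_fun cl])
    then show ?thesis by (simp only: Int_absorb1[OF sub])
  qed
  define Y where "Y = {p \<in> weights. decode_measure p \<in> ctrl_laws ?U}"
  have dm: "decode_measure p \<in> ctrl_laws ?U \<longleftrightarrow> distr (decode_measure p) borel snd = time_law" if "p \<in> weights" for p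
    using decode_measure[OF that] by (simp add: ctrl_laws_def)
  have clY: "p \<in> Y" if s: "\<And>n. s n \<in> Y" and lim: "s \<longlonglongrightarrow> p" for s p
  proof -
    have "closed weights" using comp by (rule compact_imp_closed)
    then have p: "p \<in> weights" using s lim by (auto simp: Y_def closed_sequential_limits)
    have sw: "s n \<in> weights" for n using s by (simp add: Y_def)
    have "distr (decode_measure p) borel snd = time_law"
    proof (rule prob_eq_if_integral_continuous_eq)
      have ms: "snd \<in> borel_measurable (decode_measure q)" if "q \<in> weights" for q
        using decode_measure(2)[OF that] measurable_fst_snd_borel(1) by (simp cong: measurable_cong_sets)
      show "prob_space (distr (decode_measure p) borel snd)"
        by (rule prob_space.prob_space_distr[OF decode_measure(1)[OF p] ms[OF p]])
      show "prob_space time_law" unfolding time_law_def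
        by (rule prob_space.prob_space_distr[OF prob_exp_law]) measurable
      fix f :: "real \<Rightarrow> real" assume f: "continuous_on UNIV f"
      have mf: "f \<in> borel_measurable borel" using f by (rule borel_measurable_continuous_onI)
      have fs: "continuous_on (?U \<times> {0..1::real}) (\<lambda>z. f (snd z))"
        by (rule continuous_on_compose2[OF f]) (auto intro: continuous_intros)
      have eq: "(\<integral>z. indicator (?U \<times> {0..1}) z * f (snd z) \<partial>decode_measure q) = (\<integral>\<theta>. f \<theta> \<partial>distr (decode_measure q) borel snd)"
        if q: "q \<in> weights" for q
      proof -
        interpret q: prob_space "decode_measure q" by (rule decode_measure(1)[OF q])
        have c: "?U \<times> {0..1::real} \<in> sets (decode_measure q)"
          using cZ by (simp add: decode_measure(2)[OF q] compact_imp_closed)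
        have ae: "AE z in decode_measure q. z \<in> ?U \<times> {0..1}"
          using c decode_measure(3)[OF q] by (simp add: q.AE_in_set_eq_1 q.emeasure_eq_measure)
        have "(\<integral>z. indicator (?U \<times> {0..1}) z * f (snd z) \<partial>decode_measure q) = (\<integral>z. f (snd z) \<partial>decode_measure q)"
        proof (rule integral_cong_AE)
          show "(\<lambda>z. indicator (?U \<times> {0..1}) z * f (snd z)) \<in> borel_measurable (decode_measure q)"
            using measurable_indicator_Z[OF fs] decode_measure(2)[OF q] by (simp cong: measurable_cong_sets)
          show "(\<lambda>z. f (snd z)) \<in> borel_measurable (decode_measure q)"
            by (rule measurable_compose[OF ms[OF q] mf])
          show "AE z in decode_measure q. indicator (?U \<times> {0..1}) z * f (snd z) = f (snd z)"
            using ae by eventually_elim simp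
        qed
        then show ?thesis by (simp add: integral_distr[OF ms[OF q] mf])
      qed
      have "(\<lambda>n. \<integral>z. indicator (?U \<times> {0..1}) z * f (snd z) \<partial>decode_measure (s n)) \<longlonglongrightarrow>
          (\<integral>z. indicator (?U \<times> {0..1}) z * f (snd z) \<partial>decode_measure p)"
        by (rule tendsto_integral_decode_measure[OF fs p sw tendsto_coord[OF lim]])
      moreover have "(\<integral>z. indicator (?U \<times> {0..1}) z * f (snd z) \<partial>decode_measure (s n)) = (\<integral>\<theta>. f \<theta> \<partial>time_law)" for n
      proof -
        have "distr (decode_measure (s n)) borel snd = time_law" using s[of n] sw[of n] dm by (auto simp: Y_def)
        then show ?thesis using eq[OF sw[of n]] by metis
      qed
      ultimately have "(\<integral>z. indicator (?U \<times> {0..1}) z * f (snd z) \<partial>decode_measure p) = (\<integral>\<theta>. f \<theta> \<partial>time_law)"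
        by (simp add: LIMSEQ_const_iff)
      then show "(\<integral>\<theta>. f \<theta> \<partial>distr (decode_measure p) borel snd) = (\<integral>\<theta>. f \<theta> \<partial>time_law)" using eq[OF p] by simp
    qed (simp_all add: time_law_def)
    then show ?thesis using p dm[OF p] by (simp add: Y_def)
  qed
  have "closed Y" unfolding closed_sequential_limits using clY by blast
  moreover have "weights \<inter> Y = Y" by (auto simp: Y_def)
  ultimately have cY: "compact Y" using compact_Int_closed[OF comp, of Y] by simp
  have surj: "unroll ` ctrl_laws ?U = (\<lambda>p. unroll (decode_measure p)) ` Y"
  proof -
    have "\<exists>p\<in>Y. \<mu> = decode_measure p" if "\<mu> \<in> ctrl_laws ?U" for \<mu>
      using decode_measure_surj[of \<mu>] that by (auto simp: Y_def ctrl_laws_def)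
    then show ?thesis by (force simp: Y_def)
  qed
  show ?thesis unfolding surj
  proof (rule image_compactin)
    show "compactin (top_of_set Y) Y" using cY by (simp add: compactin_subtopology)
    show "continuous_map (top_of_set Y) (Rtop P) (\<lambda>p. unroll (decode_measure p))"
      unfolding Rtop_def
    proof (rule continuous_on_generated_topo)
      have R: "unroll (decode_measure p) \<in> Rset P" if "p \<in> Y" for p
        using that U by (auto simp: Y_def intro!: unroll_Rset)
      show "(\<lambda>p. unroll (decode_measure p)) ` topspace (top_of_set Y) \<subseteq>
        \<Union>{{m\<in>Rset P. (\<integral>p. indicator (Uset P \<times> {0..T}) p * (f p :: real) \<partial>m) \<in> V} | T f V.
          0 \<le> T \<and> continuous_on (Uset P \<times> {0..T}) f \<and> open V}"
      proof clarsimp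
        fix p assume p: "p \<in> Y"
        show "\<exists>x. (\<exists>T f V. x = {m \<in> Rset P. (\<integral>p. indicator (Uset P \<times> {0..T}) p * (f p :: real) \<partial>m) \<in> V} \<and>
             0 \<le> T \<and> continuous_on (Uset P \<times> {0..T}) f \<and> open V) \<and> unroll (decode_measure p) \<in> x"
          \<comment> \<open>The zero function with \<open>V = UNIV\<close> exhibits
            \<open>Rset P\<close> itself as a member of the subbasis.\<close>
          by (rule exI[of _ "Rset P"], rule conjI, rule exI[of _ 0], rule exI[of _ "\<lambda>_. 0"], rule exI[of _ UNIV])
            (use R[OF p] in auto)
      qed
      fix S assume "S \<in> {{m\<in>Rset P. (\<integral>p. indicator (Uset P \<times> {0..T}) p * (f p :: real) \<partial>m) \<in> V} | T f V.
          0 \<le> T \<and> continuous_on (Uset P \<times> {0..T}) f \<and> open V}"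
      then obtain T f V where S: "S = {m\<in>Rset P. (\<integral>p. indicator (Uset P \<times> {0..T}) p * (f p :: real) \<partial>m) \<in> V}"
        and T: "0 \<le> T" and f: "continuous_on (Uset P \<times> {0..T}) f" and V: "open V" by blast
      define \<phi> where "\<phi> p = (\<integral>z. indicator (Uset P \<times> {0..T}) z * f z \<partial>unroll (decode_measure p))" for p
      obtain C where C: "0 \<le> C" "\<And>\<mu> e. \<mu> \<in> ctrl_laws ?U \<Longrightarrow> 0 < e \<Longrightarrow>
        \<bar>(\<integral>p. indicator (?U \<times> {0..T}) p * f p \<partial>unroll \<mu>) - (\<integral>z. indicator (?U \<times> {0..1}) z * smooth_rep f T e z \<partial>\<mu>)\<bar>
          \<le> C * (T + ln (exp (- T) + e))"
        by (rule unroll_integral_approx[OF U(1) T f]) (rule that)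
      have "continuous_on Y \<phi>"
        unfolding continuous_on_sequentially
      proof (intro allI ballI impI)
        fix s p assume p: "p \<in> Y" and s: "(\<forall>n. s n \<in> Y) \<and> s \<longlonglongrightarrow> p"
        show "(\<phi> \<circ> s) \<longlonglongrightarrow> \<phi> p"
        proof (rule LIMSEQ_I)
          fix r :: real assume r: "0 < r"
          have "((\<lambda>e. C * (T + ln (exp (- T) + e))) \<longlongrightarrow> C * (T + ln (exp (- T) + 0))) (at_right 0)"
            by (intro tendsto_intros) auto
          then have "((\<lambda>e. C * (T + ln (exp (- T) + e))) \<longlongrightarrow> 0) (at_right 0)" by simp
          then have "eventually (\<lambda>e. C * (T + ln (exp (- T) + e)) < r / 3) (at_right 0)"
            using r by (intro order_tendstoD) auto
          then obtain b where b: "0 < b" "\<And>e. 0 < e \<Longrightarrow> e < b \<Longrightarrow> C * (T + ln (exp (- T) + e)) < r / 3"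
            unfolding eventually_at_right_field by auto
          define e where "e = b / 2"
          have e: "0 < e" "C * (T + ln (exp (- T) + e)) < r / 3" using b by (auto simp: e_def)
          define \<psi> where "\<psi> q = (\<integral>z. indicator (?U \<times> {0..1}) z * smooth_rep f T e z \<partial>decode_measure q)" for q
          have "(\<lambda>n. \<psi> (s n)) \<longlonglongrightarrow> \<psi> p"
            unfolding \<psi>_def
            by (rule tendsto_integral_decode_measure[OF continuous_on_smooth_rep[OF f T e(1)]])
              (use p s tendsto_coord in \<open>auto simp: Y_def\<close>)
          then obtain N where N: "\<forall>n\<ge>N. norm (\<psi> (s n) - \<psi> p) < r / 3" using r by (auto dest!: LIMSEQ_D[of _ _ "r / 3"])
          have close: "\<bar>\<phi> q - \<psi> q\<bar> < r / 3" if "q \<in> Y" for q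
            using C(2)[of "decode_measure q" e] that e by (simp add: Y_def \<phi>_def \<psi>_def)
          have "norm ((\<phi> \<circ> s) n - \<phi> p) < r" if "n \<ge> N" for n
          proof -
            have "s n \<in> Y" using s by blast
            from close[OF this] close[OF p] N[rule_format, OF that] show ?thesis
              unfolding real_norm_def o_def by linarith
          qed
          then show "\<exists>N. \<forall>n\<ge>N. norm ((\<phi> \<circ> s) n - \<phi> p) < r" by blast
        qed
      qed
      then have "openin (top_of_set Y) (Y \<inter> \<phi> -` V)" using V by (rule continuous_openin_preimage_gen)
      moreover have "(\<lambda>p. unroll (decode_measure p)) -` S \<inter> topspace (top_of_set Y) = Y \<inter> \<phi> -` V"
        using R by (auto simp: S \<phi>_def)
      ultimately show "openin (top_of_set Y) ((\<lambda>p. unroll (decode_measure p)) -` S \<inter> topspace (top_of_set Y))" by simp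
    qed
  qed
qed

lemma relaxed_rep_unrolled:
  assumes "v \<in> borel_measurable borel" "\<And>t. 0 \<le> t \<Longrightarrow> v t \<in> U" "compact U"
  shows "relaxed_rep v \<in> unroll ` ctrl_laws U"
  using unroll_ctrl_law[OF assms(1)] ctrl_law_in[OF assms] by (metis imageI)

section \<open>Fourth moments and chaining\<close>

lemma rho8_mult: "rho8 (x * y) = rho8 x * rho8 y"
  by (simp add: rho8_def real_sqrt_mult)

lemma rho8_power: "rho8 (x ^ n) = rho8 x ^ n"
  by (simp add: rho8_def real_sqrt_power)

lemma rho8_nonneg: "0 \<le> x \<Longrightarrow> 0 \<le> rho8 x"
  by (simp add: rho8_def)

lemma rho8_pow4:
  assumes "0 \<le> x" shows "rho8 x ^ 4 = sqrt x"
proof -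
  have "rho8 x ^ 4 = (rho8 x ^ 2) ^ 2" by simp
  also have "\<dots> = sqrt x" using assms by (simp add: rho8_def)
  finally show ?thesis .
qed

lemma rho8_2: "1 < rho8 2" by (simp add: rho8_def)

text \<open>The lowest binary digits of \<open>n\<close> are cleared one at a time; clearing digit
  \<open>j\<close> moves the index by nothing or by one dyadic interval of length
  \<open>2 ^ j\<close>.\<close>

lemma dyadic_approximation:
  fixes v a :: "nat \<Rightarrow> real"
  assumes inc: "\<And>j i. j \<le> p \<Longrightarrow> Suc i * 2 ^ j \<le> 2 ^ p \<Longrightarrow> \<bar>v (Suc i * 2 ^ j) - v (i * 2 ^ j)\<bar> \<le> a j"
    and a: "\<And>j. 0 \<le> a j" and n: "n < 2 ^ p"
  shows "j \<le> p \<Longrightarrow> \<bar>v n - v (n div 2 ^ j * 2 ^ j)\<bar> \<le> (\<Sum>k<j. a k)"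
proof (induction j)
  case (Suc j)
  define m where "m = n div 2 ^ Suc j"
  have IH: "\<bar>v n - v (n div 2 ^ j * 2 ^ j)\<bar> \<le> (\<Sum>k<j. a k)" using Suc by simp
  have m: "m = n div 2 ^ j div 2" unfolding m_def by (simp only: power_Suc2 div_mult2_eq)
  have "\<forall>x::nat. x = 2 * (x div 2) \<or> x = Suc (2 * (x div 2))" by presburger
  have "n div 2 ^ j = 2 * m \<or> n div 2 ^ j = Suc (2 * m)" unfolding m using \<open>\<forall>x::nat. x = 2 * (x div 2) \<or> x = Suc (2 * (x div 2))\<close> by blast
  then have "\<bar>v (n div 2 ^ j * 2 ^ j) - v (m * 2 ^ Suc j)\<bar> \<le> a j"
  proof
    assume "n div 2 ^ j = 2 * m"
    then have e: "n div 2 ^ j * 2 ^ j = m * 2 ^ Suc j" by simp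
    show ?thesis unfolding e using a by simp
  next
    assume e: "n div 2 ^ j = Suc (2 * m)"
    have "Suc (2 * m) * 2 ^ j \<le> n" unfolding e[symmetric] by (rule div_times_less_eq_dividend)
    also have "n \<le> 2 ^ p" using n by simp
    finally have "Suc (2 * m) * 2 ^ j \<le> 2 ^ p" .
    then show ?thesis using inc[of j "2 * m"] Suc.prems e by (simp add: mult.assoc mult.left_commute)
  qed
  then show ?case using IH unfolding m_def[symmetric] sum.lessThan_Suc by linarith
qed simp

text \<open>Rounded down to multiples of \<open>2 ^ j\<close>, indices at distance at most
  \<open>2 ^ j\<close> become equal or neighbours. Two chains of smaller scales and one increment of
  scale \<open>j\<close> then connect them.\<close>

lemma dyadic_chaining:
  fixes v a :: "nat \<Rightarrow> real"
  assumes inc: "\<And>j i. j \<le> p \<Longrightarrow> Suc i * 2 ^ j \<le> 2 ^ p \<Longrightarrow> \<bar>v (Suc i * 2 ^ j) - v (i * 2 ^ j)\<bar> \<le> a j"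
    and a: "\<And>j. 0 \<le> a j" and mn: "m < n" "n < 2 ^ p" and j: "j \<le> p" "n - m \<le> 2 ^ j"
  shows "\<bar>v n - v m\<bar> \<le> 2 * (\<Sum>k<j. a k) + a j"
proof -
  define i where "i = m div 2 ^ j"
  have 1: "\<bar>v n - v (n div 2 ^ j * 2 ^ j)\<bar> \<le> (\<Sum>k<j. a k)"
    by (rule dyadic_approximation[OF inc a mn(2) j(1)])
  have mp: "m < 2 ^ p" using mn by simp
  have 2: "\<bar>v m - v (i * 2 ^ j)\<bar> \<le> (\<Sum>k<j. a k)"
    unfolding i_def by (rule dyadic_approximation[OF inc a mp j(1)])
  have "i \<le> n div 2 ^ j" unfolding i_def using mn by (intro div_le_mono) simp
  moreover have "n div 2 ^ j \<le> Suc i"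
  proof -
    have "n \<le> m + 2 ^ j" using j mn by simp
    then have "n div 2 ^ j \<le> (m + 2 ^ j) div 2 ^ j" by (rule div_le_mono)
    then show ?thesis by (simp add: i_def)
  qed
  ultimately have "n div 2 ^ j = i \<or> n div 2 ^ j = Suc i" by linarith
  then have "\<bar>v (n div 2 ^ j * 2 ^ j) - v (i * 2 ^ j)\<bar> \<le> a j"
  proof
    assume e: "n div 2 ^ j = Suc i"
    have "Suc i * 2 ^ j \<le> n" unfolding e[symmetric] by (rule div_times_less_eq_dividend)
    also have "n \<le> 2 ^ p" using mn by simp
    finally have "Suc i * 2 ^ j \<le> 2 ^ p" .
    then show ?thesis using inc[of j i] j e by simp
  qed (use a in simp)
  with 1 2 show ?thesis by linarith
qed

text \<open>With \<open>\<theta> = rho8 2\<close>, summing the scales below \<open>j\<close> twice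
  and scale \<open>j\<close> once costs at most \<open>2 / (\<theta> - 1) + 1\<close> times
  \<open>\<theta> ^ j\<close>. The outer \<open>\<theta>\<close> arises because the least admissible
  \<open>j\<close> satisfies only \<open>2 ^ j \<le> 2 * (n - m)\<close>.\<close>

definition holder_factor :: real where
  "holder_factor = rho8 2 * (2 / (rho8 2 - 1) + 1)"

lemma holder_factor_nonneg: "0 \<le> holder_factor"
  using rho8_2 by (simp add: holder_factor_def)

lemma dyadic_holder:
  fixes v :: "nat \<Rightarrow> real"
  assumes inc: "\<And>j i. j \<le> p \<Longrightarrow> Suc i * 2 ^ j \<le> 2 ^ p \<Longrightarrow>
      \<bar>v (Suc i * 2 ^ j) - v (i * 2 ^ j)\<bar> \<le> L * rho8 (2 ^ j * h)"
    and L: "0 \<le> L" "0 \<le> h" and mn: "m < n" "n < 2 ^ p"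
  shows "\<bar>v n - v m\<bar> \<le> holder_factor * L * rho8 (real (n - m) * h)"
proof -
  let ?\<theta> = "rho8 2"
  note t = rho8_2
  define j where "j = (LEAST j. n - m \<le> 2 ^ j)"
  have "n - m \<le> 2 ^ p" using mn by simp
  then have j1: "n - m \<le> 2 ^ j" and jp: "j \<le> p" unfolding j_def by (rule LeastI, rule Least_le)
  have j2: "2 ^ j \<le> 2 * (n - m)"
  proof (cases j)
    case 0 then show ?thesis using mn by simp
  next
    case (Suc i)
    have "\<not> n - m \<le> 2 ^ i" using not_less_Least[of i "\<lambda>j. n - m \<le> 2 ^ j"] Suc by (simp add: j_def)
    then show ?thesis using Suc by simp
  qed
  define A where "A = L * rho8 h"
  have A0: "0 \<le> A" using L by (simp add: A_def rho8_nonneg)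
  have aj: "L * rho8 (2 ^ k * h) = A * ?\<theta> ^ k" for k by (simp add: A_def rho8_mult rho8_power)
  have "\<bar>v n - v m\<bar> \<le> 2 * (\<Sum>k<j. A * ?\<theta> ^ k) + A * ?\<theta> ^ j"
    by (rule dyadic_chaining[OF _ _ mn jp j1]) (use inc aj A0 t in auto)
  also have "(\<Sum>k<j. A * ?\<theta> ^ k) = A * ((?\<theta> ^ j - 1) / (?\<theta> - 1))"
    using t by (simp add: sum_distrib_left[symmetric] geometric_sum)
  also have "2 * (A * ((?\<theta> ^ j - 1) / (?\<theta> - 1))) + A * ?\<theta> ^ j \<le> A * ?\<theta> ^ j * (2 / (?\<theta> - 1) + 1)"
  proof -
    have "A * ((?\<theta> ^ j - 1) / (?\<theta> - 1)) \<le> A * (?\<theta> ^ j / (?\<theta> - 1))"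
      using t A0 by (intro mult_left_mono divide_right_mono) auto
    moreover have "A * ?\<theta> ^ j * (2 / (?\<theta> - 1) + 1) = 2 * (A * (?\<theta> ^ j / (?\<theta> - 1))) + A * ?\<theta> ^ j"
      by (simp add: distrib_left)
    ultimately show ?thesis by linarith
  qed
  also have "\<dots> \<le> A * (?\<theta> * rho8 (real (n - m))) * (2 / (?\<theta> - 1) + 1)"
  proof (intro mult_right_mono mult_left_mono A0)
    have "?\<theta> ^ j = rho8 (2 ^ j)" by (simp add: rho8_power)
    also have "\<dots> \<le> rho8 (2 * real (n - m))"
      using j2 by (intro rho8_mono) (metis of_nat_le_iff of_nat_mult of_nat_numeral of_nat_power)
    finally show "?\<theta> ^ j \<le> ?\<theta> * rho8 (real (n - m))" by (simp add: rho8_mult)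
    show "0 \<le> 2 / (?\<theta> - 1) + 1" using t by simp
  qed
  finally show ?thesis by (simp add: A_def holder_factor_def rho8_mult mult_ac)
qed

section \<open>Fourth moments of martingale sums and the Hoelder event\<close>

lemma (in prob_space) bounded_integrable:
  fixes f :: "'a \<Rightarrow> real"
  assumes "f \<in> borel_measurable M" "AE x in M. \<bar>f x\<bar> \<le> C"
  shows "integrable M f"
  using integrable_const_bound[of f C] assms by simp

text \<open>Induction on \<open>n\<close> by expanding the fourth power of \<open>S + D\<close>. The
  term with \<open>S ^ 3 * D\<close> vanishes by orthogonality, and the rest needs only the second
  moment of \<open>S\<close>, at most \<open>n * c\<^sup>2\<close>. The increment is thus at most
  \<open>c ^ 4 * (8 * n + 3)\<close>, within the increment \<open>c ^ 4 * (8 * n + 4)\<close> of the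
  claimed bound.\<close>

lemma (in prob_space) martingale_fourth_moment:
  fixes D :: "nat \<Rightarrow> 'a \<Rightarrow> real"
  assumes D [measurable]: "\<And>k. D k \<in> borel_measurable M" and c: "\<And>k. AE x in M. \<bar>D k x\<bar> \<le> c" "0 \<le> c"
    and ad: "\<And>k n. k < n \<Longrightarrow> D k \<in> borel_measurable (F n)"
    and orth: "\<And>k G C. G \<in> borel_measurable (F k) \<Longrightarrow> G \<in> borel_measurable M \<Longrightarrow> (AE x in M. \<bar>G x\<bar> \<le> C) \<Longrightarrow>
        (\<integral>x. G x * D k x \<partial>M) = 0"
  shows "(\<integral>x. (\<Sum>k\<in>{m..<m + n}. D k x) ^ 4 \<partial>M) \<le> 4 * c ^ 4 * (real n)\<^sup>2"
    and "integrable M (\<lambda>x. (\<Sum>k\<in>{m..<m + n}. D k x) ^ 4)"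
proof -
  define S where "S n x = (\<Sum>k\<in>{m..<m + n}. D k x)" for n x
  have Sm [measurable]: "S n \<in> borel_measurable M" for n unfolding S_def by measurable
  have SF: "S n \<in> borel_measurable (F (m + n))" for n
    unfolding S_def by (intro borel_measurable_sum ad) auto
  have S0: "S 0 x = 0" and SS: "S (Suc n) x = S n x + D (m + n) x" for n x by (auto simp: S_def)
  have Sb: "AE x in M. \<bar>S n x\<bar> \<le> real n * c" for n
  proof (induction n)
    case (Suc n)
    from Suc c(1)[of "m + n"] show ?case by eventually_elim (auto simp: SS algebra_simps)
  qed (simp add: S0)
  have int: "integrable M (\<lambda>x. S n x ^ p * D k x ^ q)" for n p k q
  proof (rule bounded_integrable)
    show "AE x in M. \<bar>S n x ^ p * D k x ^ q\<bar> \<le> (real n * c) ^ p * c ^ q"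
      using Sb[of n] c(1)[of k]
      by eventually_elim (auto simp: abs_mult power_abs intro!: mult_mono power_mono c(2))
  qed measurable
  have intS: "integrable M (\<lambda>x. S n x ^ p)" for n p using int[of n p 0 0] by simp
  have orthS: "(\<integral>x. S n x ^ p * D (m + n) x \<partial>M) = 0" for n p
  proof (rule orth)
    show "AE x in M. \<bar>S n x ^ p\<bar> \<le> (real n * c) ^ p"
      using Sb[of n] by eventually_elim (auto simp: power_abs intro!: power_mono)
  qed (use SF in \<open>auto intro!: borel_measurable_power\<close>)
  have S2: "(\<integral>x. S n x ^ 2 \<partial>M) \<le> real n * c\<^sup>2" for n
  proof (induction n)
    case (Suc n)
    have "(\<integral>x. S (Suc n) x ^ 2 \<partial>M) = (\<integral>x. S n x ^ 2 + 2 * (S n x ^ 1 * D (m + n) x ^ 1) + S n x ^ 0 * D (m + n) x ^ 2 \<partial>M)"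
      by (rule Bochner_Integration.integral_cong) (simp_all add: SS power2_eq_square algebra_simps)
    also have "\<dots> = (\<integral>x. S n x ^ 2 \<partial>M) + 2 * (\<integral>x. S n x ^ 1 * D (m + n) x ^ 1 \<partial>M) + (\<integral>x. S n x ^ 0 * D (m + n) x ^ 2 \<partial>M)"
      using int intS by (simp only: Bochner_Integration.integral_add Bochner_Integration.integrable_add integrable_mult_right integral_mult_right_zero)
    also have "(\<integral>x. S n x ^ 1 * D (m + n) x ^ 1 \<partial>M) = 0" using orthS[of n 1] by simp
    also have "(\<integral>x. S n x ^ 0 * D (m + n) x ^ 2 \<partial>M) \<le> (\<integral>x. c\<^sup>2 \<partial>M)"
    proof (rule integral_mono_AE)
      show "AE x in M. S n x ^ 0 * D (m + n) x ^ 2 \<le> c\<^sup>2"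
        using c(1)[of "m + n"] by eventually_elim (use c(2) in \<open>simp add: abs_le_square_iff[symmetric]\<close>)
    qed (use int[of n 0 "m + n" 2] in auto)
    finally show ?case using Suc by (simp add: prob_space algebra_simps)
  qed (simp add: S0)
  have S4: "(\<integral>x. S n x ^ 4 \<partial>M) \<le> 4 * c ^ 4 * (real n)\<^sup>2"
  proof (induction n)
    case (Suc n)
    let ?D = "D (m + n)"
    have "(\<integral>x. 6 * (S n x ^ 2 * ?D x ^ 2) + 4 * (S n x ^ 1 * ?D x ^ 3) + S n x ^ 0 * ?D x ^ 4 \<partial>M)
      \<le> (\<integral>x. 8 * c\<^sup>2 * S n x ^ 2 + 3 * c ^ 4 \<partial>M)"
    proof (rule integral_mono_AE)
      show "AE x in M. 6 * (S n x ^ 2 * ?D x ^ 2) + 4 * (S n x ^ 1 * ?D x ^ 3) + S n x ^ 0 * ?D x ^ 4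
        \<le> 8 * c\<^sup>2 * S n x ^ 2 + 3 * c ^ 4"
        using c(1)[of "m + n"]
      proof eventually_elim
        case (elim x)
        define s d where "s = \<bar>S n x\<bar>" and "d = \<bar>?D x\<bar>"
        have sd: "0 \<le> s" "0 \<le> d" "d \<le> c" using elim by (auto simp: s_def d_def)
        have d2: "d ^ p \<le> c ^ p" for p using sd by (intro power_mono) auto
        have "S n x ^ 1 * ?D x ^ 3 \<le> \<bar>S n x ^ 1 * ?D x ^ 3\<bar>" by simp
        also have "\<dots> = s * d ^ 3" by (simp add: s_def d_def abs_mult power_abs)
        also have "\<dots> \<le> s * c ^ 3" using sd d2 by (intro mult_left_mono) auto
        finally have 1: "4 * (S n x ^ 1 * ?D x ^ 3) \<le> 4 * s * c ^ 3" by simp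
        \<comment> \<open>The term with \<open>S * D ^ 3\<close> does not cancel;
          \<open>2 * s * c \<le> s\<^sup>2 + c\<^sup>2\<close> trades it for a square
          moment.\<close>
        have "4 * s * c ^ 3 = 2 * c\<^sup>2 * (2 * s * c)" by (simp add: power2_eq_square power3_eq_cube)
        also have "\<dots> \<le> 2 * c\<^sup>2 * (s\<^sup>2 + c\<^sup>2)" using sum_squares_bound[of s c] by (intro mult_left_mono) auto
        finally have 2: "4 * s * c ^ 3 \<le> 2 * c\<^sup>2 * s\<^sup>2 + 2 * c ^ 4" by (simp add: algebra_simps power2_eq_square power4_eq_xxxx)
        have 3: "6 * (s\<^sup>2 * d\<^sup>2) \<le> 6 * (s\<^sup>2 * c\<^sup>2)" using d2 by (intro mult_left_mono) auto
        have e: "S n x ^ 2 = s\<^sup>2" "?D x ^ 2 = d\<^sup>2" "?D x ^ 4 = d ^ 4"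
          by (simp_all add: s_def d_def power_even_abs)
        show ?case using 1 2 3 d2[of 4] unfolding e by (simp add: algebra_simps)
      qed
    qed (use int[of n 0 "m + n" 4] int[of n 1 "m + n" 3] int intS in \<open>auto intro!: Bochner_Integration.integrable_add\<close>)
    also have "\<dots> = 8 * c\<^sup>2 * (\<integral>x. S n x ^ 2 \<partial>M) + 3 * c ^ 4" using intS by (simp add: prob_space)
    also have "\<dots> \<le> 8 * c\<^sup>2 * (real n * c\<^sup>2) + 3 * c ^ 4" using S2[of n] by (intro add_right_mono mult_left_mono) auto
    finally have R: "(\<integral>x. 6 * (S n x ^ 2 * ?D x ^ 2) + 4 * (S n x ^ 1 * ?D x ^ 3) + S n x ^ 0 * ?D x ^ 4 \<partial>M)
      \<le> 8 * c\<^sup>2 * (real n * c\<^sup>2) + 3 * c ^ 4" .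
    have "(\<integral>x. S (Suc n) x ^ 4 \<partial>M) = (\<integral>x. S n x ^ 4 + 4 * (S n x ^ 3 * ?D x ^ 1)
        + (6 * (S n x ^ 2 * ?D x ^ 2) + 4 * (S n x ^ 1 * ?D x ^ 3) + S n x ^ 0 * ?D x ^ 4) \<partial>M)"
      by (rule Bochner_Integration.integral_cong) (simp_all add: SS power4_eq_xxxx power2_eq_square power3_eq_cube algebra_simps)
    also have "\<dots> = (\<integral>x. S n x ^ 4 \<partial>M) + 4 * (\<integral>x. S n x ^ 3 * ?D x ^ 1 \<partial>M)
       + (\<integral>x. 6 * (S n x ^ 2 * ?D x ^ 2) + 4 * (S n x ^ 1 * ?D x ^ 3) + S n x ^ 0 * ?D x ^ 4 \<partial>M)"
      using int intS by (simp only: Bochner_Integration.integral_add Bochner_Integration.integrable_add integrable_mult_right integral_mult_right_zero)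
    also have "(\<integral>x. S n x ^ 3 * ?D x ^ 1 \<partial>M) = 0" using orthS[of n 3] by simp
    finally have "(\<integral>x. S (Suc n) x ^ 4 \<partial>M) \<le> (\<integral>x. S n x ^ 4 \<partial>M) + c ^ 4 * (8 * real n + 3)"
      using R by (simp add: algebra_simps power2_eq_square power4_eq_xxxx)
    also have "\<dots> \<le> 4 * c ^ 4 * (real n)\<^sup>2 + c ^ 4 * (8 * real n + 4)"
      using Suc by (intro add_mono mult_left_mono) auto
    finally show ?case by (simp add: algebra_simps power2_eq_square)
  qed (simp add: S0)
  show "(\<integral>x. (\<Sum>k\<in>{m..<m + n}. D k x) ^ 4 \<partial>M) \<le> 4 * c ^ 4 * (real n)\<^sup>2"
    using S4 by (simp add: S_def)
  show "integrable M (\<lambda>x. (\<Sum>k\<in>{m..<m + n}. D k x) ^ 4)" using intS[of n 4] by (simp add: S_def)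
qed

lemma (in prob_space) avoid_countable_bad:
  assumes "\<And>N :: nat. Bad N \<in> events" "\<And>N. prob (Bad N) \<le> \<epsilon> / 2 ^ Suc N"
  shows "\<exists>A\<in>events. 1 - \<epsilon> \<le> prob A \<and> (\<forall>\<omega>\<in>A. \<forall>N. \<omega> \<notin> Bad N)"
proof -
  have sm: "(\<lambda>N. \<epsilon> / 2 ^ Suc N) sums \<epsilon>"
    using sums_mult[OF power_half_series, of \<epsilon>] by (simp add: power_divide)
  have s: "summable (\<lambda>N. prob (Bad N))"
    by (rule summable_comparison_test'[OF sums_summable[OF sm]]) (use assms in auto)
  have "prob (\<Union>N. Bad N) \<le> (\<Sum>N. prob (Bad N))"
    using assms s by (intro finite_measure_subadditive_countably) auto
  also have "\<dots> \<le> (\<Sum>N. \<epsilon> / 2 ^ Suc N)" by (rule suminf_le[OF assms(2) s sums_summable[OF sm]])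
  also have "\<dots> = \<epsilon>" using sm by (rule sums_unique[symmetric])
  finally have "1 - \<epsilon> \<le> prob (space M - (\<Union>N. Bad N))" using assms by (subst prob_compl) auto
  then show ?thesis using assms by (intro bexI[of _ "space M - (\<Union>N. Bad N)"]) auto
qed

text \<open>The summand \<open>1\<close> gives \<open>L \<le> L ^ 4\<close> for this constant \<open>L\<close>, so Markov's inequality for
  fourth moments needs no fourth root.\<close>
definition holder_const :: "real \<Rightarrow> real \<Rightarrow> real \<Rightarrow> nat \<Rightarrow> real" where
  "holder_const c B \<epsilon> N = 1 + 4 * c * (2 * N + B\<^sup>2) * (1 + (2 * N + B\<^sup>2)) / (\<epsilon> / 2 ^ Suc N)"

lemma sqrt2_geometric: "(\<Sum>j\<le>p. sqrt 2 ^ j) \<le> 4 * sqrt 2 ^ p"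
proof (induction p)
  case (Suc p)
  \<comment> \<open>The induction step with constant \<open>4\<close> amounts to
    \<open>4 \<le> 3 * sqrt 2\<close>.\<close>
  have "4 / 3 \<le> sqrt (2::real)" by (rule real_le_rsqrt) (simp add: power2_eq_square)
  then have "4 * sqrt 2 ^ p \<le> 3 * sqrt (2::real) * sqrt 2 ^ p" by (intro mult_right_mono) auto
  then show ?case using Suc unfolding sum.atMost_Suc power_Suc by linarith
qed simp

text \<open>Markov's inequality at threshold \<open>a j\<close> costs
  \<open>c * h ^ 3 / L ^ 4 * (4 / sqrt 2) ^ j\<close> for each of the \<open>2 ^ (p - j)\<close>
  increments of scale \<open>j\<close>. Over all scales this sums to order
  \<open>(2 ^ p * h\<^sup>2)\<close> to the power \<open>3/2\<close>, in which no separate power of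
  \<open>h\<close> is left; so a constant \<open>L\<close> can be chosen independently of the
  mesh.\<close>

lemma (in prob_space) dyadic_bad_event:
  fixes X :: "nat \<Rightarrow> 'a \<Rightarrow> real"
  assumes X [measurable]: "\<And>n. X n \<in> borel_measurable M"
    and mom: "\<And>m n. (\<integral>x. (X (m + n) x - X m x) ^ 4 \<partial>M) \<le> c * h ^ 4 * (real n)\<^sup>2"
      "\<And>m n. integrable M (\<lambda>x. (X (m + n) x - X m x) ^ 4)"
    and h: "0 < h" "h \<le> B" and c: "0 \<le> c" and \<epsilon>: "0 < \<epsilon>"
  shows "\<exists>Bad\<in>events. prob Bad \<le> \<epsilon> / 2 ^ Suc N \<and> (\<forall>\<omega>\<in>space M - Bad. \<forall>n m.
    real n * h\<^sup>2 \<le> real N \<and> real m * h\<^sup>2 \<le> real N \<longrightarrow>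
      \<bar>X n \<omega> - X m \<omega>\<bar> \<le> holder_factor * holder_const c B \<epsilon> N * rho8 (\<bar>real n - real m\<bar> * h\<^sup>2))"
proof -
  define L where "L = holder_const c B \<epsilon> N"
  define R where "R = 2 * real N + B\<^sup>2"
  have R0: "0 \<le> R" by (simp add: R_def)
  have L1: "1 \<le> L" using c \<epsilon> R0 by (simp add: L_def holder_const_def R_def[symmetric])
  \<comment> \<open>The least such \<open>p\<close> keeps \<open>2 ^ p * h\<^sup>2\<close> below
    \<open>2 * N\<close>, or below \<open>B\<^sup>2\<close> when \<open>p = 0\<close>;
    \<open>R\<close> covers both cases.\<close>
  define p where "p = (LEAST p. real N < 2 ^ p * h\<^sup>2)"
  obtain p0 :: nat where "real N / h\<^sup>2 < 2 ^ p0" using real_arch_pow[of 2] by auto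
  then have "real N < 2 ^ p0 * h\<^sup>2" using h by (simp add: divide_less_eq)
  then have p1: "real N < 2 ^ p * h\<^sup>2" unfolding p_def by (rule LeastI)
  have p2: "2 ^ p * h\<^sup>2 \<le> R"
  proof (cases p)
    case 0
    have "h\<^sup>2 \<le> B\<^sup>2" using h by (intro power_mono) auto
    then show ?thesis using 0 by (simp add: R_def)
  next
    case (Suc q)
    have "\<not> real N < 2 ^ q * h\<^sup>2" using not_less_Least[of q "\<lambda>p. real N < 2 ^ p * h\<^sup>2"] Suc by (simp add: p_def)
    moreover have "0 \<le> B\<^sup>2" by simp
    ultimately show ?thesis unfolding R_def Suc power_Suc mult.assoc not_less by linarith
  qed
  define a where "a j = L * rho8 (2 ^ j * h\<^sup>2)" for j :: nat
  have h2: "0 < 2 ^ j * h\<^sup>2" for j :: nat using h by simp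
  have apos: "0 < a j" for j using L1 h2[of j] unfolding a_def rho8_def by (intro mult_pos_pos) auto
  have a4: "a j ^ 4 = L ^ 4 * (sqrt 2 ^ j * h)" for j
    using h2[of j] h by (simp add: a_def power_mult_distrib rho8_pow4 less_imp_le real_sqrt_mult real_sqrt_power)
  define E where "E j i = {\<omega>\<in>space M. a j < \<bar>X (Suc i * 2 ^ j) \<omega> - X (i * 2 ^ j) \<omega>\<bar>}" for j i
  have Em: "E j i \<in> events" for j i unfolding E_def by measurable
  have PE: "prob (E j i) \<le> c * h ^ 3 / L ^ 4 * (4 / sqrt 2) ^ j" for j i
  proof -
    let ?Y = "\<lambda>x. (X (i * 2 ^ j + 2 ^ j) x - X (i * 2 ^ j) x) ^ 4"
    have "prob (E j i) \<le> prob {x\<in>space M. a j ^ 4 \<le> ?Y x}"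
    proof (rule finite_measure_mono)
      show "E j i \<subseteq> {x\<in>space M. a j ^ 4 \<le> ?Y x}"
      proof (clarsimp simp: E_def)
        fix x assume "a j < \<bar>X (2 ^ j + i * 2 ^ j) x - X (i * 2 ^ j) x\<bar>"
        then have "a j ^ 4 \<le> \<bar>X (2 ^ j + i * 2 ^ j) x - X (i * 2 ^ j) x\<bar> ^ 4" using apos[of j] by (intro power_mono) auto
        then show "a j ^ 4 \<le> (X (i * 2 ^ j + 2 ^ j) x - X (i * 2 ^ j) x) ^ 4" by (simp add: power_even_abs add.commute)
      qed
    qed measurable
    also have "\<dots> \<le> (\<integral>x. ?Y x \<partial>M) / a j ^ 4"
      using apos[of j] by (intro integral_Markov_inequality_measure[where A = "{}"] mom(2)) auto
    also have "\<dots> \<le> (c * h ^ 4 * (real (2 ^ j))\<^sup>2) / a j ^ 4"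
      using apos[of j] by (intro divide_right_mono mom(1)) auto
    also have "\<dots> = c * h ^ 3 / L ^ 4 * (4 / sqrt 2) ^ j"
    proof -
      have "(real (2 ^ j))\<^sup>2 = 4 ^ j" by (simp add: power2_eq_square flip: power_mult_distrib)
      moreover have "h ^ 4 = h ^ 3 * h" by (simp add: power4_eq_xxxx power3_eq_cube)
      ultimately show ?thesis using h L1 by (simp add: a4 power_divide)
    qed
    finally show ?thesis .
  qed
  define Bad where "Bad = (\<Union>j\<le>p. \<Union>i<2 ^ (p - j). E j i)"
  have Bm: "Bad \<in> events" unfolding Bad_def by (intro sets.finite_UN) (use Em in auto)
  have sq: "2 * (1 / sqrt 2) = sqrt (2::real)" by (simp add: real_div_sqrt)
  have "prob Bad \<le> (\<Sum>j\<le>p. prob (\<Union>i<2 ^ (p - j). E j i))"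
    unfolding Bad_def by (rule finite_measure_subadditive_finite) (use Em in auto)
  also have "\<dots> \<le> (\<Sum>j\<le>p. c * h ^ 3 / L ^ 4 * 2 ^ p * sqrt 2 ^ j)"
  proof (rule sum_mono)
    fix j assume "j \<in> {..p}"
    then have j: "j \<le> p" by simp
    have "prob (\<Union>i<2 ^ (p - j). E j i) \<le> (\<Sum>i<(2::nat) ^ (p - j). prob (E j i))"
      by (rule finite_measure_subadditive_finite) (use Em in auto)
    also have "\<dots> \<le> (\<Sum>i<(2::nat) ^ (p - j). c * h ^ 3 / L ^ 4 * (4 / sqrt 2) ^ j)"
      by (rule sum_mono) (rule PE)
    also have "\<dots> = c * h ^ 3 / L ^ 4 * (2 ^ (p - j) * (4 / sqrt 2) ^ j)" by simp
    also have "2 ^ (p - j) * (4 / sqrt 2) ^ j = 2 ^ p * sqrt (2::real) ^ j"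
    proof -
      have "(4 / sqrt 2 :: real) = 2 * sqrt 2" using sq by simp
      then have "(4 / sqrt 2 :: real) ^ j = 2 ^ j * sqrt 2 ^ j" by (simp add: power_mult_distrib)
      moreover have "(2::real) ^ (p - j) * 2 ^ j = 2 ^ p" using j by (simp flip: power_add)
      ultimately show ?thesis by (simp add: mult.assoc[symmetric])
    qed
    finally show "prob (\<Union>i<2 ^ (p - j). E j i) \<le> c * h ^ 3 / L ^ 4 * 2 ^ p * sqrt 2 ^ j" by (simp add: mult_ac)
  qed
  also have "\<dots> = c * h ^ 3 / L ^ 4 * 2 ^ p * (\<Sum>j\<le>p. sqrt 2 ^ j)" by (simp add: sum_distrib_left)
  also have "\<dots> \<le> c * h ^ 3 / L ^ 4 * 2 ^ p * (4 * sqrt 2 ^ p)"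
    using c h L1 by (intro mult_left_mono sqrt2_geometric) auto
  also have "\<dots> = 4 * c / L ^ 4 * ((2 ^ p * h\<^sup>2) * (sqrt 2 ^ p * h))"
    by (simp add: power2_eq_square power3_eq_cube)
  \<comment> \<open>The remaining root is removed by \<open>sqrt R \<le> 1 + R\<close>.\<close>
  also have "\<dots> \<le> 4 * c / L ^ 4 * (R * (1 + R))"
  proof (intro mult_left_mono mult_mono p2)
    have "sqrt 2 ^ p * h = sqrt (2 ^ p * h\<^sup>2)" using h by (simp add: real_sqrt_mult real_sqrt_power)
    also have "\<dots> \<le> sqrt R" using p2 by simp
    also have "\<dots> \<le> 1 + R"
    proof (rule real_le_lsqrt)
      show "R \<le> (1 + R)\<^sup>2" using R0 by (simp add: power2_eq_square algebra_simps)
    qed (use R0 in auto)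
    finally show "sqrt 2 ^ p * h \<le> 1 + R" .
  qed (use c R0 h L1 in auto)
  also have "\<dots> \<le> 4 * c / L * (R * (1 + R))"
  proof (intro mult_right_mono divide_left_mono)
    show "L \<le> L ^ 4" using L1 power_increasing[of 1 4 L] by simp
  qed (use c R0 L1 in auto)
  also have "\<dots> = 4 * c * R * (1 + R) / L" by simp
  also have "\<dots> \<le> \<epsilon> / 2 ^ Suc N"
  proof -
    have e: "0 < \<epsilon> / 2 ^ Suc N" using \<epsilon> by simp
    have "4 * c * R * (1 + R) / (\<epsilon> / 2 ^ Suc N) \<le> L" by (simp add: L_def holder_const_def R_def)
    then have "4 * c * R * (1 + R) \<le> L * (\<epsilon> / 2 ^ Suc N)" using e by (simp only: pos_divide_le_eq)
    then show ?thesis using L1 by (simp only: pos_divide_le_eq mult.commute[of _ L])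
  qed
  finally have PB: "prob Bad \<le> \<epsilon> / 2 ^ Suc N" .
  have good: "\<bar>X n \<omega> - X m \<omega>\<bar> \<le> holder_factor * L * rho8 (\<bar>real n - real m\<bar> * h\<^sup>2)"
    if \<omega>: "\<omega> \<in> space M - Bad" and nm: "real n * h\<^sup>2 \<le> real N" "real m * h\<^sup>2 \<le> real N" for \<omega> n m
  proof -
    have small: "n < 2 ^ p" if "real n * h\<^sup>2 \<le> real N" for n
    proof -
      have "real n * h\<^sup>2 < 2 ^ p * h\<^sup>2" using that p1 by linarith
      then have "real n < 2 ^ p" using h by simp
      then show ?thesis by (metis of_nat_less_iff of_nat_numeral of_nat_power)
    qed
    have inc: "\<bar>X (Suc i * 2 ^ j) \<omega> - X (i * 2 ^ j) \<omega>\<bar> \<le> L * rho8 (2 ^ j * h\<^sup>2)"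
      if j: "j \<le> p" "Suc i * 2 ^ j \<le> 2 ^ p" for i j
    proof -
      have "Suc i * 2 ^ j \<le> 2 ^ (p - j) * 2 ^ j" using j by (simp flip: power_add)
      then have "i < 2 ^ (p - j)" by (simp add: Suc_le_eq del: mult_Suc)
      then have "\<omega> \<notin> E j i" using \<omega> j by (auto simp: Bad_def)
      then show ?thesis using \<omega> by (auto simp: E_def a_def)
    qed
    have *: "\<bar>X n \<omega> - X m \<omega>\<bar> \<le> holder_factor * L * rho8 (real (n - m) * h\<^sup>2)"
      if "m < n" "real n * h\<^sup>2 \<le> real N" for n m
      by (rule dyadic_holder[OF inc _ _ that(1) small[OF that(2)]]) (use L1 in auto)
    consider "m < n" | "n < m" | "m = n" by linarith
    then show ?thesis
    proof cases
      case 1 then show ?thesis using *[OF 1 nm(1)] by (simp add: of_nat_diff)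
    next
      case 2 then show ?thesis using *[OF 2 nm(2)] by (simp add: of_nat_diff abs_minus_commute)
    next
      case 3 then show ?thesis by (simp add: rho8_def)
    qed
  qed
  show ?thesis using Bm PB good unfolding L_def by (intro bexI[of _ Bad]) auto
qed

lemma (in prob_space) holder_event:
  fixes X :: "nat \<Rightarrow> 'a \<Rightarrow> real"
  assumes X: "\<And>n. X n \<in> borel_measurable M"
    and mom: "\<And>m n. (\<integral>x. (X (m + n) x - X m x) ^ 4 \<partial>M) \<le> c * h ^ 4 * (real n)\<^sup>2"
      "\<And>m n. integrable M (\<lambda>x. (X (m + n) x - X m x) ^ 4)"
    and h: "0 < h" "h \<le> B" and c: "0 \<le> c" and \<epsilon>: "0 < \<epsilon>"
  shows "\<exists>A\<in>events. 1 - \<epsilon> \<le> prob A \<and> (\<forall>\<omega>\<in>A. \<forall>N n m.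
    real n * h\<^sup>2 \<le> real N \<and> real m * h\<^sup>2 \<le> real N \<longrightarrow>
      \<bar>X n \<omega> - X m \<omega>\<bar> \<le> holder_factor * holder_const c B \<epsilon> N * rho8 (\<bar>real n - real m\<bar> * h\<^sup>2))"
proof -
  have "\<forall>N. \<exists>Bad. Bad \<in> events \<and> prob Bad \<le> \<epsilon> / 2 ^ Suc N \<and> (\<forall>\<omega>\<in>space M - Bad. \<forall>n m.
    real n * h\<^sup>2 \<le> real N \<and> real m * h\<^sup>2 \<le> real N \<longrightarrow>
      \<bar>X n \<omega> - X m \<omega>\<bar> \<le> holder_factor * holder_const c B \<epsilon> N * rho8 (\<bar>real n - real m\<bar> * h\<^sup>2))"
    using dyadic_bad_event[OF X mom h c \<epsilon>] unfolding Bex_def by (intro allI)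
  then obtain Bad where Bad: "\<forall>N. Bad N \<in> events \<and> prob (Bad N) \<le> \<epsilon> / 2 ^ Suc N \<and> (\<forall>\<omega>\<in>space M - Bad N. \<forall>n m.
    real n * h\<^sup>2 \<le> real N \<and> real m * h\<^sup>2 \<le> real N \<longrightarrow>
      \<bar>X n \<omega> - X m \<omega>\<bar> \<le> holder_factor * holder_const c B \<epsilon> N * rho8 (\<bar>real n - real m\<bar> * h\<^sup>2))"
    by (rule choice[THEN exE]) (rule that)
  have B1: "Bad N \<in> events" and B2: "prob (Bad N) \<le> \<epsilon> / 2 ^ Suc N" for N using Bad by auto
  obtain A where A: "A \<in> events" "1 - \<epsilon> \<le> prob A" "\<forall>\<omega>\<in>A. \<forall>N. \<omega> \<notin> Bad N"
    using avoid_countable_bad[OF B1 B2] by (elim bexE conjE) (rule that)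
  have "A \<subseteq> space M" using A(1) by (rule sets.sets_into_space)
  then show ?thesis using A Bad by (intro bexI[of _ A] conjI ballI allI impI) (auto simp: subset_iff)
qed

lemma holder_const_nonneg: "0 \<le> c \<Longrightarrow> 0 < \<epsilon> \<Longrightarrow> 0 \<le> holder_const c B \<epsilon> N"
  by (simp add: holder_const_def)

section \<open>The approximating chain\<close>

lemma compact_Uset: "compact (Uset P)"
proof -
  have "Uset P = ({Ma P..1} \<times> {0..Ms P} \<times> {Ml P..1}) \<inter> {v. fst (snd v) + snd (snd v) \<le> 1}"
    by (auto simp: Uset_def)
  moreover have "closed {v :: ctrl. fst (snd v) + snd (snd v) \<le> 1}"
    by (intro closed_Collect_le continuous_intros)
  ultimately show ?thesis by (auto intro!: compact_Int_closed compact_Times)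
qed

lemma drift_alt: "drift P x i v = cfun P i - (1 + beta P) * (1 - fst v) * muC P i - fst v * muC P i
     + (fst (snd v) * r1 P i + (1 - fst (snd v) - snd (snd v)) * r2 P - snd (snd v)) * max (x - Kc P) 0"
  by (simp add: drift_def Psi_def split: prod.split)

lemma sig2_alt: "sig2 P x i v = (fst v)\<^sup>2 * (sigC P i)\<^sup>2 + (fst (snd v))\<^sup>2 * (sigS P i)\<^sup>2 * (max (x - Kc P) 0)\<^sup>2"
  by (simp add: sig2_def split: prod.split)

lemma continuous_drift: "continuous_on S (\<lambda>z. drift P (fst z) i (snd z))"
  unfolding drift_alt by (intro continuous_intros)

lemma continuous_sig2: "continuous_on S (\<lambda>z. sig2 P (fst z) i (snd z))"
  unfolding sig2_alt by (intro continuous_intros)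

text \<open>The constants depend on the model and on \<open>B\<close> and serve every mesh up to
  \<open>B\<close> at once, which makes the later moduli uniform. Coefficients matter only at
  regular steps, hence the restriction to the interval from \<open>-B\<close> to
  \<open>B\<close>.\<close>

definition coeff_bounds :: "model \<Rightarrow> real \<Rightarrow> real \<Rightarrow> real \<Rightarrow> real \<Rightarrow> real \<Rightarrow> bool" where
  "coeff_bounds P B s0 b0 D0 q0 \<longleftrightarrow> 0 < s0 \<and> 0 \<le> b0 \<and> 0 < D0 \<and> 0 \<le> q0 \<and>
     (\<forall>i<m0 P. 0 \<le> - Q P i i \<and> - Q P i i \<le> q0) \<and>
     (\<forall>x i v. \<bar>x\<bar> \<le> B \<longrightarrow> i < m0 P \<longrightarrow> v \<in> Uset P \<longrightarrow> s0 \<le> sig2 P x i v \<and> \<bar>drift P x i v\<bar> \<le> b0 \<and>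
        (\<forall>h. 0 < h \<and> h \<le> B \<longrightarrow> s0 \<le> Dn P h x i v \<and> Dn P h x i v \<le> D0))"

lemma generator_diag:
  assumes "irreducible_generator m q" "i < m"
  shows "(\<Sum>j\<in>{..<m} - {i}. q i j) = - q i i" "0 \<le> - q i i"
proof -
  have "(\<Sum>j<m. q i j) = 0" using assms by (simp add: irreducible_generator_def)
  moreover have "(\<Sum>j<m. q i j) = q i i + (\<Sum>j\<in>{..<m} - {i}. q i j)"
    using assms(2) by (intro sum.remove) auto
  ultimately show e: "(\<Sum>j\<in>{..<m} - {i}. q i j) = - q i i" by simp
  have "0 \<le> (\<Sum>j\<in>{..<m} - {i}. q i j)"
    using assms by (intro sum_nonneg) (auto simp: irreducible_generator_def)
  then show "0 \<le> - q i i" using e by simp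
qed

text \<open>Upper bounds come from continuity on the compact set of positions and controls, for each
  of finitely many regimes. The lower bound of \<open>sig2\<close> comes from its first summand
  alone, as \<open>a\<close> stays above \<open>Ma P > 0\<close>; the other summand vanishes below
  \<open>Kc P\<close>.\<close>

lemma ex_coeff_bounds:
  assumes MA: "model_assms P" and B: "0 < B"
  shows "\<exists>s0 b0 D0 q0. coeff_bounds P B s0 b0 D0 q0"
proof -
  let ?I = "{..<m0 P}"
  let ?Z = "{-B..B} \<times> Uset P"
  have fin: "finite ?I" "?I \<noteq> {}" using MA by (auto simp: model_assms_def lessThan_empty_iff)
  have cZ: "compact ?Z" by (intro compact_Times compact_Uset) simp
  have bd: "\<exists>b. \<forall>i<m0 P. \<forall>x v. \<bar>x\<bar> \<le> B \<longrightarrow> v \<in> Uset P \<longrightarrow> \<bar>f x i v\<bar> \<le> b \<and> 0 \<le> b"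
    if c: "\<And>i. continuous_on ?Z (\<lambda>z. f (fst z) i (snd z))" for f :: "real \<Rightarrow> nat \<Rightarrow> ctrl \<Rightarrow> real"
  proof -
    have "\<exists>b. 0 \<le> b \<and> (\<forall>x v. \<bar>x\<bar> \<le> B \<longrightarrow> v \<in> Uset P \<longrightarrow> \<bar>f x i v\<bar> \<le> b)" for i
    proof -
      have "bounded ((\<lambda>z. f (fst z) i (snd z)) ` ?Z)"
        using c cZ by (intro compact_imp_bounded compact_continuous_image)
      then obtain b where b: "0 < b" "\<And>z. z \<in> ?Z \<Longrightarrow> \<bar>f (fst z) i (snd z)\<bar> \<le> b"
        unfolding bounded_pos by auto
      have "\<bar>f x i v\<bar> \<le> b" if "\<bar>x\<bar> \<le> B" "v \<in> Uset P" for x v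
        using b(2)[of "(x, v)"] that by (simp add: abs_le_iff)
      then show ?thesis using b(1) by (intro exI[of _ b]) auto
    qed
    then obtain b where b: "\<And>i. 0 \<le> b i" "\<And>i x v. \<bar>x\<bar> \<le> B \<Longrightarrow> v \<in> Uset P \<Longrightarrow> \<bar>f x i v\<bar> \<le> b i" by metis
    have "b i \<le> sum b ?I" if "i < m0 P" for i using that b by (intro member_le_sum) auto
    then show ?thesis using b by (intro exI[of _ "sum b ?I"]) (meson order_trans sum_nonneg)
  qed
  obtain b0 where b0: "\<forall>i<m0 P. \<forall>x v. \<bar>x\<bar> \<le> B \<longrightarrow> v \<in> Uset P \<longrightarrow> \<bar>drift P x i v\<bar> \<le> b0 \<and> 0 \<le> b0"
    using bd[of "drift P"] continuous_drift by blast
  obtain s1 where s1: "\<forall>i<m0 P. \<forall>x v. \<bar>x\<bar> \<le> B \<longrightarrow> v \<in> Uset P \<longrightarrow> \<bar>sig2 P x i v\<bar> \<le> s1 \<and> 0 \<le> s1"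
    using bd[of "sig2 P"] continuous_sig2 by blast
  define q0 where "q0 = (\<Sum>i<m0 P. - Q P i i)"
  have ig: "irreducible_generator (m0 P) (Q P)" using MA by (simp add: model_assms_def)
  have q: "0 \<le> - Q P i i" "- Q P i i \<le> q0" if "i < m0 P" for i
  proof -
    show "0 \<le> - Q P i i" by (rule generator_diag(2)[OF ig that])
    show "- Q P i i \<le> q0" unfolding q0_def
      using that generator_diag(2)[OF ig] by (intro member_le_sum) auto
  qed
  have q00: "0 \<le> q0" unfolding q0_def using generator_diag(2)[OF ig] by (intro sum_nonneg) auto
  define \<sigma> where "\<sigma> = Min ((\<lambda>i. (sigC P i)\<^sup>2) ` ?I)"
  have "\<sigma> \<in> (\<lambda>i. (sigC P i)\<^sup>2) ` ?I" unfolding \<sigma>_def using fin by (intro Min_in) auto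
  then have \<sigma>0: "0 < \<sigma>" using MA by (auto simp: model_assms_def)
  define s0 where "s0 = (Ma P)\<^sup>2 * \<sigma>"
  have Ma: "0 < Ma P" using MA by (simp add: model_assms_def)
  have s00: "0 < s0" using \<sigma>0 Ma by (simp add: s0_def)
  have s0: "s0 \<le> sig2 P x i v" if i: "i < m0 P" and v: "v \<in> Uset P" for x i v
  proof -
    have "Ma P \<le> fst v" using v by (auto simp: Uset_def)
    then have "(Ma P)\<^sup>2 \<le> (fst v)\<^sup>2" using Ma by (intro power_mono) auto
    moreover have "\<sigma> \<le> (sigC P i)\<^sup>2" unfolding \<sigma>_def using i by (intro Min_le) auto
    ultimately have "s0 \<le> (fst v)\<^sup>2 * (sigC P i)\<^sup>2" unfolding s0_def using \<sigma>0 by (intro mult_mono) auto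
    then show ?thesis by (simp add: sig2_alt add_increasing2)
  qed
  define D0 where "D0 = \<bar>s1\<bar> + B * \<bar>b0\<bar> + B\<^sup>2 * q0 + 1"
  have D00: "0 < D0" using B q00 by (simp add: D0_def add_nonneg_pos)
  have D: "s0 \<le> Dn P h x i v" "Dn P h x i v \<le> D0"
    if x: "\<bar>x\<bar> \<le> B" and i: "i < m0 P" and v: "v \<in> Uset P" and h: "0 < h" "h \<le> B" for x i v h
  proof -
    have "0 \<le> h\<^sup>2 * - Q P i i" using q(1)[OF i] by (intro mult_nonneg_nonneg) auto
    moreover have "0 \<le> h * \<bar>drift P x i v\<bar>" using h by simp
    ultimately show "s0 \<le> Dn P h x i v" unfolding Dn_def using s0[OF i v, of x] by linarith
    have "sig2 P x i v \<le> \<bar>s1\<bar>" using s1 x i v by fastforce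
    moreover have "h * \<bar>drift P x i v\<bar> \<le> B * \<bar>b0\<bar>" using b0 x i v h by (intro mult_mono) fastforce+
    moreover have "h\<^sup>2 * - Q P i i \<le> B\<^sup>2 * q0" using h q[OF i] by (intro mult_mono power_mono) auto
    ultimately show "Dn P h x i v \<le> D0" unfolding Dn_def D0_def by linarith
  qed
  have "coeff_bounds P B s0 \<bar>b0\<bar> D0 q0"
    unfolding coeff_bounds_def using s00 D00 q00 q s0 D b0 by fastforce
  then show ?thesis by blast
qed

section \<open>One step of the controlled chain\<close>

locale controlled_chain =
  fixes P :: model and B h :: real and M :: "'a measure" and F :: "nat \<Rightarrow> 'a measure"
    and xi :: "nat \<Rightarrow> 'a \<Rightarrow> real" and al :: "nat \<Rightarrow> 'a \<Rightarrow> nat" and u :: "nat \<Rightarrow> 'a \<Rightarrow> ctrl"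
    and s0 b0 D0 q0 :: real
  assumes MA: "model_assms P" and B0: "0 < B" and hH: "h \<in> Hset B"
    and chain: "approx_chain P B h M F xi al u" and bounds: "coeff_bounds P B s0 b0 D0 q0"
begin

lemma h0: "0 < h" "h \<le> B"
proof -
  obtain k :: nat where k: "0 < h" "0 < k" "B = real k * h" using hH by (auto simp: Hset_def)
  show "0 < h" by fact
  have "1 * h \<le> real k * h" using k by (intro mult_right_mono) auto
  then show "h \<le> B" using k by simp
qed

sublocale prob_space M using chain by (simp add: approx_chain_def)

lemma sub: "sigma_finite_subalgebra M (F n)" using chain by (simp add: approx_chain_def)

lemma subalg: "subalgebra M (F n)"
  using sub[of n] by (rule sigma_finite_subalgebra.subalg)

lemma space_F: "space (F n) = space M" using subalg[of n] by (simp add: subalgebra_def)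

lemma sets_F_M: "A \<in> sets (F n) \<Longrightarrow> A \<in> events" using subalg[of n] by (auto simp: subalgebra_def)

lemma sets_F_mono: "m \<le> n \<Longrightarrow> sets (F m) \<subseteq> sets (F n)"
  by (rule lift_Suc_mono_le) (use chain in \<open>auto simp: approx_chain_def\<close>)

lemma measurable_F_mono:
  assumes "f \<in> measurable (F m) N" "m \<le> n" shows "f \<in> measurable (F n) N"
proof (rule measurable_from_subalg[OF _ assms(1)])
  show "subalgebra (F n) (F m)" using sets_F_mono[OF assms(2)] by (auto simp: subalgebra_def space_F)
qed

lemma measurable_F_M: "f \<in> measurable (F m) N \<Longrightarrow> f \<in> measurable M N"
  by (rule measurable_from_subalg[OF subalg])

lemma adapted:
  "xi n \<in> borel_measurable (F n)" "al n \<in> measurable (F n) (count_space UNIV)" "u n \<in> borel_measurable (F n)"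
  using chain by (auto simp: approx_chain_def)

lemmas adapted_M [measurable] = adapted[THEN measurable_F_M]

lemma u_Uset: "\<omega> \<in> space M \<Longrightarrow> u n \<omega> \<in> Uset P" using chain by (simp add: approx_chain_def)

lemma coeffs:
  assumes "\<bar>x\<bar> \<le> B" "i < m0 P" "v \<in> Uset P"
  shows "s0 \<le> sig2 P x i v" "\<bar>drift P x i v\<bar> \<le> b0" "s0 \<le> Dn P h x i v" "Dn P h x i v \<le> D0"
  using bounds assms h0 unfolding coeff_bounds_def by blast+

lemma coeff_signs: "0 < s0" "0 \<le> b0" "0 < D0" "0 \<le> q0" "\<And>i. i < m0 P \<Longrightarrow> 0 \<le> - Q P i i" "\<And>i. i < m0 P \<Longrightarrow> - Q P i i \<le> q0"
  using bounds by (auto simp: coeff_bounds_def)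

lemma generator: "irreducible_generator (m0 P) (Q P)" using MA by (simp add: model_assms_def)

definition succs :: "real \<Rightarrow> nat \<Rightarrow> (real \<times> nat) set" where
  "succs x i = (if x = -(B + h) then {(-B, i)} else if x = B + h then {(B, i)}
     else {(x + h, i), (x - h, i)} \<union> Pair x ` ({..<m0 P} - {i}))"

definition states :: "(real \<times> nat) set" where
  "states = Sgrid B h \<times> {..<m0 P}"

text \<open>\<open>B\<close> is a multiple \<open>b * h\<close> of the mesh, so a grid point other
  than the two extreme ones has an integer index of absolute value at most \<open>b\<close>, and its
  neighbours are grid points again.\<close>

lemma grid_interior:
  assumes "x \<in> Sgrid B h" "x \<noteq> -(B + h)" "x \<noteq> B + h"
  shows "\<bar>x\<bar> \<le> B" "x + h \<in> Sgrid B h" "x - h \<in> Sgrid B h"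
proof -
  obtain k :: int where k: "x = of_int k * h" "\<bar>x\<bar> \<le> B + h" using assms(1) by (auto simp: Sgrid_def)
  obtain b :: nat where b: "B = real b * h" using hH by (auto simp: Hset_def)
  have "\<bar>real_of_int k\<bar> * h \<le> (real b + 1) * h" using k b h0 by (simp add: abs_mult algebra_simps)
  then have "\<bar>real_of_int k\<bar> \<le> real b + 1" using h0 by simp
  then have k1: "\<bar>k\<bar> \<le> int b + 1" by linarith
  have "x = B + h" if "k = int b + 1" using k(1) b that by (simp add: algebra_simps)
  moreover have "x = - (B + h)" if "k = - (int b + 1)" using k(1) b that by (simp add: algebra_simps)
  ultimately have "k \<noteq> int b + 1" "k \<noteq> - (int b + 1)" using assms(2,3) by blast+
  then have k2: "\<bar>k\<bar> \<le> int b" using k1 by linarith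
  then have "\<bar>real_of_int k\<bar> \<le> real b" by linarith
  then have "\<bar>real_of_int k\<bar> * h \<le> real b * h" using h0 by (intro mult_right_mono) auto
  then show x: "\<bar>x\<bar> \<le> B" using k b h0 by (simp add: abs_mult)
  have "x + h = of_int (k + 1) * h" "x - h = of_int (k - 1) * h" using k by (simp_all add: algebra_simps)
  then show "x + h \<in> Sgrid B h" "x - h \<in> Sgrid B h"
    using x h0 unfolding Sgrid_def by (auto intro: exI[of _ "k + 1"] exI[of _ "k - 1"])
qed

lemma B_grid: "B \<in> Sgrid B h" "- B \<in> Sgrid B h"
proof -
  obtain b :: nat where b: "B = real b * h" using hH by (auto simp: Hset_def)
  have "\<exists>k::int. B = of_int k * h" "\<exists>k::int. - B = of_int k * h"
    using b by (auto intro: exI[of _ "int b"] exI[of _ "- int b"])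
  then show "B \<in> Sgrid B h" "- B \<in> Sgrid B h" using B0 h0 by (auto simp: Sgrid_def)
qed

lemma finite_states: "finite states"
proof -
  have "Sgrid B h \<subseteq> (\<lambda>k. of_int k * h) ` {- \<lceil>(B + h) / h\<rceil>..\<lceil>(B + h) / h\<rceil>}"
  proof
    fix x assume "x \<in> Sgrid B h"
    then obtain k :: int where k: "x = of_int k * h" "\<bar>x\<bar> \<le> B + h" by (auto simp: Sgrid_def)
    then have "\<bar>real_of_int k\<bar> \<le> (B + h) / h" using h0 by (simp add: abs_mult le_divide_eq)
    then have "\<bar>k\<bar> \<le> \<lceil>(B + h) / h\<rceil>" by linarith
    then show "x \<in> (\<lambda>k. of_int k * h) ` {- \<lceil>(B + h) / h\<rceil>..\<lceil>(B + h) / h\<rceil>}"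
      using k(1) by (intro image_eqI[of _ _ k]) auto
  qed
  then show ?thesis unfolding states_def by (auto intro: finite_subset)
qed

lemma succs_states: "(x, i) \<in> states \<Longrightarrow> succs x i \<subseteq> states"
  using B_grid grid_interior[of x] by (auto simp: succs_def states_def)

lemma finite_succs: "finite (succs x i)" by (simp add: succs_def)

lemma interior_ne: "\<bar>x\<bar> \<le> B \<Longrightarrow> x \<noteq> -(B + h)" "\<bar>x\<bar> \<le> B \<Longrightarrow> x \<noteq> B + h"
  using h0 by auto

lemma ptrans_jump:
  assumes "\<bar>x\<bar> \<le> B" "i < m0 P" "j < m0 P" "j \<noteq> i"
  shows "ptrans P B h x i v x j = Q P i j * h\<^sup>2 / Dn P h x i v"
  using interior_ne[OF assms(1)] assms by (simp add: ptrans_def Let_def)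

lemma ptrans_move:
  assumes "\<bar>x\<bar> \<le> B"
  shows "ptrans P B h x i v (x + h) i = (sig2 P x i v / 2 + h * max (drift P x i v) 0) / Dn P h x i v"
    "ptrans P B h x i v (x - h) i = (sig2 P x i v / 2 + h * max (- drift P x i v) 0) / Dn P h x i v"
  using interior_ne[OF assms] h0 by (simp_all add: ptrans_def Let_def)

text \<open>The normalization \<open>Dn\<close> is the sum of the numerators: the parts of the drift
  add up to its absolute value, and the off-diagonal rates of row \<open>i\<close> add up to
  \<open>- Q P i i\<close>.\<close>

lemma sum_ptrans:
  assumes s: "(x, i) \<in> states" and v: "v \<in> Uset P"
  shows "(\<Sum>(y, j)\<in>succs x i. ptrans P B h x i v y j) = 1"
proof -
  consider "x = -(B + h)" | "x \<noteq> -(B + h)" "x = B + h" | "x \<noteq> -(B + h)" "x \<noteq> B + h" by blast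
  then show ?thesis
  proof cases
    case 3
    have x: "\<bar>x\<bar> \<le> B" and i: "i < m0 P" using grid_interior(1)[of x] 3 s by (auto simp: states_def)
    let ?D = "Dn P h x i v" and ?s = "sig2 P x i v" and ?b = "drift P x i v"
    have D: "0 < ?D" using coeffs(3)[OF x i v] coeff_signs(1) by linarith
    have "(\<Sum>(y, j)\<in>succs x i. ptrans P B h x i v y j) =
      (\<Sum>(y, j)\<in>{(x + h, i), (x - h, i)}. ptrans P B h x i v y j) + (\<Sum>(y, j)\<in>Pair x ` ({..<m0 P} - {i}). ptrans P B h x i v y j)"
      using 3 h0 by (simp only: succs_def if_False) (intro sum.union_disjoint, auto)
    also have "(\<Sum>(y, j)\<in>{(x + h, i), (x - h, i)}. ptrans P B h x i v y j) =
        (?s / 2 + h * max ?b 0) / ?D + (?s / 2 + h * max (- ?b) 0) / ?D"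
      using h0 ptrans_move[OF x, of i v] by simp
    also have "(\<Sum>(y, j)\<in>Pair x ` ({..<m0 P} - {i}). ptrans P B h x i v y j) = (\<Sum>j\<in>{..<m0 P} - {i}. ptrans P B h x i v x j)"
      by (subst sum.reindex) (auto simp: inj_on_def)
    also have "\<dots> = (\<Sum>j\<in>{..<m0 P} - {i}. Q P i j * h\<^sup>2 / ?D)"
      by (rule sum.cong[OF refl]) (use ptrans_jump[OF x i] in auto)
    also have "\<dots> = (\<Sum>j\<in>{..<m0 P} - {i}. Q P i j) * h\<^sup>2 / ?D"
      by (simp add: sum_divide_distrib sum_distrib_right)
    also have "\<dots> = - Q P i i * h\<^sup>2 / ?D" using generator_diag(1)[OF generator i] by simp
    also have "(?s / 2 + h * max ?b 0) / ?D + (?s / 2 + h * max (- ?b) 0) / ?D + - Q P i i * h\<^sup>2 / ?D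
        = (?s + h * (max ?b 0 + max (- ?b) 0) - h\<^sup>2 * Q P i i) / ?D"
      by (simp add: add_divide_distrib diff_divide_distrib algebra_simps)
    also have "max ?b 0 + max (- ?b) 0 = \<bar>?b\<bar>" by simp
    also have "(?s + h * \<bar>?b\<bar> - h\<^sup>2 * Q P i i) / ?D = 1" using D by (simp add: Dn_def)
    finally show ?thesis .
  qed (use B0 h0 in \<open>simp_all add: succs_def ptrans_def\<close>)
qed

definition here :: "nat \<Rightarrow> real \<times> nat \<Rightarrow> 'a set" where
  "here n s = {\<omega>\<in>space M. xi n \<omega> = fst s \<and> al n \<omega> = snd s}"

lemma here_F: "here n s \<in> sets (F n)"
proof -
  have [measurable]: "xi n \<in> borel_measurable (F n)" "al n \<in> measurable (F n) (count_space UNIV)" by (rule adapted)+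
  have "{\<omega>\<in>space (F n). xi n \<omega> = fst s \<and> al n \<omega> = snd s} \<in> sets (F n)" by measurable
  then show ?thesis by (simp add: here_def space_F)
qed

lemma here_M [measurable]: "here n s \<in> events" by (rule sets_F_M[OF here_F])

lemma cond_exp_here:
  "AE \<omega> in M. real_cond_exp M (F n) (indicator (here (Suc n) s)) \<omega> = ptrans P B h (xi n \<omega>) (al n \<omega>) (u n \<omega>) (fst s) (snd s)"
  using chain by (auto simp: approx_chain_def here_def)

text \<open>The chain is given by conditional probabilities of single targets. On an event of the
  past where the state is frozen at \<open>(x, i)\<close>, integrating them leaves an integral in
  the control variable only, which also settles the measurability of \<open>ptrans\<close>.\<close>

lemma step_prob:
  assumes A: "A \<in> sets (F n)" "A \<subseteq> here n (x, i)"
  shows "integrable M (\<lambda>\<omega>. indicator A \<omega> * ptrans P B h x i (u n \<omega>) y j)"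
    and "prob (A \<inter> here (Suc n) (y, j)) = (\<integral>\<omega>. indicator A \<omega> * ptrans P B h x i (u n \<omega>) y j \<partial>M)"
proof -
  interpret S: sigma_finite_subalgebra M "F n" by (rule sub)
  let ?f = "indicator (here (Suc n) (y, j)) :: 'a \<Rightarrow> real"
  have AM: "A \<in> events" using A(1) by (rule sets_F_M)
  have fi: "integrable M ?f" by (rule integrable_real_indicator) (auto simp: emeasure_eq_measure)
  have ci: "integrable M (\<lambda>\<omega>. indicator A \<omega> * real_cond_exp M (F n) ?f \<omega>)"
    by (rule integrable_real_mult_indicator[OF AM S.real_cond_exp_int(1)[OF fi], unfolded mult.commute[of _ "indicator A _"]])
  have ae: "AE \<omega> in M. indicator A \<omega> * real_cond_exp M (F n) ?f \<omega> = indicator A \<omega> * ptrans P B h x i (u n \<omega>) y j"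
    using cond_exp_here[of n "(y, j)"]
  proof eventually_elim
    case (elim \<omega>)
    show ?case
    proof (cases "\<omega> \<in> A")
      case True
      then have "xi n \<omega> = x" "al n \<omega> = i" using A(2) by (auto simp: here_def)
      then show ?thesis using elim by simp
    qed simp
  qed
  have m: "(\<lambda>\<omega>. indicator A \<omega> * ptrans P B h x i (u n \<omega>) y j) \<in> borel_measurable M"
  proof -
    have mc: "(\<lambda>\<omega>. f x i (u n \<omega>)) \<in> borel_measurable M" if "continuous_on UNIV (\<lambda>z. f (fst z) i (snd z))" for f :: "real \<Rightarrow> nat \<Rightarrow> ctrl \<Rightarrow> real"
      using measurable_compose[OF borel_measurable_Pair[OF measurable_const adapted_M(3)] borel_measurable_continuous_onI[OF that], of x n] by simp
    have [measurable]: "(\<lambda>\<omega>. drift P x i (u n \<omega>)) \<in> borel_measurable M" "(\<lambda>\<omega>. sig2 P x i (u n \<omega>)) \<in> borel_measurable M"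
      by (rule mc[OF continuous_drift], rule mc[OF continuous_sig2])
    show ?thesis unfolding ptrans_def Let_def Dn_def using AM by measurable
  qed
  show "integrable M (\<lambda>\<omega>. indicator A \<omega> * ptrans P B h x i (u n \<omega>) y j)"
    using integrable_cong_AE[OF _ m ae] ci borel_measurable_integrable[OF ci] by simp
  have "prob (A \<inter> here (Suc n) (y, j)) = (\<integral>\<omega>\<in>A. ?f \<omega> \<partial>M)"
    unfolding set_lebesgue_integral_def using AM by (simp add: indicator_inter_arith[symmetric])
  also have "\<dots> = (\<integral>\<omega>\<in>A. real_cond_exp M (F n) ?f \<omega> \<partial>M)" by (rule S.real_cond_exp_intA[OF fi A(1)])
  also have "\<dots> = (\<integral>\<omega>. indicator A \<omega> * ptrans P B h x i (u n \<omega>) y j \<partial>M)"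
    unfolding set_lebesgue_integral_def real_scaleR_def
    by (rule integral_cong_AE[OF borel_measurable_integrable[OF ci] m ae])
  finally show "prob (A \<inter> here (Suc n) (y, j)) = (\<integral>\<omega>. indicator A \<omega> * ptrans P B h x i (u n \<omega>) y j \<partial>M)" .
qed

text \<open>Nothing is prescribed about the support of a step directly. But the finitely many
  successors already carry total conditional probability one, so all other outcomes form a null
  event.\<close>

lemma AE_step_at:
  assumes s: "(x, i) \<in> states"
  shows "AE \<omega> in M. \<omega> \<in> here n (x, i) \<longrightarrow> (xi (Suc n) \<omega>, al (Suc n) \<omega>) \<in> succs x i"
proof -
  let ?A = "here n (x, i)"
  note st = step_prob[OF here_F order_refl, of n x i]
  define E where "E = (\<Union>s\<in>succs x i. ?A \<inter> here (Suc n) s)"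
  have Em: "E \<in> events" unfolding E_def using finite_succs by (intro sets.finite_UN) auto
  have "prob E = (\<Sum>s\<in>succs x i. prob (?A \<inter> here (Suc n) s))"
    unfolding E_def by (rule finite_measure_finite_Union[OF finite_succs]) (auto simp: disjoint_family_on_def here_def prod_eq_iff)
  also have "\<dots> = (\<Sum>(y, j)\<in>succs x i. \<integral>\<omega>. indicator ?A \<omega> * ptrans P B h x i (u n \<omega>) y j \<partial>M)"
    by (rule sum.cong) (auto simp: st(2))
  also have "\<dots> = (\<integral>\<omega>. (\<Sum>(y, j)\<in>succs x i. indicator ?A \<omega> * ptrans P B h x i (u n \<omega>) y j) \<partial>M)"
    unfolding case_prod_beta by (rule Bochner_Integration.integral_sum[symmetric]) (rule st(1))
  also have "\<dots> = (\<integral>\<omega>. indicator ?A \<omega> \<partial>M)"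
  proof (rule Bochner_Integration.integral_cong[OF refl])
    fix \<omega> assume "\<omega> \<in> space M"
    then have "(\<Sum>(y, j)\<in>succs x i. ptrans P B h x i (u n \<omega>) y j) = 1" by (intro sum_ptrans[OF s] u_Uset)
    then show "(\<Sum>(y, j)\<in>succs x i. indicator ?A \<omega> * ptrans P B h x i (u n \<omega>) y j) = indicator ?A \<omega>"
      by (simp add: case_prod_beta sum_distrib_left[symmetric])
  qed
  also have "\<dots> = prob ?A" by simp
  finally have "prob (?A - E) = 0"
    using Em by (subst finite_measure_Diff) (auto simp: E_def)
  then have "AE \<omega> in M. \<omega> \<notin> ?A - E"
    using Em by (intro AE_not_in) (auto simp: null_sets_def emeasure_eq_measure)
  then show ?thesis by (rule eventually_mono) (auto simp: E_def here_def)
qed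

lemma AE_states: "AE \<omega> in M. (xi n \<omega>, al n \<omega>) \<in> states"
  and AE_succs: "AE \<omega> in M. (xi (Suc n) \<omega>, al (Suc n) \<omega>) \<in> succs (xi n \<omega>) (al n \<omega>)"
proof -
  have all: "AE \<omega> in M. \<forall>s\<in>states. \<omega> \<in> here n s \<longrightarrow> (xi (Suc n) \<omega>, al (Suc n) \<omega>) \<in> succs (fst s) (snd s)" for n
    by (rule AE_finite_allI[OF finite_states]) (use AE_step_at in auto)
  have *: "AE \<omega> in M. (xi (Suc n) \<omega>, al (Suc n) \<omega>) \<in> succs (xi n \<omega>) (al n \<omega>)"
    if "AE \<omega> in M. (xi n \<omega>, al n \<omega>) \<in> states" for n
    using that all[of n] AE_space by eventually_elim (auto simp: here_def)
  have st: "AE \<omega> in M. (xi n \<omega>, al n \<omega>) \<in> states" for n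
  proof (induction n)
    case 0
    show ?case using chain by (intro AE_I2) (auto simp: approx_chain_def states_def)
  next
    case (Suc n)
    from Suc *[OF Suc] show ?case by eventually_elim (use succs_states in blast)
  qed
  show "AE \<omega> in M. (xi n \<omega>, al n \<omega>) \<in> states" by (rule st)
  show "AE \<omega> in M. (xi (Suc n) \<omega>, al (Suc n) \<omega>) \<in> succs (xi n \<omega>) (al n \<omega>)" by (rule *[OF st])
qed

definition mean_inc :: "nat \<Rightarrow> 'a \<Rightarrow> real" where
  "mean_inc k = real_cond_exp M (F k) (\<lambda>\<omega>. xi (Suc k) \<omega> - xi k \<omega>)"

lemma succs_dist:
  assumes "(y, j) \<in> succs x i" shows "\<bar>y - x\<bar> \<le> h"
  using assms h0 by (auto simp: succs_def split: if_splits)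

lemma AE_inc: "AE \<omega> in M. \<bar>xi (Suc n) \<omega> - xi n \<omega>\<bar> \<le> h"
  using AE_succs[of n] by eventually_elim (rule succs_dist)

lemma integrable_inc: "integrable M (\<lambda>\<omega>. xi (Suc n) \<omega> - xi n \<omega>)"
  using AE_inc[of n] by (intro bounded_integrable) auto

text \<open>At a regular state the increment is almost surely \<open>h\<close> times the indicator
  of the move up minus that of the move down. Its conditional mean is therefore the drift times
  \<open>h\<^sup>2 / Dn\<close>, that is, times the interpolation interval.\<close>

lemma mean_inc_at:
  assumes s: "(x, i) \<in> states" and x: "\<bar>x\<bar> \<le> B"
  shows "AE \<omega> in M. \<omega> \<in> here n (x, i) \<longrightarrow> \<bar>mean_inc n \<omega>\<bar> \<le> b0 * (h\<^sup>2 / Dn P h x i (u n \<omega>))"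
proof -
  interpret S: sigma_finite_subalgebra M "F n" by (rule sub)
  let ?A = "indicator (here n (x, i)) :: 'a \<Rightarrow> real"
  let ?p = "indicator (here (Suc n) (x + h, i)) :: 'a \<Rightarrow> real" and ?m = "indicator (here (Suc n) (x - h, i)) :: 'a \<Rightarrow> real"
  let ?X = "\<lambda>\<omega>. h * ?p \<omega> - h * ?m \<omega>"
  let ?d = "\<lambda>\<omega>. xi (Suc n) \<omega> - xi n \<omega>"
  have i: "i < m0 P" using s by (simp add: states_def)
  have pi: "integrable M ?p" "integrable M ?m" by (auto simp: emeasure_eq_measure)
  have hp: "integrable M (\<lambda>\<omega>. h * ?p \<omega>)" "integrable M (\<lambda>\<omega>. h * ?m \<omega>)" using pi by auto
  have Xi: "integrable M ?X" using hp by auto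
  have AF: "?A \<in> borel_measurable (F n)" using here_F by (rule borel_measurable_indicator)
  have AX: "integrable M (\<lambda>\<omega>. ?A \<omega> * ?X \<omega>)" "integrable M (\<lambda>\<omega>. ?A \<omega> * ?d \<omega>)"
    using integrable_real_mult_indicator[OF here_M[of n "(x, i)"] Xi]
      integrable_real_mult_indicator[OF here_M[of n "(x, i)"] integrable_inc[of n]]
    by (simp_all add: mult.commute)
  have "AE \<omega> in M. ?A \<omega> * ?d \<omega> = ?A \<omega> * ?X \<omega>"
    using AE_step_at[OF s, of n] AE_space
  proof eventually_elim
    case (elim \<omega>)
    show ?case
    proof (cases "\<omega> \<in> here n (x, i)")
      case True
      with elim have "(xi (Suc n) \<omega>, al (Suc n) \<omega>) \<in> succs x i" "xi n \<omega> = x" by (auto simp: here_def)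
      then show ?thesis using interior_ne[OF x] elim(2) h0 by (auto simp: succs_def here_def indicator_def)
    qed simp
  qed
  then have 1: "AE \<omega> in M. real_cond_exp M (F n) (\<lambda>\<omega>. ?A \<omega> * ?d \<omega>) \<omega> = real_cond_exp M (F n) (\<lambda>\<omega>. ?A \<omega> * ?X \<omega>) \<omega>"
    using AX by (intro S.real_cond_exp_cong) auto
  have 2: "AE \<omega> in M. real_cond_exp M (F n) (\<lambda>\<omega>. ?A \<omega> * ?d \<omega>) \<omega> = ?A \<omega> * mean_inc n \<omega>"
    unfolding mean_inc_def by (rule S.real_cond_exp_mult[OF AF _ AX(2)]) measurable
  have 3: "AE \<omega> in M. real_cond_exp M (F n) (\<lambda>\<omega>. ?A \<omega> * ?X \<omega>) \<omega> = ?A \<omega> * real_cond_exp M (F n) ?X \<omega>"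
    by (rule S.real_cond_exp_mult[OF AF _ AX(1)]) measurable
  have 4: "AE \<omega> in M. real_cond_exp M (F n) ?X \<omega> = real_cond_exp M (F n) (\<lambda>\<omega>. h * ?p \<omega>) \<omega> - real_cond_exp M (F n) (\<lambda>\<omega>. h * ?m \<omega>) \<omega>"
    by (rule S.real_cond_exp_diff[OF hp])
  have 5: "AE \<omega> in M. real_cond_exp M (F n) (\<lambda>\<omega>. h * ?p \<omega>) \<omega> = h * real_cond_exp M (F n) ?p \<omega>"
    "AE \<omega> in M. real_cond_exp M (F n) (\<lambda>\<omega>. h * ?m \<omega>) \<omega> = h * real_cond_exp M (F n) ?m \<omega>"
    by (rule S.real_cond_exp_cmult[OF pi(1)], rule S.real_cond_exp_cmult[OF pi(2)])
  show ?thesis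
    using 1 2 3 4 5 cond_exp_here[of n "(x + h, i)"] cond_exp_here[of n "(x - h, i)"] AE_space
  proof (eventually_elim, intro impI)
    fix \<omega>
    assume e: "real_cond_exp M (F n) (\<lambda>\<omega>. ?A \<omega> * ?d \<omega>) \<omega> = real_cond_exp M (F n) (\<lambda>\<omega>. ?A \<omega> * ?X \<omega>) \<omega>"
      "real_cond_exp M (F n) (\<lambda>\<omega>. ?A \<omega> * ?d \<omega>) \<omega> = ?A \<omega> * mean_inc n \<omega>"
      "real_cond_exp M (F n) (\<lambda>\<omega>. ?A \<omega> * ?X \<omega>) \<omega> = ?A \<omega> * real_cond_exp M (F n) ?X \<omega>"
      "real_cond_exp M (F n) ?X \<omega> = real_cond_exp M (F n) (\<lambda>\<omega>. h * ?p \<omega>) \<omega> - real_cond_exp M (F n) (\<lambda>\<omega>. h * ?m \<omega>) \<omega>"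
      "real_cond_exp M (F n) (\<lambda>\<omega>. h * ?p \<omega>) \<omega> = h * real_cond_exp M (F n) ?p \<omega>"
      "real_cond_exp M (F n) (\<lambda>\<omega>. h * ?m \<omega>) \<omega> = h * real_cond_exp M (F n) ?m \<omega>"
      "real_cond_exp M (F n) ?p \<omega> = ptrans P B h (xi n \<omega>) (al n \<omega>) (u n \<omega>) (fst (x + h, i)) (snd (x + h, i))"
      "real_cond_exp M (F n) ?m \<omega> = ptrans P B h (xi n \<omega>) (al n \<omega>) (u n \<omega>) (fst (x - h, i)) (snd (x - h, i))"
      and \<omega>: "\<omega> \<in> space M" "\<omega> \<in> here n (x, i)"
    let ?D = "Dn P h x i (u n \<omega>)" and ?b = "drift P x i (u n \<omega>)"
    note c = coeffs[OF x i u_Uset[OF \<omega>(1), of n]]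
    have D: "0 < ?D" using c(3) coeff_signs(1) by linarith
    have st: "xi n \<omega> = x" "al n \<omega> = i" using \<omega>(2) by (auto simp: here_def)
    have "mean_inc n \<omega> = h * ptrans P B h x i (u n \<omega>) (x + h) i - h * ptrans P B h x i (u n \<omega>) (x - h) i"
      using e \<omega>(2) st by simp
    also have "\<dots> = (h\<^sup>2 / ?D) * (max ?b 0 - max (- ?b) 0)"
      unfolding ptrans_move[OF x] using D by (simp add: field_simps power2_eq_square)
    also have "max ?b 0 - max (- ?b) 0 = ?b" by simp
    finally have "\<bar>mean_inc n \<omega>\<bar> = (h\<^sup>2 / ?D) * \<bar>?b\<bar>" using D by (simp add: abs_mult)
    also have "\<dots> \<le> (h\<^sup>2 / ?D) * b0" using c(2) D by (intro mult_left_mono) auto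
    finally show "\<bar>mean_inc n \<omega>\<bar> \<le> b0 * (h\<^sup>2 / ?D)" by (simp add: mult.commute)
  qed
qed

lemma AE_mean_inc:
  "AE \<omega> in M. xi n \<omega> \<noteq> -(B + h) \<and> xi n \<omega> \<noteq> B + h \<longrightarrow>
     \<bar>mean_inc n \<omega>\<bar> \<le> b0 * (h\<^sup>2 / Dn P h (xi n \<omega>) (al n \<omega>) (u n \<omega>))"
proof -
  have "AE \<omega> in M. \<forall>s\<in>states. \<bar>fst s\<bar> \<le> B \<longrightarrow> \<omega> \<in> here n s \<longrightarrow>
     \<bar>mean_inc n \<omega>\<bar> \<le> b0 * (h\<^sup>2 / Dn P h (fst s) (snd s) (u n \<omega>))"
    by (rule AE_finite_allI[OF finite_states]) (use mean_inc_at in \<open>auto split: prod.split simp: case_prod_beta\<close>)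
  with AE_states[of n] AE_space show ?thesis
  proof eventually_elim
    case (elim \<omega>)
    show ?case
    proof
      assume ne: "xi n \<omega> \<noteq> -(B + h) \<and> xi n \<omega> \<noteq> B + h"
      then have "\<bar>xi n \<omega>\<bar> \<le> B" using grid_interior(1)[of "xi n \<omega>"] elim(1) by (simp add: states_def)
      moreover have "\<omega> \<in> here n (xi n \<omega>, al n \<omega>)" using elim(2) by (simp add: here_def)
      ultimately show "\<bar>mean_inc n \<omega>\<bar> \<le> b0 * (h\<^sup>2 / Dn P h (xi n \<omega>) (al n \<omega>) (u n \<omega>))"
        using elim(1,3) by fastforce
    qed
  qed
qed

section \<open>Probability of a regime jump\<close>

definition jump :: "nat \<Rightarrow> 'a set" where
  "jump n = {\<omega>\<in>space M. al (Suc n) \<omega> \<noteq> al n \<omega>}"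

lemma jump_F: "jump n \<in> sets (F (Suc n))"
proof -
  have a: "al n \<in> measurable (F (Suc n)) (count_space UNIV)"
    by (rule measurable_F_mono[OF adapted(2)]) simp
  have [measurable]: "(\<lambda>\<omega>. real (al (Suc n) \<omega>)) \<in> borel_measurable (F (Suc n))"
    by (rule measurable_compose[OF adapted(2)]) simp
  have [measurable]: "(\<lambda>\<omega>. real (al n \<omega>)) \<in> borel_measurable (F (Suc n))"
    by (rule measurable_compose[OF a]) simp
  have "{\<omega>\<in>space (F (Suc n)). real (al (Suc n) \<omega>) \<noteq> real (al n \<omega>)} \<in> sets (F (Suc n))" by measurable
  then show ?thesis by (simp add: jump_def space_F)
qed

lemma jump_M [measurable]: "jump n \<in> events" by (rule sets_F_M[OF jump_F])

text \<open>At a regular state the rates out of regime \<open>i\<close> add up to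
  \<open>- Q P i i \<le> q0\<close> and the denominator is at least \<open>s0\<close>; at a
  reflecting state the regime stays put.\<close>

lemma prob_jump_at:
  assumes s: "(x, i) \<in> states" and A: "A \<in> sets (F n)" "A \<subseteq> here n (x, i)"
  shows "prob (A \<inter> jump n) \<le> q0 / s0 * h\<^sup>2 * prob A"
proof -
  have AM [measurable]: "A \<in> events" using A(1) by (rule sets_F_M)
  have i: "i < m0 P" using s by (simp add: states_def)
  let ?T = "succs x i \<inter> {s. snd s \<noteq> i}"
  have fT: "finite ?T" using finite_succs by simp
  have "prob (A \<inter> jump n) \<le> prob (\<Union>s\<in>?T. A \<inter> here (Suc n) s)"
  proof (rule finite_measure_mono_AE)
    show "AE \<omega> in M. \<omega> \<in> A \<inter> jump n \<longrightarrow> \<omega> \<in> (\<Union>s\<in>?T. A \<inter> here (Suc n) s)"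
      using AE_step_at[OF s, of n]
    proof (eventually_elim, intro impI)
      fix \<omega> assume e: "\<omega> \<in> here n (x, i) \<longrightarrow> (xi (Suc n) \<omega>, al (Suc n) \<omega>) \<in> succs x i" and \<omega>: "\<omega> \<in> A \<inter> jump n"
      then have "(xi (Suc n) \<omega>, al (Suc n) \<omega>) \<in> ?T" "\<omega> \<in> here (Suc n) (xi (Suc n) \<omega>, al (Suc n) \<omega>)"
        using A(2) by (auto simp: jump_def here_def)
      then show "\<omega> \<in> (\<Union>s\<in>?T. A \<inter> here (Suc n) s)" using \<omega> by blast
    qed
    show "(\<Union>s\<in>?T. A \<inter> here (Suc n) s) \<in> events" using fT by (intro sets.finite_UN) auto
  qed
  also have "\<dots> \<le> (\<Sum>s\<in>?T. prob (A \<inter> here (Suc n) s))"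
    by (rule finite_measure_subadditive_finite[OF fT]) auto
  also have "\<dots> \<le> q0 / s0 * h\<^sup>2 * prob A"
  proof (cases "x = -(B + h) \<or> x = B + h")
    case True
    then have "?T = {}" by (auto simp: succs_def)
    then have "(\<Sum>s\<in>?T. prob (A \<inter> here (Suc n) s)) = 0" by (simp only: sum.empty)
    then show ?thesis using coeff_signs by simp
  next
    case False
    then have x: "\<bar>x\<bar> \<le> B" using grid_interior(1)[of x] s by (auto simp: states_def)
    have T: "?T = Pair x ` ({..<m0 P} - {i})" using False by (auto simp: succs_def)
    have "(\<Sum>s\<in>?T. prob (A \<inter> here (Suc n) s)) = (\<Sum>j\<in>{..<m0 P} - {i}. prob (A \<inter> here (Suc n) (x, j)))"
      unfolding T by (subst sum.reindex) (auto simp: inj_on_def)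
    also have "\<dots> = (\<Sum>j\<in>{..<m0 P} - {i}. \<integral>\<omega>. indicator A \<omega> * ptrans P B h x i (u n \<omega>) x j \<partial>M)"
      by (rule sum.cong[OF refl], rule step_prob(2)[OF A])
    also have "\<dots> = (\<integral>\<omega>. (\<Sum>j\<in>{..<m0 P} - {i}. indicator A \<omega> * ptrans P B h x i (u n \<omega>) x j) \<partial>M)"
      by (rule Bochner_Integration.integral_sum[symmetric]) (rule step_prob(1)[OF A])
    also have "\<dots> \<le> (\<integral>\<omega>. q0 / s0 * h\<^sup>2 * indicator A \<omega> \<partial>M)"
    proof (rule integral_mono)
      show "integrable M (\<lambda>\<omega>. \<Sum>j\<in>{..<m0 P} - {i}. indicator A \<omega> * ptrans P B h x i (u n \<omega>) x j)"
        by (rule Bochner_Integration.integrable_sum) (rule step_prob(1)[OF A])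
      show "integrable M (\<lambda>\<omega>. q0 / s0 * h\<^sup>2 * indicator A \<omega>)"
        by (intro integrable_mult_right integrable_real_indicator AM) (simp add: emeasure_eq_measure)
      fix \<omega> assume \<omega>: "\<omega> \<in> space M"
      let ?D = "Dn P h x i (u n \<omega>)"
      have D: "s0 \<le> ?D" by (rule coeffs(3)[OF x i u_Uset[OF \<omega>]])
      have "(\<Sum>j\<in>{..<m0 P} - {i}. indicator A \<omega> * ptrans P B h x i (u n \<omega>) x j) = indicator A \<omega> * (\<Sum>j\<in>{..<m0 P} - {i}. Q P i j * h\<^sup>2 / ?D)"
        unfolding sum_distrib_left by (rule sum.cong[OF refl]) (use ptrans_jump[OF x i] in auto)
      also have "(\<Sum>j\<in>{..<m0 P} - {i}. Q P i j * h\<^sup>2 / ?D) = (\<Sum>j\<in>{..<m0 P} - {i}. Q P i j) * h\<^sup>2 / ?D"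
        by (simp add: sum_divide_distrib sum_distrib_right)
      also have "\<dots> = - Q P i i * h\<^sup>2 / ?D" using generator_diag(1)[OF generator i] by simp
      also have "indicator A \<omega> * (- Q P i i * h\<^sup>2 / ?D) \<le> indicator A \<omega> * (q0 * h\<^sup>2 / s0)"
        using coeff_signs(1,4) coeff_signs(5,6)[OF i] D by (intro mult_left_mono frac_le mult_right_mono mult_nonneg_nonneg) auto
      finally show "(\<Sum>j\<in>{..<m0 P} - {i}. indicator A \<omega> * ptrans P B h x i (u n \<omega>) x j) \<le> q0 / s0 * h\<^sup>2 * indicator A \<omega>"
        by (simp add: mult.commute)
    qed
    also have "\<dots> = q0 / s0 * h\<^sup>2 * prob A" by simp
    finally show ?thesis .
  qed
  finally show ?thesis .
qed

text \<open>The event is split along the finitely many current states. Stating it for every event of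
  the past allows two jumps to be estimated by conditioning.\<close>

lemma prob_jump:
  assumes A: "A \<in> sets (F n)"
  shows "prob (A \<inter> jump n) \<le> q0 / s0 * h\<^sup>2 * prob A"
proof -
  have AM [measurable]: "A \<in> events" using A(1) by (rule sets_F_M)
  have "prob (A \<inter> jump n) \<le> prob (\<Union>s\<in>states. (A \<inter> here n s) \<inter> jump n)"
  proof (rule finite_measure_mono_AE)
    show "AE \<omega> in M. \<omega> \<in> A \<inter> jump n \<longrightarrow> \<omega> \<in> (\<Union>s\<in>states. (A \<inter> here n s) \<inter> jump n)"
      using AE_states[of n] AE_space
    proof (eventually_elim, intro impI)
      fix \<omega> assume "(xi n \<omega>, al n \<omega>) \<in> states" "\<omega> \<in> space M" "\<omega> \<in> A \<inter> jump n"
      then show "\<omega> \<in> (\<Union>s\<in>states. (A \<inter> here n s) \<inter> jump n)"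
        by (intro UN_I[of "(xi n \<omega>, al n \<omega>)"]) (auto simp: here_def)
    qed
    show "(\<Union>s\<in>states. (A \<inter> here n s) \<inter> jump n) \<in> events" using finite_states by (intro sets.finite_UN) auto
  qed
  also have "\<dots> \<le> (\<Sum>s\<in>states. prob ((A \<inter> here n s) \<inter> jump n))"
    by (rule finite_measure_subadditive_finite[OF finite_states]) auto
  also have "\<dots> \<le> (\<Sum>s\<in>states. q0 / s0 * h\<^sup>2 * prob (A \<inter> here n s))"
  proof (rule sum_mono)
    fix s assume s: "s \<in> states"
    show "prob ((A \<inter> here n s) \<inter> jump n) \<le> q0 / s0 * h\<^sup>2 * prob (A \<inter> here n s)"
      using prob_jump_at[of "fst s" "snd s" "A \<inter> here n s" n] s A here_F[of n s] by auto
  qed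
  also have "\<dots> = q0 / s0 * h\<^sup>2 * (\<Sum>s\<in>states. prob (A \<inter> here n s))" by (simp add: sum_distrib_left)
  also have "(\<Sum>s\<in>states. prob (A \<inter> here n s)) = prob (\<Union>s\<in>states. A \<inter> here n s)"
    by (rule finite_measure_finite_Union[OF finite_states, symmetric]) (auto simp: disjoint_family_on_def here_def prod_eq_iff)
  also have "q0 / s0 * h\<^sup>2 * \<dots> \<le> q0 / s0 * h\<^sup>2 * prob A"
    using coeff_signs by (intro mult_left_mono finite_measure_mono) auto
  finally show ?thesis .
qed

end

section \<open>Rescaled paths and regime jumps\<close>

text \<open>One step is enough, since a reflection is always followed by a regular step.\<close>

definition next_regular :: "real \<Rightarrow> real \<Rightarrow> (nat \<Rightarrow> real) \<Rightarrow> nat \<Rightarrow> nat" where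
  "next_regular B h xs n = (if Iidx B h xs n = 0 then n else Suc n)"

text \<open>Everything the pathwise arguments require of a single trajectory. The conditions
  \<open>\<kappa> * h\<^sup>2 \<le> h\<close> and \<open>1 \<le> G\<close> make the bounds for
  regular steps hold for reflection steps as well, which last \<open>h\<close>.\<close>

locale chain_path =
  fixes P :: model and B h \<kappa> G :: real and xs :: "nat \<Rightarrow> real" and as :: "nat \<Rightarrow> nat" and us :: "nat \<Rightarrow> ctrl"
  assumes h: "0 < h" and \<kappa>: "0 < \<kappa>" "\<kappa> * h\<^sup>2 \<le> h" and G: "1 \<le> G"
    and refl: "\<And>n. Iidx B h xs n \<noteq> 0 \<Longrightarrow> Iidx B h xs (Suc n) = 0"
    and dt: "\<And>n. Iidx B h xs n = 0 \<Longrightarrow> \<kappa> * h\<^sup>2 \<le> dtn P B h xs as us n \<and> dtn P B h xs as us n \<le> G * h"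
begin

abbreviation "\<tau> \<equiv> tthat P B h xs as us"
abbreviation "I \<equiv> Iidx B h xs"
abbreviation "nr \<equiv> next_regular B h xs"

lemma kpos: "0 < \<kappa> * h\<^sup>2" using h \<kappa> by simp

lemma dthat_bounds: "\<kappa> * h\<^sup>2 \<le> dthat P B h xs as us n" "dthat P B h xs as us n \<le> G * h"
proof -
  have "1 * h \<le> G * h" using G h by (intro mult_right_mono) auto
  then show "\<kappa> * h\<^sup>2 \<le> dthat P B h xs as us n" "dthat P B h xs as us n \<le> G * h"
    using dt[of n] \<kappa> by (auto simp: dthat_def)
qed

lemma dthat_nonneg: "0 \<le> dthat P B h xs as us n"
  using dthat_bounds(1)[of n] kpos by linarith

lemma tau_Suc: "\<tau> (Suc n) = \<tau> n + dthat P B h xs as us n" by (simp add: tthat_def)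

lemma tau_0: "\<tau> 0 = 0" by (simp add: tthat_def)

lemma tau_growth: "\<kappa> * (real n * h\<^sup>2) \<le> \<tau> n"
proof (induction n)
  case (Suc n) then show ?case using dthat_bounds(1)[of n] by (simp add: tau_Suc algebra_simps)
qed (simp add: tau_0)

lemma tau_diff: "m \<le> n \<Longrightarrow> \<tau> n - \<tau> m = (\<Sum>k\<in>{m..<n}. dthat P B h xs as us k)"
  unfolding tthat_def by (simp add: lessThan_atLeast0 sum_diff_nat_ivl)

lemma tau_diff_growth: "m \<le> n \<Longrightarrow> \<kappa> * (real (n - m) * h\<^sup>2) \<le> \<tau> n - \<tau> m"
proof -
  assume mn: "m \<le> n"
  have "(\<Sum>k\<in>{m..<n}. \<kappa> * h\<^sup>2) \<le> (\<Sum>k\<in>{m..<n}. dthat P B h xs as us k)"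
    by (intro sum_mono dthat_bounds)
  then show ?thesis using mn by (simp add: tau_diff algebra_simps)
qed

lemma strict_mono_tau: "strict_mono \<tau>"
  unfolding strict_mono_Suc_iff
proof
  fix n show "\<tau> n < \<tau> (Suc n)" using dthat_bounds(1)[of n] kpos by (simp add: tau_Suc)
qed

lemma clock_tau: "clock \<tau>"
proof -
  have "\<exists>n. x < \<tau> n" for x
  proof -
    obtain n :: nat where "x / (\<kappa> * h\<^sup>2) < real n" using reals_Archimedean2 by blast
    then have "x < \<kappa> * (real n * h\<^sup>2)" using kpos by (simp add: divide_less_eq algebra_simps)
    then show ?thesis using tau_growth[of n] by (intro exI[of _ n]) simp
  qed
  then show ?thesis using strict_mono_tau tau_0 by (simp add: clock_def)
qed

lemma nr_regular: "I (nr n) = 0" using refl[of n] by (auto simp: next_regular_def)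

lemma dtn_nonneg: "0 \<le> dtn P B h xs as us n"
  using dt[of n] kpos by (auto simp: dtn_def split: if_splits)

lemma ttn_mono: "m \<le> n \<Longrightarrow> ttn P B h xs as us m \<le> ttn P B h xs as us n"
  unfolding ttn_def by (rule sum_mono2) (auto simp: dtn_nonneg)

text \<open>Reflection steps take no time, so at time \<open>ttn n\<close> the interpolation has already left a
  reflecting state.\<close>
lemma nh_ttn: "nh P B h xs as us (ttn P B h xs as us n) = nr n"
  unfolding nh_def
proof (rule Greatest_equality)
  have e: "ttn P B h xs as us (nr n) = ttn P B h xs as us n"
    by (simp add: next_regular_def ttn_def dtn_def)
  then show "ttn P B h xs as us (nr n) \<le> ttn P B h xs as us n" by simp
  fix m assume m: "ttn P B h xs as us m \<le> ttn P B h xs as us n"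
  show "m \<le> nr n"
  proof (rule ccontr)
    assume "\<not> m \<le> nr n"
    then have "ttn P B h xs as us (Suc (nr n)) \<le> ttn P B h xs as us m" by (intro ttn_mono) simp
    moreover have "ttn P B h xs as us (Suc (nr n)) = ttn P B h xs as us (nr n) + dtn P B h xs as us (nr n)"
      by (simp add: ttn_def)
    ultimately show False using m e dt[OF nr_regular[of n]] kpos by linarith
  qed
qed

text \<open>The hat time at a given instant is some \<open>ttn n\<close>, so by
  \<open>nh_ttn\<close> the two successive time changes collapse into the index shift
  \<open>nr\<close>.\<close>

lemma rescaled_path:
  "\<psi> (nh P B h xs as us (That P B h xs as us (max 0 t))) = stepf \<tau> (\<lambda>n. \<psi> (nr n)) t"
  by (simp add: That_def nh_ttn stepf_def)

lemma That_path: "That P B h xs as us (max 0 t) = stepf \<tau> (ttn P B h xs as us) t"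
  by (simp add: That_def stepf_def)

text \<open>The common shape of the component estimates: a Lipschitz part in rescaled time, an error
  of order \<open>h\<close>, and a Hoelder part in index time. Since \<open>n - m\<close> steps last
  at least \<open>\<kappa> * (n - m) * h\<^sup>2\<close>, index time is converted into rescaled time
  at the price of the factor \<open>rho8 (1 / \<kappa>)\<close>.\<close>

lemma step_codesI:
  assumes ab: "0 \<le> a" "0 \<le> b" and H: "\<And>N. 0 \<le> H N" and C: "\<bar>v 0\<bar> \<le> C"
    and v: "\<And>N m n. m \<le> n \<Longrightarrow> real n * h\<^sup>2 \<le> real N \<Longrightarrow> real m * h\<^sup>2 \<le> real N \<Longrightarrow>
      \<bar>v n - v m\<bar> \<le> a * (\<tau> n - \<tau> m) + b * h + H N * rho8 (\<bar>real n - real m\<bar> * h\<^sup>2)"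
  shows "(\<tau>, v) \<in> step_codes \<kappa> G C (\<lambda>N. a + b + H N * rho8 (1 / \<kappa>)) h"
proof -
  have *: "\<bar>v n - v m\<bar> \<le> (a + b + H N * rho8 (1 / \<kappa>)) * omega (\<bar>\<tau> n - \<tau> m\<bar> + h)"
    if mn: "m \<le> n" and N: "real n * h\<^sup>2 \<le> real N" "real m * h\<^sup>2 \<le> real N" for N m n
  proof -
    define r where "r = \<tau> n - \<tau> m"
    have r: "\<kappa> * (real (n - m) * h\<^sup>2) \<le> r" using tau_diff_growth[OF mn] by (simp add: r_def)
    moreover have "0 \<le> \<kappa> * (real (n - m) * h\<^sup>2)" using \<kappa> by simp
    ultimately have r0: "0 \<le> r" by linarith
    have o: "r \<le> omega (r + h)" "h \<le> omega (r + h)" "rho8 r \<le> omega (r + h)"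
    proof -
      have "0 \<le> rho8 (r + h)" using r0 h by (simp add: rho8_nonneg)
      then show "r \<le> omega (r + h)" "h \<le> omega (r + h)" using r0 h unfolding omega_def by linarith+
      have "rho8 r \<le> rho8 (r + h)" using h by (intro rho8_mono) simp
      then show "rho8 r \<le> omega (r + h)" using r0 h unfolding omega_def by linarith
    qed
    have "\<bar>real n - real m\<bar> * h\<^sup>2 \<le> 1 / \<kappa> * r"
      using r mn \<kappa> by (simp add: le_divide_eq of_nat_diff mult.commute)
    then have "rho8 (\<bar>real n - real m\<bar> * h\<^sup>2) \<le> rho8 (1 / \<kappa>) * rho8 r" unfolding rho8_mult[symmetric] by (rule rho8_mono)
    also have "\<dots> \<le> rho8 (1 / \<kappa>) * omega (r + h)" using o \<kappa> by (intro mult_left_mono rho8_nonneg) auto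
    finally have "H N * rho8 (\<bar>real n - real m\<bar> * h\<^sup>2) \<le> H N * (rho8 (1 / \<kappa>) * omega (r + h))"
      by (intro mult_left_mono H)
    moreover have "a * r \<le> a * omega (r + h)" "b * h \<le> b * omega (r + h)" using o ab by (auto intro: mult_left_mono)
    ultimately have "\<bar>v n - v m\<bar> \<le> a * omega (r + h) + b * omega (r + h) + H N * (rho8 (1 / \<kappa>) * omega (r + h))"
      using v[OF mn N] unfolding r_def by linarith
    then show ?thesis using r0 by (simp add: r_def algebra_simps)
  qed
  show ?thesis
    unfolding step_codes_def
  proof (intro CollectI case_prodI conjI allI impI)
    show "\<tau> 0 = 0" by (rule tau_0)
    show "\<kappa> * h\<^sup>2 \<le> \<tau> (Suc n) - \<tau> n" "\<tau> (Suc n) - \<tau> n \<le> G * h" for n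
      using dthat_bounds[of n] by (simp_all add: tau_Suc)
    show "\<bar>v 0\<bar> \<le> C" by (rule C)
    fix N n m :: nat assume N: "real n * h\<^sup>2 \<le> real N \<and> real m * h\<^sup>2 \<le> real N"
    show "\<bar>v n - v m\<bar> \<le> (a + b + H N * rho8 (1 / \<kappa>)) * omega (\<bar>\<tau> n - \<tau> m\<bar> + h)"
    proof (cases "m \<le> n")
      case True then show ?thesis using *[OF True] N by blast
    next
      case False
      then have "n \<le> m" by simp
      from *[OF this] N show ?thesis by (simp add: abs_minus_commute)
    qed
  qed
qed

text \<open>A reflection adds \<open>h\<close> during a step of rescaled length \<open>h\<close>,
  which gives slope one. The closed upper index shifts the sum by one step and costs another
  \<open>h\<close>; the shift by \<open>nr\<close> adds only a regular step, which contributes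
  nothing.\<close>

lemma reflection_code:
  assumes "h \<le> B" "k \<noteq> 0"
  shows "(\<tau>, \<lambda>n. \<Sum>j\<in>{..nr n}. if I j = k then h else 0) \<in> step_codes \<kappa> G B (\<lambda>N. 1 + 1 + 0 * rho8 (1 / \<kappa>)) h"
proof -
  let ?z = "\<lambda>j. if I j = k then h else 0"
  have eq: "(\<Sum>j\<in>{..nr n}. ?z j) = (\<Sum>j\<in>{..n}. ?z j)" for n
  proof (cases "I n = 0")
    case False
    then have "nr n = Suc n" by (simp add: next_regular_def)
    then show ?thesis using refl[OF False] assms by simp
  qed (simp add: next_regular_def)
  have zd: "?z j \<le> dthat P B h xs as us j" for j
    using assms dthat_nonneg[of j] by (auto simp: dthat_def)
  have "\<bar>(\<Sum>j\<in>{..n}. ?z j) - (\<Sum>j\<in>{..m}. ?z j)\<bar> \<le> \<tau> n - \<tau> m + h" if mn: "m \<le> n" for m n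
  proof -
    have "(\<Sum>j\<in>{..n}. ?z j) - (\<Sum>j\<in>{..m}. ?z j) = (\<Sum>j\<in>{m..<n}. ?z (Suc j))"
      using mn by (induction n rule: dec_induct) auto
    moreover have "0 \<le> (\<Sum>j\<in>{m..<n}. ?z (Suc j))" using h by (intro sum_nonneg) auto
    moreover have "(\<Sum>j\<in>{m..<n}. ?z (Suc j)) \<le> \<tau> n - \<tau> m + h"
    proof -
      have "(\<Sum>j\<in>{m..<n}. ?z (Suc j)) = (\<Sum>j\<in>{Suc m..<Suc n}. ?z j)"
        by (rule sum.shift_bounds_Suc_ivl[symmetric])
      also have "\<dots> \<le> (\<Sum>j\<in>{m..<Suc n}. ?z j)" using h by (intro sum_mono2) auto
      also have "\<dots> = (\<Sum>j\<in>{m..<n}. ?z j) + ?z n" using mn by simp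
      also have "\<dots> \<le> (\<tau> n - \<tau> m) + h" unfolding tau_diff[OF mn] using zd h by (intro add_mono sum_mono) auto
      finally show ?thesis .
    qed
    ultimately show ?thesis by simp
  qed
  then show ?thesis unfolding eq
    using assms h by (intro step_codesI) (auto simp: rho8_def)
qed

lemma time_code: "0 \<le> C \<Longrightarrow> (\<tau>, ttn P B h xs as us) \<in> step_codes \<kappa> G C (\<lambda>N. 1 + 0 + 0 * rho8 (1 / \<kappa>)) h"
proof (rule step_codesI)
  fix N m n :: nat assume mn: "m \<le> n"
  have d: "dtn P B h xs as us k \<le> dthat P B h xs as us k" for k using h by (auto simp: dthat_def dtn_def)
  have "ttn P B h xs as us n - ttn P B h xs as us m = (\<Sum>k\<in>{m..<n}. dtn P B h xs as us k)"
    unfolding ttn_def using mn by (simp add: lessThan_atLeast0 sum_diff_nat_ivl)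
  also have "\<dots> \<le> \<tau> n - \<tau> m" unfolding tau_diff[OF mn] by (rule sum_mono) (rule d)
  finally show "\<bar>ttn P B h xs as us n - ttn P B h xs as us m\<bar> \<le> 1 * (\<tau> n - \<tau> m) + 0 * h + 0 * rho8 (\<bar>real n - real m\<bar> * h\<^sup>2)"
    using ttn_mono[OF mn] by simp
qed (auto simp: ttn_def)

lemma measurable_stepf: "(\<lambda>t. stepf \<tau> v t :: 'b::topological_space) \<in> borel_measurable borel"
proof -
  have "(\<lambda>t. GREATEST n. \<tau> n \<le> max 0 t) \<in> measurable borel (count_space UNIV)"
  proof (subst measurable_count_space_eq_countable, safe)
    fix n
    have "(GREATEST n. \<tau> n \<le> max 0 t) = n \<longleftrightarrow> \<tau> n \<le> max 0 t \<and> max 0 t < \<tau> (Suc n)" for t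
    proof -
      obtain k where "\<tau> k \<le> max 0 t" "max 0 t < \<tau> (Suc k)" using clock_cell[OF clock_tau, of "max 0 t"] by auto
      then show ?thesis using Greatest_clock[OF strict_mono_tau] by metis
    qed
    then have "(\<lambda>t. GREATEST n. \<tau> n \<le> max 0 t) -` {n} \<inter> space borel = {t. \<tau> n \<le> max 0 t \<and> max 0 t < \<tau> (Suc n)}" by auto
    also have "\<dots> \<in> sets borel" by measurable
    finally show "(\<lambda>t. GREATEST n. \<tau> n \<le> max 0 t) -` {n} \<inter> space borel \<in> sets borel" .
  qed auto
  then show ?thesis unfolding stepf_def by (rule measurable_compose) simp
qed

lemma jump_path:
  assumes d: "\<And>N. 0 < d N" "\<And>N. d N \<le> 1" "\<And>N N'. N \<le> N' \<Longrightarrow> d N' \<le> d N"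
    and as: "\<And>n. I n \<noteq> 0 \<Longrightarrow> as (Suc n) = as n" "\<And>n. as n \<le> m"
    and first: "\<And>i. as (Suc i) \<noteq> as i \<Longrightarrow> d 0 \<le> real (Suc i) * (\<kappa> * h\<^sup>2)"
    and sep: "\<And>N i j. i < j \<Longrightarrow> real i * (\<kappa> * h\<^sup>2) \<le> real N \<Longrightarrow> as (Suc i) \<noteq> as i \<Longrightarrow> as (Suc j) \<noteq> as j \<Longrightarrow>
      d N \<le> real (j - i) * (\<kappa> * h\<^sup>2)"
  shows "(\<lambda>t. real (as (nh P B h xs as us (That P B h xs as us (max 0 t))))) \<in> (\<lambda>(\<tau>, v). stepf \<tau> v) ` jump_codes d m"
proof -
  let ?f = "stepf \<tau> (\<lambda>n. real (as n))"
  have nr: "as (nr n) = as n" for n using as(1)[of n] by (simp add: next_regular_def)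
  have f: "(\<lambda>t. real (as (nh P B h xs as us (That P B h xs as us (max 0 t))))) = ?f"
    using rescaled_path[of "\<lambda>n. real (as n)"] by (simp add: nr)
  \<comment> \<open>A change of regime in step \<open>i\<close> becomes visible at the end of that
    step, hence the index \<open>Suc i\<close>.\<close>
  define S where "S = {\<tau> (Suc i) | i. as (Suc i) \<noteq> as i}"
  have less: "\<tau> i < \<tau> j \<longleftrightarrow> i < j" "\<tau> i \<le> \<tau> j \<longleftrightarrow> i \<le> j" for i j
    using strict_mono_tau by (simp_all add: strict_mono_less strict_mono_less_eq)
  have "\<exists>\<sigma> w. (\<sigma>, w) \<in> jump_codes d m \<and> ?f = stepf \<sigma> w"
  proof (rule jump_path_recode[OF d])
    show "d 0 \<le> s" if sS: "s \<in> S" for s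
    proof -
      obtain i where i: "s = \<tau> (Suc i)" "as (Suc i) \<noteq> as i" using sS by (auto simp: S_def)
      show ?thesis using first[OF i(2)] tau_growth[of "Suc i"] i(1) by (simp add: mult.left_commute)
    qed
    show "d N \<le> s' - s" if s: "s \<in> S" "s' \<in> S" "s < s'" "s \<le> real N" for N s s'
    proof -
      obtain i where i: "s = \<tau> (Suc i)" "as (Suc i) \<noteq> as i" using s by (auto simp: S_def)
      obtain j where j: "s' = \<tau> (Suc j)" "as (Suc j) \<noteq> as j" using s by (auto simp: S_def)
      have ij: "i < j" using s i j by (simp add: less)
      have "\<kappa> * (real (Suc i) * h\<^sup>2) \<le> real N" using tau_growth[of "Suc i"] i s by linarith
      moreover have "real i * (\<kappa> * h\<^sup>2) \<le> \<kappa> * (real (Suc i) * h\<^sup>2)" using kpos by (simp add: algebra_simps)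
      ultimately have "d N \<le> real (j - i) * (\<kappa> * h\<^sup>2)" using i j by (intro sep[OF ij]) auto
      also have "\<dots> = \<kappa> * (real (Suc j - Suc i) * h\<^sup>2)" by simp
      also have "\<dots> \<le> \<tau> (Suc j) - \<tau> (Suc i)" using ij by (intro tau_diff_growth) simp
      finally show ?thesis by (simp add: i j)
    qed
    show "?f t = ?f 0" if "t \<le> 0" for t using that by (rule stepf_neg)
    show "?f s = ?f t" if st: "0 \<le> s" "s \<le> t" "S \<inter> {s<..t} = {}" for s t
    proof -
      have t0: "0 \<le> t" using st by simp
      obtain n where n: "\<tau> n \<le> s" "s < \<tau> (Suc n)" using clock_cell[OF clock_tau st(1)] .
      obtain k where k: "\<tau> k \<le> t" "t < \<tau> (Suc k)" using clock_cell[OF clock_tau t0] .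
      have "\<tau> n < \<tau> (Suc k)" using n k st by linarith
      then have nk: "n \<le> k" by (simp add: less)
      have "as i = as n" if "n \<le> i" "i \<le> k" for i
        using that
      proof (induction i rule: dec_induct)
        case (step i)
        have "\<tau> (Suc n) \<le> \<tau> (Suc i)" "\<tau> (Suc i) \<le> \<tau> k" using step by (simp_all add: less)
        then have "\<tau> (Suc i) \<in> {s<..t}" using n k by simp
        then have "\<tau> (Suc i) \<notin> S" using st by blast
        then show ?case using step by (auto simp: S_def)
      qed simp
      from this[OF nk order_refl] have "as k = as n" .
      then show ?thesis
        using stepf_eq[OF strict_mono_tau st(1) n, of "\<lambda>n. real (as n)"]
          stepf_eq[OF strict_mono_tau t0 k, of "\<lambda>n. real (as n)"] by simp
    qed
    show "0 \<le> ?f t" "?f t \<le> real m" for t using as(2) by (simp_all add: stepf_def)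
  qed
  then obtain \<sigma> w where sw: "(\<sigma>, w) \<in> jump_codes d m" "?f = stepf \<sigma> w" by blast
  show ?thesis unfolding f sw(2) by (rule image_eqI[of _ _ "(\<sigma>, w)"]) (use sw in auto)
qed

end

section \<open>Separation of regime jumps with high probability\<close>

lemma card_short_gaps:
  fixes r d :: real
  assumes r: "0 < r" and d: "0 \<le> d"
  shows "finite {e :: nat. 0 < e \<and> real e * r < d}" "real (card {e :: nat. 0 < e \<and> real e * r < d}) \<le> d / r"
proof -
  have sub: "{e :: nat. 0 < e \<and> real e * r < d} \<subseteq> {1..nat \<lfloor>d / r\<rfloor>}"
  proof safe
    fix e :: nat assume e: "0 < e" "real e * r < d"
    then have "real e \<le> d / r" using r by (simp add: le_divide_eq)
    then show "e \<in> {1..nat \<lfloor>d / r\<rfloor>}" using e by (simp add: le_nat_floor)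
  qed
  show "finite {e :: nat. 0 < e \<and> real e * r < d}" using sub by (rule finite_subset) simp
  have "card {e :: nat. 0 < e \<and> real e * r < d} \<le> nat \<lfloor>d / r\<rfloor>"
    using card_mono[OF _ sub] by simp
  moreover have "real (nat \<lfloor>d / r\<rfloor>) \<le> d / r" using r d by (simp add: of_nat_nat)
  ultimately show "real (card {e :: nat. 0 < e \<and> real e * r < d}) \<le> d / r" by linarith
qed

text \<open>If every step jumps with conditional probability at most \<open>C h\<^sup>2\<close> and lasts at least \<open>\<kappa> h\<^sup>2\<close>, then
  \<open>d (N / \<kappa> + B\<^sup>2) C\<^sup>2 / \<kappa>\<close> bounds the probability of two jumps at distance below \<open>d\<close> before
  time \<open>N\<close>, and \<open>d C / \<kappa>\<close> that of a jump before time \<open>d\<close>.\<close>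
definition jump_gap :: "real \<Rightarrow> real \<Rightarrow> real \<Rightarrow> real \<Rightarrow> nat \<Rightarrow> real" where
  "jump_gap \<kappa> C B \<epsilon> N = min 1 (\<epsilon> / 2 ^ Suc N / (1 + (real N / \<kappa> + B\<^sup>2) * (C\<^sup>2 / \<kappa>) + C / \<kappa>))"

text \<open>The cap at \<open>1\<close> is for the forced ticks of \<open>jump_path_recode\<close>,
  which lie at distance \<open>1\<close>; the summand \<open>1\<close> keeps the denominator
  positive. As \<open>N\<close> grows the numerator falls and the denominator rises, so the gaps
  decrease.\<close>

lemma jump_gap:
  assumes "0 < \<kappa>" "0 \<le> C" "0 < \<epsilon>"
  shows "0 < jump_gap \<kappa> C B \<epsilon> N" "jump_gap \<kappa> C B \<epsilon> N \<le> 1" "N \<le> N' \<Longrightarrow> jump_gap \<kappa> C B \<epsilon> N' \<le> jump_gap \<kappa> C B \<epsilon> N"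
    "jump_gap \<kappa> C B \<epsilon> N * ((real N / \<kappa> + B\<^sup>2) * (C\<^sup>2 / \<kappa>) + C / \<kappa>) \<le> \<epsilon> / 2 ^ Suc N"
proof -
  define E where "E N = 1 + (real N / \<kappa> + B\<^sup>2) * (C\<^sup>2 / \<kappa>) + C / \<kappa>" for N :: nat
  have nn: "0 \<le> (real N / \<kappa> + B\<^sup>2) * (C\<^sup>2 / \<kappa>)" "0 \<le> C / \<kappa>" for N :: nat using assms by auto
  have E: "1 \<le> E N" for N using nn(1)[of N] nn(2) by (simp add: E_def)
  have jg: "jump_gap \<kappa> C B \<epsilon> N = min 1 (\<epsilon> / 2 ^ Suc N / E N)" for N by (simp add: jump_gap_def E_def)
  have Ep: "0 < E N" for N using E[of N] by simp
  show "0 < jump_gap \<kappa> C B \<epsilon> N" using assms Ep[of N] by (simp add: jg)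
  then have p: "0 \<le> jump_gap \<kappa> C B \<epsilon> N" by simp
  show "jump_gap \<kappa> C B \<epsilon> N \<le> 1" by (simp add: jg)
  show "jump_gap \<kappa> C B \<epsilon> N' \<le> jump_gap \<kappa> C B \<epsilon> N" if "N \<le> N'"
  proof -
    have e: "E N \<le> E N'" unfolding E_def using that assms
      by (intro add_mono mult_right_mono divide_right_mono) auto
    have p: "\<epsilon> / 2 ^ Suc N' \<le> \<epsilon> / 2 ^ Suc N" using that assms by (intro divide_left_mono power_increasing) auto
    have "\<epsilon> / 2 ^ Suc N' / E N' \<le> \<epsilon> / 2 ^ Suc N / E N"
      by (rule frac_le[OF _ p Ep e]) (use assms in simp)
    then show ?thesis unfolding jg by (intro min.mono) auto
  qed
  have "jump_gap \<kappa> C B \<epsilon> N * ((real N / \<kappa> + B\<^sup>2) * (C\<^sup>2 / \<kappa>) + C / \<kappa>) \<le> jump_gap \<kappa> C B \<epsilon> N * E N"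
    using p by (intro mult_left_mono) (auto simp: E_def)
  also have "\<dots> \<le> \<epsilon> / 2 ^ Suc N / E N * E N" using Ep[of N] by (intro mult_right_mono) (auto simp: jg)
  also have "\<dots> = \<epsilon> / 2 ^ Suc N" using Ep[of N] by simp
  finally show "jump_gap \<kappa> C B \<epsilon> N * ((real N / \<kappa> + B\<^sup>2) * (C\<^sup>2 / \<kappa>) + C / \<kappa>) \<le> \<epsilon> / 2 ^ Suc N" .
qed

context controlled_chain
begin

lemma measurable_mean_inc: "mean_inc k \<in> borel_measurable (F k)"
  unfolding mean_inc_def by (rule borel_measurable_cond_exp)

lemma mean_inc_orthogonal:
  assumes g: "g \<in> borel_measurable (F k)" and b: "AE \<omega> in M. \<bar>g \<omega>\<bar> \<le> C"
  shows "(\<integral>\<omega>. g \<omega> * (xi (Suc k) \<omega> - xi k \<omega> - mean_inc k \<omega>) \<partial>M) = 0"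
proof -
  interpret S: sigma_finite_subalgebra M "F k" by (rule sub)
  let ?d = "\<lambda>\<omega>. xi (Suc k) \<omega> - xi k \<omega>"
  have gM [measurable]: "g \<in> borel_measurable M" using g by (rule measurable_F_M)
  have i: "integrable M (\<lambda>\<omega>. g \<omega> * ?d \<omega>)"
  proof (rule bounded_integrable)
    show "AE \<omega> in M. \<bar>g \<omega> * ?d \<omega>\<bar> \<le> C * h"
      using b AE_inc[of k]
    proof eventually_elim
      case (elim \<omega>)
      then show ?case unfolding abs_mult by (intro mult_mono) (auto intro: order_trans[OF abs_ge_zero])
    qed
  qed measurable
  have "(\<integral>\<omega>. g \<omega> * mean_inc k \<omega> \<partial>M) = (\<integral>\<omega>. g \<omega> * ?d \<omega> \<partial>M)" "integrable M (\<lambda>\<omega>. g \<omega> * mean_inc k \<omega>)"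
    unfolding mean_inc_def using S.real_cond_exp_intg[OF i g] by auto
  then show ?thesis using i by (simp add: right_diff_distrib)
qed

definition regular :: "nat \<Rightarrow> 'a \<Rightarrow> bool" where
  "regular k \<omega> \<longleftrightarrow> xi k \<omega> \<noteq> -(B + h) \<and> xi k \<omega> \<noteq> B + h"

text \<open>With \<open>g\<close> equal to \<open>1\<close> this is the martingale part of
  \<open>xi\<close>, with \<open>inv_sigma\<close> it is the increment of \<open>W\<close>.
  Reflection steps are left out; their displacement is charged to the clock.\<close>

definition noise :: "(nat \<Rightarrow> 'a \<Rightarrow> real) \<Rightarrow> nat \<Rightarrow> 'a \<Rightarrow> real" where
  "noise g k \<omega> = (if regular k \<omega> then g k \<omega> * (xi (Suc k) \<omega> - xi k \<omega> - mean_inc k \<omega>) else 0)"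

text \<open>An increment is at most \<open>h\<close> and its conditional mean at most
  \<open>b0 * h\<^sup>2 / s0\<close>, which is at most \<open>b0 * (B / s0) * h\<close>.\<close>

definition noise_bound :: real where "noise_bound = 1 + b0 * (B / s0)"

lemma AE_interior: "AE \<omega> in M. regular k \<omega> \<longrightarrow> \<bar>xi k \<omega>\<bar> \<le> B \<and> al k \<omega> < m0 P"
  using AE_states[of k] by eventually_elim (use grid_interior(1) in \<open>auto simp: states_def regular_def\<close>)

lemma AE_noise_bound:
  assumes g: "AE \<omega> in M. regular k \<omega> \<longrightarrow> \<bar>g k \<omega>\<bar> \<le> C" "0 \<le> C"
  shows "AE \<omega> in M. \<bar>noise g k \<omega>\<bar> \<le> C * noise_bound * h"
  using g(1) AE_inc[of k] AE_mean_inc[of k] AE_interior[of k] AE_space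
proof eventually_elim
  case (elim \<omega>)
  show ?case
  proof (cases "regular k \<omega>")
    case True
    let ?D = "Dn P h (xi k \<omega>) (al k \<omega>) (u k \<omega>)"
    have D: "s0 \<le> ?D" using elim True by (intro coeffs(3) u_Uset) auto
    have "\<bar>mean_inc k \<omega>\<bar> \<le> b0 * (h\<^sup>2 / ?D)" using elim True by (simp add: regular_def)
    also have "\<dots> \<le> b0 * (h\<^sup>2 / s0)" using D coeff_signs by (intro mult_left_mono divide_left_mono) auto
    also have "\<dots> \<le> b0 * (B * h / s0)"
      using h0 coeff_signs by (intro mult_left_mono divide_right_mono) (auto simp: power2_eq_square)
    finally have "\<bar>xi (Suc k) \<omega> - xi k \<omega> - mean_inc k \<omega>\<bar> \<le> h + b0 * (B * h / s0)" using elim(2) by linarith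
    then have "\<bar>xi (Suc k) \<omega> - xi k \<omega> - mean_inc k \<omega>\<bar> \<le> noise_bound * h"
      by (simp add: noise_bound_def algebra_simps)
    then have "\<bar>g k \<omega> * (xi (Suc k) \<omega> - xi k \<omega> - mean_inc k \<omega>)\<bar> \<le> C * (noise_bound * h)"
      unfolding abs_mult using elim(1) True g(2) by (intro mult_mono) auto
    then show ?thesis using True by (simp add: noise_def mult.assoc)
  next
    case False
    have "0 \<le> noise_bound" using coeff_signs B0 by (simp add: noise_bound_def)
    then show ?thesis using False g(2) h0 by (simp add: noise_def)
  qed
qed

lemma regular_F: "Measurable.pred (F k) (regular k)"
proof -
  have [measurable]: "xi k \<in> borel_measurable (F k)" by (rule adapted)
  show ?thesis unfolding regular_def by measurable
qed

text \<open>The factor \<open>g k\<close> and the restriction to regular steps are known at time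
  \<open>k\<close>, so they join the multiplier in \<open>mean_inc_orthogonal\<close>: the
  increments remain orthogonal to the past and of order \<open>h\<close>.\<close>

lemma noise_holder:
  assumes gm: "\<And>k. g k \<in> borel_measurable (F k)"
    and g: "\<And>k. AE \<omega> in M. regular k \<omega> \<longrightarrow> \<bar>g k \<omega>\<bar> \<le> C" "0 \<le> C" and \<epsilon>: "0 < \<epsilon>"
  shows "\<exists>A\<in>events. 1 - \<epsilon> \<le> prob A \<and> (\<forall>\<omega>\<in>A. \<forall>N n m.
    real n * h\<^sup>2 \<le> real N \<and> real m * h\<^sup>2 \<le> real N \<longrightarrow>
      \<bar>(\<Sum>k<n. noise g k \<omega>) - (\<Sum>k<m. noise g k \<omega>)\<bar> \<le>
        holder_factor * holder_const (4 * (C * noise_bound) ^ 4) B \<epsilon> N * rho8 (\<bar>real n - real m\<bar> * h\<^sup>2))"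
proof -
  have c0: "0 \<le> C * noise_bound * h" using g(2) coeff_signs B0 h0 by (simp add: noise_bound_def)
  have m1: "noise g k \<in> borel_measurable (F n)" if "k < n" for k n
  proof -
    have le: "k \<le> n" "Suc k \<le> n" using that by auto
    have [measurable]: "g k \<in> borel_measurable (F n)" "mean_inc k \<in> borel_measurable (F n)"
      "xi k \<in> borel_measurable (F n)" "xi (Suc k) \<in> borel_measurable (F n)" "Measurable.pred (F n) (regular k)"
      using measurable_F_mono[OF gm le(1)] measurable_F_mono[OF measurable_mean_inc le(1)]
        measurable_F_mono[OF adapted(1) le(1)] measurable_F_mono[OF adapted(1) le(2)] measurable_F_mono[OF regular_F le(1)] by auto
    show ?thesis unfolding noise_def by measurable
  qed
  have mM: "noise g k \<in> borel_measurable M" for k using m1[of k "Suc k"] by (intro measurable_F_M) auto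
  have orth: "(\<integral>\<omega>. K \<omega> * noise g k \<omega> \<partial>M) = 0"
    if K: "K \<in> borel_measurable (F k)" "AE \<omega> in M. \<bar>K \<omega>\<bar> \<le> D" for K k D
  proof -
    let ?g = "\<lambda>\<omega>. if regular k \<omega> then K \<omega> * g k \<omega> else 0"
    have "(\<integral>\<omega>. K \<omega> * noise g k \<omega> \<partial>M) = (\<integral>\<omega>. ?g \<omega> * (xi (Suc k) \<omega> - xi k \<omega> - mean_inc k \<omega>) \<partial>M)"
      by (rule Bochner_Integration.integral_cong) (auto simp: noise_def)
    also have "\<dots> = 0"
    proof (rule mean_inc_orthogonal)
      have [measurable]: "K \<in> borel_measurable (F k)" "g k \<in> borel_measurable (F k)" "Measurable.pred (F k) (regular k)"
        using K gm regular_F by auto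
      show "?g \<in> borel_measurable (F k)" by measurable
      show "AE \<omega> in M. \<bar>?g \<omega>\<bar> \<le> \<bar>D\<bar> * C"
        using K(2) g(1)[of k]
      proof eventually_elim
        case (elim \<omega>)
        then show ?case using g(2) by (auto simp: abs_mult intro!: mult_mono)
      qed
    qed
    finally show ?thesis .
  qed
  have diff: "(\<Sum>k<m + n. noise g k \<omega>) - (\<Sum>k<m. noise g k \<omega>) = (\<Sum>k\<in>{m..<m + n}. noise g k \<omega>)" for m n \<omega>
    by (simp add: lessThan_atLeast0 sum_diff_nat_ivl)
  note fm = martingale_fourth_moment[where D = "noise g" and F = F and c = "C * noise_bound * h",
      OF mM AE_noise_bound[OF g] c0 m1 orth]
  show ?thesis
  proof (rule holder_event[where c = "4 * (C * noise_bound) ^ 4" and h = h])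
    show "(\<lambda>\<omega>. \<Sum>k<n. noise g k \<omega>) \<in> borel_measurable M" for n using mM by (intro borel_measurable_sum)
    show "(\<integral>\<omega>. ((\<Sum>k<m + n. noise g k \<omega>) - (\<Sum>k<m. noise g k \<omega>)) ^ 4 \<partial>M)
        \<le> 4 * (C * noise_bound) ^ 4 * h ^ 4 * (real n)\<^sup>2" for m n
      unfolding diff using fm(1)[where m = m and n = n] by (simp add: power_mult_distrib mult.assoc)
    show "integrable M (\<lambda>\<omega>. ((\<Sum>k<m + n. noise g k \<omega>) - (\<Sum>k<m. noise g k \<omega>)) ^ 4)" for m n
      unfolding diff by (rule fm(2))
  qed (use h0 \<epsilon> in auto)
qed

text \<open>With \<open>r = \<kappa> * h\<^sup>2\<close> there are at most \<open>N / r + 1\<close>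
  first steps and \<open>d N / r\<close> short gaps, and two given steps both jump with probability
  at most \<open>(C * h\<^sup>2)\<^sup>2\<close>. The negative powers of \<open>h\<close> cancel,
  and the \<open>+ 1\<close> leaves a term \<open>h\<^sup>2\<close>, bounded by
  \<open>B\<^sup>2\<close>.\<close>

lemma jump_event:
  assumes \<kappa>: "0 < \<kappa>" and \<epsilon>: "0 < \<epsilon>"
  defines "d \<equiv> jump_gap \<kappa> (q0 / s0) B \<epsilon>"
  shows "\<exists>A\<in>events. 1 - \<epsilon> \<le> prob A \<and> (\<forall>\<omega>\<in>A.
    (\<forall>i. \<omega> \<in> jump i \<longrightarrow> d 0 \<le> real (Suc i) * (\<kappa> * h\<^sup>2)) \<and>
    (\<forall>N i j. i < j \<longrightarrow> real i * (\<kappa> * h\<^sup>2) \<le> real N \<longrightarrow> \<omega> \<in> jump i \<longrightarrow> \<omega> \<in> jump j \<longrightarrow>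
      d N \<le> real (j - i) * (\<kappa> * h\<^sup>2)))"
proof -
  define C where "C = q0 / s0"
  have C0: "0 \<le> C" using coeff_signs by (simp add: C_def)
  define r where "r = \<kappa> * h\<^sup>2"
  have r0: "0 < r" using \<kappa> h0 by (simp add: r_def)
  note jg = jump_gap[OF \<kappa> C0 \<epsilon>, folded C_def]
  have dC: "d = jump_gap \<kappa> C B \<epsilon>" by (simp add: d_def C_def)
  have J1: "prob (jump n) \<le> C * h\<^sup>2" for n
    using prob_jump[of "space M" n] sets.top[of "F n"] by (simp add: space_F C_def prob_space Int_absorb1 sets.sets_into_space)
  have J2: "prob (jump i \<inter> jump j) \<le> (C * h\<^sup>2) * (C * h\<^sup>2)" if "i < j" for i j
  proof -
    have "jump i \<in> sets (F j)" using jump_F[of i] sets_F_mono[of "Suc i" j] that by auto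
    then have "prob (jump i \<inter> jump j) \<le> C * h\<^sup>2 * prob (jump i)" unfolding C_def by (rule prob_jump)
    also have "\<dots> \<le> C * h\<^sup>2 * (C * h\<^sup>2)" using J1[of i] C0 by (intro mult_left_mono) auto
    finally show ?thesis .
  qed
  define T where "T N = {i :: nat. real i * r \<le> real N}" for N :: nat
  define E where "E N = {e :: nat. 0 < e \<and> real e * r < d N}" for N
  \<comment> \<open>A jump in step \<open>e - 1\<close> shows at index \<open>e\<close>, so the
    second union collects the jumps that come too soon after time \<open>0\<close>.\<close>
  define Bad where "Bad N = (\<Union>i\<in>T N. \<Union>e\<in>E N. jump i \<inter> jump (i + e)) \<union> (\<Union>e\<in>E N. jump (e - 1))" for N
  have dN: "0 < d N" for N using jg(1) by (simp add: dC)
  have fE: "finite (E N)" "real (card (E N)) \<le> d N / r" for N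
    unfolding E_def using card_short_gaps[OF r0] dN[of N] by (auto simp: less_imp_le)
  have fT: "finite (T N)" "real (card (T N)) \<le> real N / r + 1" for N
  proof -
    have sub: "T N \<subseteq> {..nat \<lfloor>real N / r\<rfloor>}"
      using r0 by (auto simp: T_def le_nat_floor le_divide_eq)
    show "finite (T N)" using sub by (rule finite_subset) simp
    have "card (T N) \<le> Suc (nat \<lfloor>real N / r\<rfloor>)" using card_mono[OF _ sub] by simp
    moreover have "real (nat \<lfloor>real N / r\<rfloor>) \<le> real N / r" using r0 by (simp add: of_nat_nat)
    ultimately show "real (card (T N)) \<le> real N / r + 1" by linarith
  qed
  have BadM: "Bad N \<in> events" for N
    unfolding Bad_def using fE fT by (intro sets.Un sets.finite_UN) auto
  have PB: "prob (Bad N) \<le> \<epsilon> / 2 ^ Suc N" for N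
  proof -
    have a: "prob (\<Union>i\<in>T N. \<Union>e\<in>E N. jump i \<inter> jump (i + e)) \<le> (real N / r + 1) * (d N / r * ((C * h\<^sup>2) * (C * h\<^sup>2)))"
    proof -
      have "prob (\<Union>e\<in>E N. jump i \<inter> jump (i + e)) \<le> d N / r * ((C * h\<^sup>2) * (C * h\<^sup>2))" for i
      proof -
        have "prob (\<Union>e\<in>E N. jump i \<inter> jump (i + e)) \<le> (\<Sum>e\<in>E N. prob (jump i \<inter> jump (i + e)))"
          using fE by (intro finite_measure_subadditive_finite) auto
        also have "\<dots> \<le> (\<Sum>e\<in>E N. (C * h\<^sup>2) * (C * h\<^sup>2))" by (rule sum_mono, rule J2) (simp add: E_def)
        also have "\<dots> \<le> d N / r * ((C * h\<^sup>2) * (C * h\<^sup>2))"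
          using fE(2)[of N] C0 by (simp only: sum_constant) (intro mult_right_mono, auto)
        finally show ?thesis .
      qed
      note i = this
      have "prob (\<Union>i\<in>T N. \<Union>e\<in>E N. jump i \<inter> jump (i + e)) \<le> (\<Sum>i\<in>T N. prob (\<Union>e\<in>E N. jump i \<inter> jump (i + e)))"
        using fT fE by (intro finite_measure_subadditive_finite) auto
      also have "\<dots> \<le> (\<Sum>i\<in>T N. d N / r * ((C * h\<^sup>2) * (C * h\<^sup>2)))" by (rule sum_mono) (rule i)
      also have "\<dots> \<le> (real N / r + 1) * (d N / r * ((C * h\<^sup>2) * (C * h\<^sup>2)))"
        using fT(2)[of N] C0 dN[of N] r0 by (simp only: sum_constant) (intro mult_right_mono, auto)
      finally show ?thesis .
    qed
    have b: "prob (\<Union>e\<in>E N. jump (e - 1)) \<le> d N / r * (C * h\<^sup>2)"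
    proof -
      have "prob (\<Union>e\<in>E N. jump (e - 1)) \<le> (\<Sum>e\<in>E N. prob (jump (e - 1)))"
        using fE by (intro finite_measure_subadditive_finite) auto
      also have "\<dots> \<le> (\<Sum>e\<in>E N. C * h\<^sup>2)" by (rule sum_mono) (rule J1)
      also have "\<dots> \<le> d N / r * (C * h\<^sup>2)"
        using fE(2)[of N] C0 by (simp only: sum_constant) (intro mult_right_mono, auto)
      finally show ?thesis .
    qed
    have "prob (Bad N) \<le> prob (\<Union>i\<in>T N. \<Union>e\<in>E N. jump i \<inter> jump (i + e)) + prob (\<Union>e\<in>E N. jump (e - 1))"
      unfolding Bad_def using fT fE by (intro measure_Un_le sets.finite_UN) auto
    also have "\<dots> \<le> (real N / r + 1) * (d N / r * ((C * h\<^sup>2) * (C * h\<^sup>2))) + d N / r * (C * h\<^sup>2)" using a b by linarith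
    also have "\<dots> = d N * ((real N / \<kappa> + h\<^sup>2) * (C\<^sup>2 / \<kappa>) + C / \<kappa>)"
      using h0 \<kappa> by (simp add: r_def field_simps power2_eq_square)
    also have "\<dots> \<le> d N * ((real N / \<kappa> + B\<^sup>2) * (C\<^sup>2 / \<kappa>) + C / \<kappa>)"
      using h0 \<kappa> dN[of N] by (intro mult_left_mono add_mono mult_right_mono power_mono) auto
    also have "\<dots> \<le> \<epsilon> / 2 ^ Suc N" using jg(4)[of B N] by (simp add: dC)
    finally show ?thesis .
  qed
  obtain A where A: "A \<in> events" "1 - \<epsilon> \<le> prob A" "\<forall>\<omega>\<in>A. \<forall>N. \<omega> \<notin> Bad N"
    using avoid_countable_bad[OF BadM PB] by (elim bexE conjE) (rule that)
  show ?thesis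
  proof (intro bexI[OF _ A(1)] conjI A(2) ballI allI impI)
    fix \<omega> i assume \<omega>: "\<omega> \<in> A" "\<omega> \<in> jump i"
    show "d 0 \<le> real (Suc i) * (\<kappa> * h\<^sup>2)"
    proof (rule ccontr)
      assume "\<not> ?thesis"
      then have "Suc i \<in> E 0" by (simp add: E_def r_def)
      then have "\<omega> \<in> Bad 0" using \<omega>(2) unfolding Bad_def by (intro UnI2 UN_I[of "Suc i"]) auto
      then show False using A(3) \<omega>(1) by blast
    qed
  next
    fix \<omega> N i j assume \<omega>: "\<omega> \<in> A" "i < j" "real i * (\<kappa> * h\<^sup>2) \<le> real N" "\<omega> \<in> jump i" "\<omega> \<in> jump j"
    show "d N \<le> real (j - i) * (\<kappa> * h\<^sup>2)"
    proof (rule ccontr)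
      assume "\<not> ?thesis"
      then have "j - i \<in> E N" "i \<in> T N" using \<omega> by (auto simp: E_def T_def r_def)
      then have "\<omega> \<in> Bad N" using \<omega> unfolding Bad_def by (intro UnI1 UN_I[of i] UN_I[of "j - i"]) auto
      then show False using A(3) \<omega>(1) by blast
    qed
  qed
qed

end

section \<open>The components of the rescaled process\<close>

context controlled_chain
begin

text \<open>In both constants one argument serves the regular steps, of length
  \<open>h\<^sup>2 / Dn\<close>, and the other the reflection steps, of length \<open>h\<close>; the
  comparison between \<open>h\<close> and \<open>h\<^sup>2\<close> uses
  \<open>h \<le> B\<close>.\<close>

abbreviation "kap \<equiv> min (1 / D0) (1 / B)"
abbreviation "gam \<equiv> max 1 (B / s0)"
abbreviation "xs \<omega> \<equiv> (\<lambda>n. xi n \<omega>)"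
abbreviation "as \<omega> \<equiv> (\<lambda>n. al n \<omega>)"
abbreviation "us \<omega> \<equiv> (\<lambda>n. u n \<omega>)"
abbreviation "hat_time \<omega> t \<equiv> That P B h (xs \<omega>) (as \<omega>) (us \<omega>) (max 0 t)"

definition good :: "'a \<Rightarrow> bool" where
  "good \<omega> \<longleftrightarrow> \<omega> \<in> space M \<and> (\<forall>n. (xi n \<omega>, al n \<omega>) \<in> states \<and>
     (xi (Suc n) \<omega>, al (Suc n) \<omega>) \<in> succs (xi n \<omega>) (al n \<omega>) \<and>
     (regular n \<omega> \<longrightarrow> \<bar>mean_inc n \<omega>\<bar> \<le> b0 * (h\<^sup>2 / Dn P h (xi n \<omega>) (al n \<omega>) (u n \<omega>))))"

lemma AE_good: "AE \<omega> in M. good \<omega>"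
  unfolding good_def regular_def
  by (intro AE_conjI AE_space AE_all_countable[THEN iffD2] allI AE_states AE_succs AE_mean_inc)

text \<open>A measurable null set covering the failures of \<open>good\<close> is removed, which
  avoids a separate proof that \<open>good\<close> itself is measurable.\<close>

lemma restrict_to_good:
  assumes "A \<in> events" "1 - \<epsilon> \<le> prob A"
  shows "\<exists>A'\<in>events. A' \<subseteq> A \<and> 1 - \<epsilon> \<le> prob A' \<and> (\<forall>\<omega>\<in>A'. good \<omega>)"
proof -
  obtain N where N: "{\<omega>\<in>space M. \<not> good \<omega>} \<subseteq> N" "N \<in> null_sets M" using AE_good by (rule AE_E) (auto simp: null_sets_def)
  have "prob (A - N) = prob A" using assms(1) N(2) by (rule measure_Diff_null_set)
  moreover have "A - N \<in> events" using assms(1) N(2) by auto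
  moreover have "good \<omega>" if "\<omega> \<in> A - N" for \<omega> using that N(1) sets.sets_into_space[OF assms(1)] by auto
  ultimately show ?thesis using assms(2) by (intro bexI[of _ "A - N"]) auto
qed

lemma Iidx_regular: "Iidx B h (xs \<omega>) n = 0 \<longleftrightarrow> regular n \<omega>"
  by (simp add: Iidx_def regular_def)

lemma good_interior: "good \<omega> \<Longrightarrow> regular n \<omega> \<Longrightarrow> \<bar>xi n \<omega>\<bar> \<le> B \<and> al n \<omega> < m0 P"
  using grid_interior(1)[of "xi n \<omega>"] by (auto simp: good_def states_def regular_def)

lemma good_succs: "good \<omega> \<Longrightarrow> (xi (Suc n) \<omega>, al (Suc n) \<omega>) \<in> succs (xi n \<omega>) (al n \<omega>)"
  by (simp add: good_def)

lemma good_Dn: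
  assumes "good \<omega>" "regular n \<omega>"
  shows "s0 \<le> Dn P h (xi n \<omega>) (al n \<omega>) (u n \<omega>)" "Dn P h (xi n \<omega>) (al n \<omega>) (u n \<omega>) \<le> D0"
proof -
  have "u n \<omega> \<in> Uset P" using assms(1) by (intro u_Uset) (simp add: good_def)
  then show "s0 \<le> Dn P h (xi n \<omega>) (al n \<omega>) (u n \<omega>)" "Dn P h (xi n \<omega>) (al n \<omega>) (u n \<omega>) \<le> D0"
    using good_interior[OF assms] by (auto intro: coeffs)
qed

lemma good_path:
  assumes g: "good \<omega>" shows "chain_path P B h kap gam (xs \<omega>) (as \<omega>) (us \<omega>)"
proof
  note c = coeff_signs(1,3)
  show "0 < h" by (rule h0)
  show "0 < kap" using c B0 by simp
  have "kap * h\<^sup>2 \<le> 1 / B * h\<^sup>2" by (intro mult_right_mono) auto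
  also have "\<dots> \<le> h" using B0 h0 by (simp add: power2_eq_square divide_le_eq mult_right_mono)
  finally show "kap * h\<^sup>2 \<le> h" .
  show "1 \<le> gam" by simp
  fix n
  show "Iidx B h (xs \<omega>) (Suc n) = 0" if "Iidx B h (xs \<omega>) n \<noteq> 0"
    using good_succs[OF g, of n] that B0 h0 unfolding Iidx_regular
    by (auto simp: regular_def succs_def split: if_splits)
  show "kap * h\<^sup>2 \<le> dtn P B h (xs \<omega>) (as \<omega>) (us \<omega>) n \<and> dtn P B h (xs \<omega>) (as \<omega>) (us \<omega>) n \<le> gam * h"
    if I: "Iidx B h (xs \<omega>) n = 0"
  proof -
    let ?D = "Dn P h (xi n \<omega>) (al n \<omega>) (u n \<omega>)"
    note D = good_Dn[OF g I[unfolded Iidx_regular]]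
    have D0: "0 < ?D" using D c by linarith
    have e: "dtn P B h (xs \<omega>) (as \<omega>) (us \<omega>) n = h\<^sup>2 / ?D" using I by (simp add: dtn_def)
    have "kap * h\<^sup>2 \<le> 1 / D0 * h\<^sup>2" by (intro mult_right_mono) auto
    also have "\<dots> \<le> h\<^sup>2 / ?D" using D D0 by (simp add: divide_left_mono)
    finally have 1: "kap * h\<^sup>2 \<le> h\<^sup>2 / ?D" .
    have "h\<^sup>2 / ?D \<le> h\<^sup>2 / s0" using D D0 c by (intro divide_left_mono) auto
    also have "\<dots> = h / s0 * h" by (simp add: power2_eq_square)
    also have "\<dots> \<le> B / s0 * h" using h0 c by (intro mult_right_mono divide_right_mono) auto
    also have "\<dots> \<le> gam * h" using h0 by (intro mult_right_mono) auto
    finally show ?thesis using 1 e by simp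
  qed
qed

text \<open>After the noise is subtracted, a regular step leaves its conditional mean, at most
  \<open>b0\<close> times its length, and a reflection step a displacement \<open>h\<close> during
  time \<open>h\<close>. This gives the slope \<open>b0 + 1\<close>; the summand \<open>2\<close>
  pays for the shift by \<open>next_regular\<close> at both ends.\<close>

lemma xi_component:
  assumes \<epsilon>: "0 < \<epsilon>"
  shows "\<exists>A\<in>events. 1 - \<epsilon> \<le> prob A \<and> (\<forall>\<omega>\<in>A. \<exists>\<tau> v. (\<tau>, v) \<in> step_codes kap gam (2 * B)
      (\<lambda>N. (b0 + 1) + 2 + holder_factor * holder_const (4 * (1 * noise_bound) ^ 4) B \<epsilon> N * rho8 (1 / kap)) h \<and>
    (\<lambda>t. xi_int P B h (xs \<omega>) (as \<omega>) (us \<omega>) (hat_time \<omega> t)) = stepf \<tau> v)"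
proof -
  let ?g = "\<lambda>(k::nat) (\<omega>::'a). 1 :: real"
  let ?H = "\<lambda>N. holder_factor * holder_const (4 * (1 * noise_bound) ^ 4) B \<epsilon> N"
  have "\<exists>A\<in>events. 1 - \<epsilon> \<le> prob A \<and> (\<forall>\<omega>\<in>A. \<forall>N n m.
    real n * h\<^sup>2 \<le> real N \<and> real m * h\<^sup>2 \<le> real N \<longrightarrow>
      \<bar>(\<Sum>k<n. noise ?g k \<omega>) - (\<Sum>k<m. noise ?g k \<omega>)\<bar> \<le> ?H N * rho8 (\<bar>real n - real m\<bar> * h\<^sup>2))"
    by (rule noise_holder) (use \<epsilon> in auto)
  then obtain A0 where A0: "A0 \<in> events" "1 - \<epsilon> \<le> prob A0" and
    H: "\<And>\<omega> N n m. \<omega> \<in> A0 \<Longrightarrow> real n * h\<^sup>2 \<le> real N \<Longrightarrow> real m * h\<^sup>2 \<le> real N \<Longrightarrow>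
      \<bar>(\<Sum>k<n. noise ?g k \<omega>) - (\<Sum>k<m. noise ?g k \<omega>)\<bar> \<le> ?H N * rho8 (\<bar>real n - real m\<bar> * h\<^sup>2)" by blast
  obtain A where A: "A \<in> events" "A \<subseteq> A0" "1 - \<epsilon> \<le> prob A" "\<And>\<omega>. \<omega> \<in> A \<Longrightarrow> good \<omega>"
    using restrict_to_good[OF A0] by blast
  show ?thesis
  proof (intro bexI[OF _ A(1)] conjI A(3) ballI)
    fix \<omega> assume \<omega>: "\<omega> \<in> A"
    have g: "good \<omega>" by (rule A(4)[OF \<omega>])
    interpret path: chain_path P B h kap gam "xs \<omega>" "as \<omega>" "us \<omega>" by (rule good_path[OF g])
    let ?nr = "next_regular B h (xs \<omega>)"
    have inc: "\<bar>xi (Suc k) \<omega> - xi k \<omega>\<bar> \<le> h" for k using succs_dist[OF good_succs[OF g]] .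
    have nr: "\<bar>xi (?nr n) \<omega> - xi n \<omega>\<bar> \<le> h" for n using inc[of n] h0 by (simp add: next_regular_def)
    have e: "\<bar>xi (Suc k) \<omega> - xi k \<omega> - noise ?g k \<omega>\<bar> \<le> (b0 + 1) * dthat P B h (xs \<omega>) (as \<omega>) (us \<omega>) k" for k
    proof (cases "regular k \<omega>")
      case True
      then have I: "Iidx B h (xs \<omega>) k = 0" by (simp add: Iidx_regular)
      have "\<bar>mean_inc k \<omega>\<bar> \<le> b0 * dthat P B h (xs \<omega>) (as \<omega>) (us \<omega>) k"
        using g True I by (simp add: good_def dthat_def dtn_def)
      also have "\<dots> \<le> (b0 + 1) * dthat P B h (xs \<omega>) (as \<omega>) (us \<omega>) k"
        by (intro mult_right_mono path.dthat_nonneg) simp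
      finally show ?thesis using True by (simp add: noise_def)
    next
      case False
      then have "dthat P B h (xs \<omega>) (as \<omega>) (us \<omega>) k = h" by (simp add: dthat_def Iidx_regular)
      moreover have "1 * h \<le> (b0 + 1) * h" using coeff_signs h0 by (intro mult_right_mono) auto
      ultimately show ?thesis using False inc[of k] by (simp add: noise_def)
    qed
    have "(path.\<tau>, \<lambda>n. xi (?nr n) \<omega>) \<in> step_codes kap gam (2 * B) (\<lambda>N. (b0 + 1) + 2 + ?H N * rho8 (1 / kap)) h"
    proof (rule path.step_codesI)
      show "0 \<le> b0 + 1" using coeff_signs by simp
      show "0 \<le> ?H N" for N using \<epsilon> by (intro mult_nonneg_nonneg holder_factor_nonneg holder_const_nonneg) auto
      have "(xi (?nr 0) \<omega>, al (?nr 0) \<omega>) \<in> states" using g by (simp add: good_def)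
      then have "\<bar>xi (?nr 0) \<omega>\<bar> \<le> B + h" by (auto simp: states_def Sgrid_def)
      then show "\<bar>xi (?nr 0) \<omega>\<bar> \<le> 2 * B" using h0 by simp
      fix N m n :: nat assume mn: "m \<le> n" and N: "real n * h\<^sup>2 \<le> real N" "real m * h\<^sup>2 \<le> real N"
      have "xi n \<omega> - xi m \<omega> = (\<Sum>k\<in>{m..<n}. xi (Suc k) \<omega> - xi k \<omega>)" by (rule sum_Suc_diff'[OF mn, symmetric])
      also have "\<dots> = (\<Sum>k\<in>{m..<n}. noise ?g k \<omega>) + (\<Sum>k\<in>{m..<n}. xi (Suc k) \<omega> - xi k \<omega> - noise ?g k \<omega>)"
        by (simp add: sum_subtractf)
      also have "(\<Sum>k\<in>{m..<n}. noise ?g k \<omega>) = (\<Sum>k<n. noise ?g k \<omega>) - (\<Sum>k<m. noise ?g k \<omega>)"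
        using mn by (simp add: lessThan_atLeast0 sum_diff_nat_ivl)
      finally have eq: "xi n \<omega> - xi m \<omega> = ((\<Sum>k<n. noise ?g k \<omega>) - (\<Sum>k<m. noise ?g k \<omega>))
          + (\<Sum>k\<in>{m..<n}. xi (Suc k) \<omega> - xi k \<omega> - noise ?g k \<omega>)" .
      have "\<bar>\<Sum>k\<in>{m..<n}. xi (Suc k) \<omega> - xi k \<omega> - noise ?g k \<omega>\<bar> \<le> (\<Sum>k\<in>{m..<n}. (b0 + 1) * dthat P B h (xs \<omega>) (as \<omega>) (us \<omega>) k)"
        by (rule order_trans[OF sum_abs]) (intro sum_mono e)
      also have "\<dots> = (b0 + 1) * (path.\<tau> n - path.\<tau> m)" by (simp add: path.tau_diff[OF mn] sum_distrib_left)
      finally have "\<bar>xi n \<omega> - xi m \<omega>\<bar> \<le> ?H N * rho8 (\<bar>real n - real m\<bar> * h\<^sup>2) + (b0 + 1) * (path.\<tau> n - path.\<tau> m)"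
        using H[OF _ N, of \<omega>] \<omega> A(2) eq by (auto simp: subset_iff)
      then show "\<bar>xi (?nr n) \<omega> - xi (?nr m) \<omega>\<bar> \<le> (b0 + 1) * (path.\<tau> n - path.\<tau> m) + 2 * h + ?H N * rho8 (\<bar>real n - real m\<bar> * h\<^sup>2)"
        using nr[of n] nr[of m] by linarith
    qed simp
    moreover have "(\<lambda>t. xi_int P B h (xs \<omega>) (as \<omega>) (us \<omega>) (hat_time \<omega> t)) = stepf path.\<tau> (\<lambda>n. xi (?nr n) \<omega>)"
      unfolding xi_int_def using path.rescaled_path[of "xs \<omega>"] by blast
    ultimately show "\<exists>\<tau> v. (\<tau>, v) \<in> step_codes kap gam (2 * B) (\<lambda>N. (b0 + 1) + 2 + ?H N * rho8 (1 / kap)) h \<and>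
      (\<lambda>t. xi_int P B h (xs \<omega>) (as \<omega>) (us \<omega>) (hat_time \<omega> t)) = stepf \<tau> v" by blast
  qed
qed

definition inv_sigma :: "nat \<Rightarrow> 'a \<Rightarrow> real" where
  "inv_sigma k \<omega> = 1 / sqrt (sig2 P (xi k \<omega>) (al k \<omega>) (u k \<omega>))"

lemma measurable_inv_sigma: "inv_sigma k \<in> borel_measurable (F k)"
proof -
  have "(\<lambda>\<omega>. sig2 P (xi k \<omega>) (al k \<omega>) (u k \<omega>)) \<in> borel_measurable (F k)"
  proof (rule measurable_compose_countable[OF _ adapted(2)])
    fix i
    have "(\<lambda>\<omega>. (xi k \<omega>, u k \<omega>)) \<in> borel_measurable (F k)"
      by (rule borel_measurable_Pair[OF adapted(1,3)])
    from measurable_compose[OF this borel_measurable_continuous_onI[OF continuous_sig2]]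
    show "(\<lambda>\<omega>. sig2 P (xi k \<omega>) i (u k \<omega>)) \<in> borel_measurable (F k)" by simp
  qed
  then show ?thesis unfolding inv_sigma_def by measurable
qed

text \<open>\<open>W\<close> has no drift part and does not move in reflection steps, so only the
  Hoelder term remains. The lower bound \<open>s0\<close> of \<open>sig2\<close> bounds the
  multiplier \<open>inv_sigma\<close> by \<open>1 / sqrt s0\<close> at regular steps.\<close>

lemma W_component:
  assumes \<epsilon>: "0 < \<epsilon>"
  shows "\<exists>A\<in>events. 1 - \<epsilon> \<le> prob A \<and> (\<forall>\<omega>\<in>A. \<exists>\<tau> v. (\<tau>, v) \<in> step_codes kap gam (2 * B)
      (\<lambda>N. 0 + 0 + holder_factor * holder_const (4 * (1 / sqrt s0 * noise_bound) ^ 4) B \<epsilon> N * rho8 (1 / kap)) h \<and>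
    (\<lambda>t. W_int P B h (xs \<omega>) (as \<omega>) (us \<omega>) (\<lambda>k. mean_inc k \<omega>) (hat_time \<omega> t)) = stepf \<tau> v)"
proof -
  let ?H = "\<lambda>N. holder_factor * holder_const (4 * (1 / sqrt s0 * noise_bound) ^ 4) B \<epsilon> N"
  have b: "AE \<omega> in M. regular k \<omega> \<longrightarrow> \<bar>inv_sigma k \<omega>\<bar> \<le> 1 / sqrt s0" for k
    using AE_interior[of k] AE_space
  proof (eventually_elim, intro impI)
    fix \<omega> assume "regular k \<omega> \<longrightarrow> \<bar>xi k \<omega>\<bar> \<le> B \<and> al k \<omega> < m0 P" "\<omega> \<in> space M" "regular k \<omega>"
    then have "s0 \<le> sig2 P (xi k \<omega>) (al k \<omega>) (u k \<omega>)" by (intro coeffs(1) u_Uset) auto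
    then show "\<bar>inv_sigma k \<omega>\<bar> \<le> 1 / sqrt s0"
      using coeff_signs(1) by (simp add: inv_sigma_def frac_le)
  qed
  have "\<exists>A\<in>events. 1 - \<epsilon> \<le> prob A \<and> (\<forall>\<omega>\<in>A. \<forall>N n m.
    real n * h\<^sup>2 \<le> real N \<and> real m * h\<^sup>2 \<le> real N \<longrightarrow>
      \<bar>(\<Sum>k<n. noise inv_sigma k \<omega>) - (\<Sum>k<m. noise inv_sigma k \<omega>)\<bar> \<le> ?H N * rho8 (\<bar>real n - real m\<bar> * h\<^sup>2))"
    by (rule noise_holder[OF measurable_inv_sigma b]) (use \<epsilon> coeff_signs in auto)
  then obtain A0 where A0: "A0 \<in> events" "1 - \<epsilon> \<le> prob A0" and
    H: "\<And>\<omega> N n m. \<omega> \<in> A0 \<Longrightarrow> real n * h\<^sup>2 \<le> real N \<Longrightarrow> real m * h\<^sup>2 \<le> real N \<Longrightarrow>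
      \<bar>(\<Sum>k<n. noise inv_sigma k \<omega>) - (\<Sum>k<m. noise inv_sigma k \<omega>)\<bar> \<le> ?H N * rho8 (\<bar>real n - real m\<bar> * h\<^sup>2)" by blast
  obtain A where A: "A \<in> events" "A \<subseteq> A0" "1 - \<epsilon> \<le> prob A" "\<And>\<omega>. \<omega> \<in> A \<Longrightarrow> good \<omega>"
    using restrict_to_good[OF A0] by blast
  show ?thesis
  proof (intro bexI[OF _ A(1)] conjI A(3) ballI)
    fix \<omega> assume \<omega>: "\<omega> \<in> A"
    interpret path: chain_path P B h kap gam "xs \<omega>" "as \<omega>" "us \<omega>" by (rule good_path[OF A(4)[OF \<omega>]])
    let ?nr = "next_regular B h (xs \<omega>)"
    let ?S = "\<lambda>n. \<Sum>k<n. noise inv_sigma k \<omega>"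
    have nr: "?S (?nr n) = ?S n" for n by (simp add: next_regular_def Iidx_regular noise_def)
    have "W_int P B h (xs \<omega>) (as \<omega>) (us \<omega>) (\<lambda>k. mean_inc k \<omega>) t = ?S (nh P B h (xs \<omega>) (as \<omega>) (us \<omega>) t)" for t
      unfolding W_int_def by (rule sum.cong) (auto simp: noise_def Iidx_regular inv_sigma_def)
    then have "(\<lambda>t. W_int P B h (xs \<omega>) (as \<omega>) (us \<omega>) (\<lambda>k. mean_inc k \<omega>) (hat_time \<omega> t)) = stepf path.\<tau> (\<lambda>n. ?S (?nr n))"
      using path.rescaled_path[of ?S] by simp
    then have "(\<lambda>t. W_int P B h (xs \<omega>) (as \<omega>) (us \<omega>) (\<lambda>k. mean_inc k \<omega>) (hat_time \<omega> t)) = stepf path.\<tau> ?S"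
      by (simp only: nr)
    moreover have "(path.\<tau>, ?S) \<in> step_codes kap gam (2 * B) (\<lambda>N. 0 + 0 + ?H N * rho8 (1 / kap)) h"
    proof (rule path.step_codesI)
      show "0 \<le> ?H N" for N using \<epsilon> by (intro mult_nonneg_nonneg holder_factor_nonneg holder_const_nonneg) auto
      show "\<bar>?S 0\<bar> \<le> 2 * B" using B0 by simp
      fix N m n :: nat assume N: "real n * h\<^sup>2 \<le> real N" "real m * h\<^sup>2 \<le> real N"
      have "\<omega> \<in> A0" using \<omega> A(2) by blast
      from H[OF this N] show "\<bar>?S n - ?S m\<bar> \<le> 0 * (path.\<tau> n - path.\<tau> m) + 0 * h + ?H N * rho8 (\<bar>real n - real m\<bar> * h\<^sup>2)" by simp
    qed auto
    ultimately show "\<exists>\<tau> v. (\<tau>, v) \<in> step_codes kap gam (2 * B) (\<lambda>N. 0 + 0 + ?H N * rho8 (1 / kap)) h \<and>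
      (\<lambda>t. W_int P B h (xs \<omega>) (as \<omega>) (us \<omega>) (\<lambda>k. mean_inc k \<omega>) (hat_time \<omega> t)) = stepf \<tau> v" by blast
  qed
qed

lemma good_event: "0 < \<epsilon> \<Longrightarrow> \<exists>A\<in>events. 1 - \<epsilon> \<le> prob A \<and> (\<forall>\<omega>\<in>A. good \<omega>)"
  using restrict_to_good[OF sets.top, of \<epsilon>] by (auto simp: prob_space)

lemma z_path:
  assumes "good \<omega>"
  shows "\<exists>\<tau> v. (\<tau>, v) \<in> step_codes kap gam B (\<lambda>N. 1 + 1 + 0 * rho8 (1 / kap)) h \<and>
    (\<lambda>t. z_int P B h (xs \<omega>) (as \<omega>) (us \<omega>) (hat_time \<omega> t)) = stepf \<tau> v"
proof -
  interpret path: chain_path P B h kap gam "xs \<omega>" "as \<omega>" "us \<omega>" by (rule good_path[OF assms])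
  show ?thesis unfolding z_int_def
    using path.reflection_code[OF h0(2), of 1]
      path.rescaled_path[of "\<lambda>n. \<Sum>k\<in>{..n}. if Iidx B h (xs \<omega>) k = 1 then h else 0"] by (intro exI conjI ext) auto
qed

lemma g_path:
  assumes "good \<omega>"
  shows "\<exists>\<tau> v. (\<tau>, v) \<in> step_codes kap gam B (\<lambda>N. 1 + 1 + 0 * rho8 (1 / kap)) h \<and>
    (\<lambda>t. g_int P B h (xs \<omega>) (as \<omega>) (us \<omega>) (hat_time \<omega> t)) = stepf \<tau> v"
proof -
  interpret path: chain_path P B h kap gam "xs \<omega>" "as \<omega>" "us \<omega>" by (rule good_path[OF assms])
  show ?thesis unfolding g_int_def
    using path.reflection_code[OF h0(2), of 2]
      path.rescaled_path[of "\<lambda>n. \<Sum>k\<in>{..n}. if Iidx B h (xs \<omega>) k = 2 then h else 0"] by (intro exI conjI ext) auto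
qed

lemma T_path:
  assumes "good \<omega>"
  shows "\<exists>\<tau> v. (\<tau>, v) \<in> step_codes kap gam B (\<lambda>N. 1 + 0 + 0 * rho8 (1 / kap)) h \<and>
    (\<lambda>t. hat_time \<omega> t) = stepf \<tau> v"
proof -
  interpret path: chain_path P B h kap gam "xs \<omega>" "as \<omega>" "us \<omega>" by (rule good_path[OF assms])
  show ?thesis using path.time_code[of B] path.That_path B0 by (intro exI conjI ext) auto
qed

lemma u_path:
  assumes g: "good \<omega>"
  shows "relaxed_rep (\<lambda>t. u_int P B h (xs \<omega>) (as \<omega>) (us \<omega>) (hat_time \<omega> t)) \<in> unroll ` ctrl_laws (Uset P)"
proof -
  interpret path: chain_path P B h kap gam "xs \<omega>" "as \<omega>" "us \<omega>" by (rule good_path[OF g])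
  have eq: "(\<lambda>t. u_int P B h (xs \<omega>) (as \<omega>) (us \<omega>) (hat_time \<omega> t)) = stepf path.\<tau> (\<lambda>n. u (next_regular B h (xs \<omega>) n) \<omega>)"
    unfolding u_int_def using path.rescaled_path[of "us \<omega>"] by blast
  show ?thesis unfolding eq
  proof (rule relaxed_rep_unrolled[OF path.measurable_stepf _ compact_Uset])
    show "stepf path.\<tau> (\<lambda>n. u (next_regular B h (xs \<omega>) n) \<omega>) t \<in> Uset P" for t
      unfolding stepf_def using g by (intro u_Uset) (simp add: good_def)
  qed
qed

lemma al_component:
  assumes \<epsilon>: "0 < \<epsilon>"
  shows "\<exists>A\<in>events. 1 - \<epsilon> \<le> prob A \<and> (\<forall>\<omega>\<in>A.
    (\<lambda>t. real (al_int P B h (xs \<omega>) (as \<omega>) (us \<omega>) (hat_time \<omega> t))) \<in>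
      (\<lambda>(\<tau>, v). stepf \<tau> v) ` jump_codes (jump_gap kap (q0 / s0) B \<epsilon>) (real (m0 P)))"
proof -
  have k0: "0 < kap" using coeff_signs B0 by simp
  have C0: "0 \<le> q0 / s0" using coeff_signs by simp
  note jg = jump_gap[OF k0 C0 \<epsilon>, where B = B]
  obtain A0 where A0: "A0 \<in> events" "1 - \<epsilon> \<le> prob A0" and
    J: "\<And>\<omega> i. \<omega> \<in> A0 \<Longrightarrow> \<omega> \<in> jump i \<Longrightarrow> jump_gap kap (q0 / s0) B \<epsilon> 0 \<le> real (Suc i) * (kap * h\<^sup>2)"
    "\<And>\<omega> N i j. \<omega> \<in> A0 \<Longrightarrow> i < j \<Longrightarrow> real i * (kap * h\<^sup>2) \<le> real N \<Longrightarrow> \<omega> \<in> jump i \<Longrightarrow> \<omega> \<in> jump j \<Longrightarrow>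
      jump_gap kap (q0 / s0) B \<epsilon> N \<le> real (j - i) * (kap * h\<^sup>2)"
    using jump_event[OF k0 \<epsilon>] by blast
  obtain A where A: "A \<in> events" "A \<subseteq> A0" "1 - \<epsilon> \<le> prob A" "\<And>\<omega>. \<omega> \<in> A \<Longrightarrow> good \<omega>"
    using restrict_to_good[OF A0] by blast
  show ?thesis
  proof (intro bexI[OF _ A(1)] conjI A(3) ballI)
    fix \<omega> assume \<omega>: "\<omega> \<in> A"
    have g: "good \<omega>" by (rule A(4)[OF \<omega>])
    have \<omega>0: "\<omega> \<in> A0" using \<omega> A(2) by blast
    interpret path: chain_path P B h kap gam "xs \<omega>" "as \<omega>" "us \<omega>" by (rule good_path[OF g])
    have jmp: "\<omega> \<in> jump i" if "al (Suc i) \<omega> \<noteq> al i \<omega>" for i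
      using that g by (simp add: jump_def good_def)
    show "(\<lambda>t. real (al_int P B h (xs \<omega>) (as \<omega>) (us \<omega>) (hat_time \<omega> t))) \<in>
      (\<lambda>(\<tau>, v). stepf \<tau> v) ` jump_codes (jump_gap kap (q0 / s0) B \<epsilon>) (real (m0 P))"
      unfolding al_int_def
    proof (rule path.jump_path[OF jg(1,2,3)])
      show "al (Suc n) \<omega> = al n \<omega>" if "Iidx B h (xs \<omega>) n \<noteq> 0" for n
        using good_succs[OF g, of n] that unfolding Iidx_regular
        by (auto simp: regular_def succs_def split: if_splits)
      show "al n \<omega> \<le> m0 P" for n using g by (auto simp: good_def states_def less_imp_le)
    qed (use J[OF \<omega>0] jmp in auto)
  qed
qed

end

theorem theorem6p3:
  fixes P :: model and B :: real
    and M :: "real \<Rightarrow> 'a measure" and F :: "real \<Rightarrow> nat \<Rightarrow> 'a measure"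
    and xi :: "real \<Rightarrow> nat \<Rightarrow> 'a \<Rightarrow> real" and al :: "real \<Rightarrow> nat \<Rightarrow> 'a \<Rightarrow> nat"
    and u :: "real \<Rightarrow> nat \<Rightarrow> 'a \<Rightarrow> ctrl"
  assumes "model_assms P"
    and "0 < B"
    and "\<forall>h\<in>Hset B. approx_chain P B h (M h) (F h) (xi h) (al h) (u h)"
  shows "tight_family (Hset B) M
           (\<lambda>h. rescaled P B h (M h) (F h) (xi h) (al h) (u h)) (jointtop P)"
  proof -
  obtain s0 b0 D0 q0 where cb: "coeff_bounds P B s0 b0 D0 q0" using ex_coeff_bounds[OF assms(1,2)] by blast
  have ch: "controlled_chain P B h (M h) (F h) (xi h) (al h) (u h) s0 b0 D0 q0" if "h \<in> Hset B" for h
    using assms that cb by unfold_locales auto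
  have ps: "prob_space (M h)" if "h \<in> Hset B" for h using assms(3) that by (simp add: approx_chain_def)
  define \<kappa> where "\<kappa> = min (1 / D0) (1 / B)"
  define G where "G = max 1 (B / s0)"
  have s: "0 < s0" "0 \<le> b0" "0 < D0" "0 \<le> q0" using cb by (auto simp: coeff_bounds_def)
  have \<kappa>: "0 < \<kappa>" using s assms(2) by (simp add: \<kappa>_def)
  have G: "0 \<le> G" by (simp add: G_def)
  have r: "0 \<le> rho8 (1 / \<kappa>)" using \<kappa> by (simp add: rho8_nonneg)
  let ?xs = "\<lambda>h \<omega> n. xi h n \<omega>" and ?as = "\<lambda>h \<omega> n. al h n \<omega>" and ?us = "\<lambda>h \<omega> n. u h n \<omega>"
  let ?T = "\<lambda>h \<omega> t. That P B h (?xs h \<omega>) (?as h \<omega>) (?us h \<omega>) (max 0 t)"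
  let ?E = "\<lambda>h \<omega> k. real_cond_exp (M h) (F h k) (\<lambda>\<omega>'. xi h (Suc k) \<omega>' - xi h k \<omega>') \<omega>"
  let ?X = "\<lambda>h \<omega> t. xi_int P B h (?xs h \<omega>) (?as h \<omega>) (?us h \<omega>) (?T h \<omega> t)"
  let ?A = "\<lambda>h \<omega> t. real (al_int P B h (?xs h \<omega>) (?as h \<omega>) (?us h \<omega>) (?T h \<omega> t))"
  let ?m = "\<lambda>h \<omega>. relaxed_rep (\<lambda>t. u_int P B h (?xs h \<omega>) (?as h \<omega>) (?us h \<omega>) (?T h \<omega> t))"
  let ?W = "\<lambda>h \<omega> t. W_int P B h (?xs h \<omega>) (?as h \<omega>) (?us h \<omega>) (?E h \<omega>) (?T h \<omega> t)"
  let ?z = "\<lambda>h \<omega> t. z_int P B h (?xs h \<omega>) (?as h \<omega>) (?us h \<omega>) (?T h \<omega> t)"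
  let ?g = "\<lambda>h \<omega> t. g_int P B h (?xs h \<omega>) (?as h \<omega>) (?us h \<omega>) (?T h \<omega> t)"
  have tX: "tight_family (Hset B) M ?X Dtop"
  proof (rule tight_family_step_paths[OF \<kappa> G assms(2)])
    fix \<epsilon> :: real assume \<epsilon>: "0 < \<epsilon>"
    let ?L = "\<lambda>N. (b0 + 1) + 2 + holder_factor * holder_const (4 * (1 * controlled_chain.noise_bound B s0 b0) ^ 4) B \<epsilon> N * rho8 (1 / \<kappa>)"
    show "\<exists>L. (\<forall>N. 0 \<le> L N) \<and> (\<forall>h\<in>Hset B. \<exists>A\<in>sets (M h). 1 - \<epsilon> \<le> measure (M h) A \<and>
        (\<forall>\<omega>\<in>A. \<exists>\<tau> v. (\<tau>, v) \<in> step_codes \<kappa> G (2 * B) L h \<and> ?X h \<omega> = stepf \<tau> v))"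
    proof (rule exI[of _ ?L], intro conjI allI ballI)
      show "0 \<le> ?L N" for N
        using s \<epsilon> r by (intro add_nonneg_nonneg mult_nonneg_nonneg holder_factor_nonneg holder_const_nonneg) auto
      show "\<exists>A\<in>sets (M h). 1 - \<epsilon> \<le> measure (M h) A \<and>
        (\<forall>\<omega>\<in>A. \<exists>\<tau> v. (\<tau>, v) \<in> step_codes \<kappa> G (2 * B) ?L h \<and> ?X h \<omega> = stepf \<tau> v)" if "h \<in> Hset B" for h
        unfolding \<kappa>_def G_def by (rule controlled_chain.xi_component[OF ch[OF that] \<epsilon>])
    qed
  qed
  have tW: "tight_family (Hset B) M ?W Dtop"
  proof (rule tight_family_step_paths[OF \<kappa> G assms(2)])
    fix \<epsilon> :: real assume \<epsilon>: "0 < \<epsilon>"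
    let ?L = "\<lambda>N. 0 + 0 + holder_factor * holder_const (4 * (1 / sqrt s0 * controlled_chain.noise_bound B s0 b0) ^ 4) B \<epsilon> N * rho8 (1 / \<kappa>)"
    show "\<exists>L. (\<forall>N. 0 \<le> L N) \<and> (\<forall>h\<in>Hset B. \<exists>A\<in>sets (M h). 1 - \<epsilon> \<le> measure (M h) A \<and>
        (\<forall>\<omega>\<in>A. \<exists>\<tau> v. (\<tau>, v) \<in> step_codes \<kappa> G (2 * B) L h \<and> ?W h \<omega> = stepf \<tau> v))"
    proof (rule exI[of _ ?L], intro conjI allI ballI)
      show "0 \<le> ?L N" for N
        using \<epsilon> r by (intro add_nonneg_nonneg mult_nonneg_nonneg holder_factor_nonneg holder_const_nonneg) auto
      show "\<exists>A\<in>sets (M h). 1 - \<epsilon> \<le> measure (M h) A \<and>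
        (\<forall>\<omega>\<in>A. \<exists>\<tau> v. (\<tau>, v) \<in> step_codes \<kappa> G (2 * B) ?L h \<and> ?W h \<omega> = stepf \<tau> v)" if "h \<in> Hset B" for h
        using controlled_chain.W_component[OF ch[OF that] \<epsilon>]
        unfolding \<kappa>_def G_def controlled_chain.mean_inc_def[OF ch[OF that]] .
    qed
  qed
  \<comment> \<open>For the reflection terms and the time change the estimate holds on every good
    path with one constant, so the exceptional event is just a null set.\<close>
  have pathwise: "tight_family (Hset B) M Y Dtop"
    if L: "0 \<le> L" and Y: "\<And>h \<omega>. h \<in> Hset B \<Longrightarrow>
        controlled_chain.good P B h (M h) (F h) (xi h) (al h) (u h) b0 \<omega> \<Longrightarrow>
        \<exists>\<tau> v. (\<tau>, v) \<in> step_codes \<kappa> G B (\<lambda>N. L) h \<and> Y h \<omega> = stepf \<tau> v"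
    for L and Y :: "real \<Rightarrow> 'a \<Rightarrow> real \<Rightarrow> real"
  proof (rule tight_family_step_paths[OF \<kappa> G assms(2)])
    fix \<epsilon> :: real assume \<epsilon>: "0 < \<epsilon>"
    show "\<exists>L. (\<forall>N. 0 \<le> L N) \<and> (\<forall>h\<in>Hset B. \<exists>A\<in>sets (M h). 1 - \<epsilon> \<le> measure (M h) A \<and>
        (\<forall>\<omega>\<in>A. \<exists>\<tau> v. (\<tau>, v) \<in> step_codes \<kappa> G B L h \<and> Y h \<omega> = stepf \<tau> v))"
      using L controlled_chain.good_event[OF ch \<epsilon>] Y by (intro exI[of _ "\<lambda>N. L"]) meson
  qed
  have tz: "tight_family (Hset B) M ?z Dtop"
    using pathwise[of 2 ?z] controlled_chain.z_path[OF ch] by (simp add: \<kappa>_def G_def)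
  have tg: "tight_family (Hset B) M ?g Dtop"
    using pathwise[of 2 ?g] controlled_chain.g_path[OF ch] by (simp add: \<kappa>_def G_def)
  have tT: "tight_family (Hset B) M ?T Dtop"
    using pathwise[of 1 ?T] controlled_chain.T_path[OF ch] by (simp add: \<kappa>_def G_def)
  have tA: "tight_family (Hset B) M ?A Dtop"
    unfolding tight_family_def
  proof (intro allI impI)
    fix \<epsilon> :: real assume \<epsilon>: "0 < \<epsilon>"
    let ?K = "(\<lambda>(\<tau>, v). stepf \<tau> v) ` jump_codes (jump_gap \<kappa> (q0 / s0) B \<epsilon>) (real (m0 P))"
    have "compactin Dtop ?K" by (rule compactin_jump_codes) (use jump_gap(1)[OF \<kappa>] s \<epsilon> in simp)
    moreover have "\<exists>A\<in>sets (M h). A \<subseteq> {\<omega> \<in> space (M h). ?A h \<omega> \<in> ?K} \<and> 1 - \<epsilon> \<le> measure (M h) A" if hH: "h \<in> Hset B" for h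
    proof -
      obtain A where A: "A \<in> sets (M h)" "1 - \<epsilon> \<le> measure (M h) A" "\<forall>\<omega>\<in>A. ?A h \<omega> \<in> ?K"
        using controlled_chain.al_component[OF ch[OF hH] \<epsilon>] unfolding \<kappa>_def by blast
      then show ?thesis using sets.sets_into_space[OF A(1)] by (intro bexI[OF _ A(1)]) auto
    qed
    ultimately show "\<exists>K. compactin Dtop K \<and> (\<forall>h\<in>Hset B. \<exists>A\<in>sets (M h).
        A \<subseteq> {\<omega> \<in> space (M h). ?A h \<omega> \<in> K} \<and> 1 - \<epsilon> \<le> measure (M h) A)" by blast
  qed
  have tm: "tight_family (Hset B) M ?m (Rtop P)"
    unfolding tight_family_def
  proof (intro allI impI)
    fix \<epsilon> :: real assume \<epsilon>: "0 < \<epsilon>"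
    let ?K = "unroll ` ctrl_laws (Uset P)"
    \<comment> \<open>\<open>B\<close> is itself an admissible mesh. Its probability space is
      nonempty, and a control evaluated there shows that \<open>Uset P\<close> is nonempty.\<close>
    have BH: "B \<in> Hset B" using assms(2) by (auto simp: Hset_def intro: exI[of _ 1])
    have "space (M B) \<noteq> {}" using ps[OF BH] by (rule prob_space.not_empty)
    then have "Uset P \<noteq> {}" using assms(3) BH by (fastforce simp: approx_chain_def)
    then have "compactin (Rtop P) ?K" by (rule compact_unrolled_controls[OF compact_Uset])
    moreover have "\<exists>A\<in>sets (M h). A \<subseteq> {\<omega> \<in> space (M h). ?m h \<omega> \<in> ?K} \<and> 1 - \<epsilon> \<le> measure (M h) A" if hH: "h \<in> Hset B" for h
    proof -
      obtain A where A: "A \<in> sets (M h)" "1 - \<epsilon> \<le> measure (M h) A"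
        "\<forall>\<omega>\<in>A. controlled_chain.good P B h (M h) (F h) (xi h) (al h) (u h) b0 \<omega>"
        using controlled_chain.good_event[OF ch[OF hH] \<epsilon>] by blast
      then have "\<forall>\<omega>\<in>A. ?m h \<omega> \<in> ?K" using controlled_chain.u_path[OF ch[OF hH]] by blast
      then show ?thesis using A sets.sets_into_space[OF A(1)] by (intro bexI[OF _ A(1)]) auto
    qed
    ultimately show "\<exists>K. compactin (Rtop P) K \<and> (\<forall>h\<in>Hset B. \<exists>A\<in>sets (M h).
        A \<subseteq> {\<omega> \<in> space (M h). ?m h \<omega> \<in> K} \<and> 1 - \<epsilon> \<le> measure (M h) A)" by blast
  qed
  have "tight_family (Hset B) M (\<lambda>h \<omega>. (?X h \<omega>, ?A h \<omega>, ?m h \<omega>, ?W h \<omega>, ?z h \<omega>, ?g h \<omega>, ?T h \<omega>)) (jointtop P)"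
    unfolding jointtop_def by (intro tight_family_prod ps tX tA tm tW tz tg tT)
  moreover have "(\<lambda>h. rescaled P B h (M h) (F h) (xi h) (al h) (u h)) =
      (\<lambda>h \<omega>. (?X h \<omega>, ?A h \<omega>, ?m h \<omega>, ?W h \<omega>, ?z h \<omega>, ?g h \<omega>, ?T h \<omega>))"
    by (intro ext) (simp only: rescaled_def Let_def)
  ultimately show ?thesis by (simp only:)
qed

end
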